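(* Let $X=(X,d,\mu)$ be a complete metric measure space with a doubling measure $\mu$, let $1<p<\infty$, and suppose $X$ supports a weak $(1,p)$-Poincaré inequality. Let $\Omega\subset X$ be open and $\beta\le 0$. Suppose there exist an exponent $0\le t<p-\beta$ and a constant $C_0>0$ such that \[ \mathscr H^t_{d_\Omega(x)}\big(\partial\Omega\cap\overline B(x,2d_\Omega(x))\big)\ge C_0\,\mu\big(\overline B(x,d_\Omega(x))\big)\,d_\Omega(x)^{-t}\quad\text{for all }x\in\Omega. \] Then $\Omega$ admits the pointwise $(p,\beta)$-Hardy inequality.
   Context: $(X,d,\mu)$: complete metric space with Borel regular outer measure $\mu$, $0<\mu(B)<\infty$ for balls, doubling: $\mu(B(x,2r))\le C_d\mu(B(x,r))$. $d_\Omega(x)=d(x,\partial\Omega)$. Upper gradient of $u$ on $\Omega$: Borel $g\ge0$ with $|u(x)-u(y)|\le\int_\gamma g\,ds$ for all rectifiable curves $\gamma$ in $\Omega$ joining $x,y$. Weak $(1,p)$-Poincaré inequality: there are $C_P>0,\tau\ge1$ with $\frac{1}{\mu(B)}\int_B|u-u_B|\,d\mu\le C_P r\big(\frac1{\mu(\tau B)}\int_{\tau B}g_u^p\,d\mu\big)^{1/p}$ for all balls $B$ of radius $r$, continuous $u$, upper gradients $g_u$. $\operatorname{Lip}_0(\Omega)$: Lipschitz functions with compact support in $\Omega$. $\mathscr H^t_R(E)=\inf\{\sum_i\mu(B(x_i,r_i))r_i^{-t}: E\subset\bigcup_iB(x_i,r_i),\ r_i\le R\}$. Restricted maximal function: $M_Rf(x)=\sup_{0<r\le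 R}\frac{1}{\mu(B(x,r))}\int_{B(x,r)}|f|\,d\mu$. $\Omega$ admits the pointwise $(p,\beta)$-Hardy inequality if there exist $1<q<p$, $C>0$, $L\ge1$ such that for every $u\in\operatorname{Lip}_0(\Omega)$, every upper gradient $g_u$ of $u$ and every $x\in\Omega$, $|u(x)|\le C\,d_\Omega(x)^{1-\beta/p}\big(M_{Ld_\Omega(x)}(g_u^q d_\Omega^{\beta q/p})(x)\big)^{1/q}$. *)

theory Defs
  imports "HOL-Analysis.Analysis"
begin

text \<open>Power of an extended nonnegative real with a positive real exponent
  (only used with exponents e > 0): \<infinity>^e = \<infinity>, a^e as usual otherwise.\<close>
definition epowr :: "ennreal \<Rightarrow> real \<Rightarrow> ennreal" where
  "epowr a e = (if a = top then top else ennreal (enn2real a powr e))"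

definition curve_length :: "(real \<Rightarrow> 'a::metric_space) \<Rightarrow> real \<Rightarrow> real \<Rightarrow> ennreal" where
  "curve_length \<gamma> a b =
     (SUP (n, s) \<in> {(n::nat, s::nat \<Rightarrow> real). s 0 = a \<and> s n = b \<and> (\<forall>i<n. s i \<le> s (Suc i))}.
        ennreal (\<Sum>i<n. dist (\<gamma> (s i)) (\<gamma> (s (Suc i)))))"

text \<open>Rectifiable curves, represented by their arc-length parametrisation
  \<gamma> : [0,l] \<rightarrow> X (every rectifiable curve has one, with the same endpoints,
  image and line integrals).\<close>
definition arclength_curve :: "(real \<Rightarrow> 'a::metric_space) \<Rightarrow> real \<Rightarrow> bool" where
  "arclength_curve \<gamma> l \<longleftrightarrow> 0 \<le> l \<and>
     (\<forall>s t. 0 \<le> s \<and> s \<le> t \<and> t \<le> l \<longrightarrow> curve_length \<gamma> s t = ennreal (t - s))"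

definition upper_gradient_on ::
    "'a::metric_space set \<Rightarrow> ('a \<Rightarrow> real) \<Rightarrow> ('a \<Rightarrow> ennreal) \<Rightarrow> bool" where
  "upper_gradient_on \<Omega> u g \<longleftrightarrow> g \<in> borel_measurable borel \<and>
     (\<forall>\<gamma> l. arclength_curve \<gamma> l \<and> \<gamma> ` {0..l} \<subseteq> \<Omega> \<longrightarrow>
        ennreal \<bar>u (\<gamma> 0) - u (\<gamma> l)\<bar> \<le> (\<integral>\<^sup>+ s. g (\<gamma> s) * indicator {0..l} s \<partial>lborel))"

definition doubling_measure :: "'a::metric_space measure \<Rightarrow> bool" where
  "doubling_measure \<mu> \<longleftrightarrow>
     (\<forall>x r. 0 < r \<longrightarrow> 0 < emeasure \<mu> (ball x r) \<and> emeasure \<mu> (ball x r) < \<infinity>) \<and>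
     (\<exists>Cd. \<forall>x r. 0 < r \<longrightarrow> emeasure \<mu> (ball x (2 * r)) \<le> ennreal Cd * emeasure \<mu> (ball x r))"

definition weak_poincare :: "'a::metric_space measure \<Rightarrow> real \<Rightarrow> bool" where
  "weak_poincare \<mu> p \<longleftrightarrow> (\<exists>CP \<tau>. CP > 0 \<and> \<tau> \<ge> 1 \<and>
     (\<forall>x r u g. 0 < r \<and> continuous_on UNIV u \<and> upper_gradient_on UNIV u g \<longrightarrow>
        (let uB = (\<integral>y. u y * indicator (ball x r) y \<partial>\<mu>) / measure \<mu> (ball x r) in
          (\<integral>\<^sup>+ y. ennreal \<bar>u y - uB\<bar> * indicator (ball x r) y \<partial>\<mu>) / emeasure \<mu> (ball x r)
          \<le> ennreal (CP * r) *
            epowr ((\<integral>\<^sup>+ y. epowr (g y) p * indicator (ball x (\<tau> * r)) y \<partial>\<mu>)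
                     / emeasure \<mu> (ball x (\<tau> * r))) (1 / p))))"

definition dist_bdry :: "'a::metric_space set \<Rightarrow> 'a \<Rightarrow> real" where
  "dist_bdry \<Omega> x = infdist x (frontier \<Omega>)"

text \<open>Codimension-t Hausdorff content at scale R (countable covers by balls;
  radius 0 = empty ball allows finite covers).\<close>
definition haus_content :: "'a::metric_space measure \<Rightarrow> real \<Rightarrow> real \<Rightarrow> 'a set \<Rightarrow> ennreal" where
  "haus_content \<mu> t R E =
     (INF (c, r) \<in> {(c::nat \<Rightarrow> 'a, r::nat \<Rightarrow> real). (\<forall>i. 0 \<le> r i \<and> r i \<le> R) \<and>
                                             E \<subseteq> (\<Union>i. ball (c i) (r i))}.
        (\<Sum>i. emeasure \<mu> (ball (c i) (r i)) * ennreal (r i powr (- t))))"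

definition max_fun :: "'a::metric_space measure \<Rightarrow> real \<Rightarrow> ('a \<Rightarrow> ennreal) \<Rightarrow> 'a \<Rightarrow> ennreal" where
  "max_fun \<mu> R f x =
     (SUP r \<in> {0<..R}. (\<integral>\<^sup>+ y. f y * indicator (ball x r) y \<partial>\<mu>) / emeasure \<mu> (ball x r))"

definition Lip0 :: "'a::metric_space set \<Rightarrow> ('a \<Rightarrow> real) set" where
  "Lip0 \<Omega> = {u. (\<exists>L. L-lipschitz_on UNIV u) \<and> compact (closure {x. u x \<noteq> 0})
                 \<and> closure {x. u x \<noteq> 0} \<subseteq> \<Omega>}"

definition pointwise_hardy :: "'a::metric_space measure \<Rightarrow> 'a set \<Rightarrow> real \<Rightarrow> real \<Rightarrow> bool" where
  "pointwise_hardy \<mu> \<Omega> p \<beta> \<longleftrightarrow> (\<exists>q C L. 1 < q \<and> q < p \<and> C > 0 \<and> L \<ge> 1 \<and>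
     (\<forall>u g x. u \<in> Lip0 \<Omega> \<and> upper_gradient_on \<Omega> u g \<and> x \<in> \<Omega> \<longrightarrow>
        ennreal \<bar>u x\<bar> \<le> ennreal (C * dist_bdry \<Omega> x powr (1 - \<beta> / p)) *
          epowr (max_fun \<mu> (L * dist_bdry \<Omega> x)
                   (\<lambda>y. epowr (g y) q * ennreal (dist_bdry \<Omega> y powr (\<beta> * q / p)) * indicator \<Omega> y) x)
                (1 / q)))"

end

theory Submission
  imports Defs
begin

text \<open>
  The exponent \<open>q < p\<close> in the Hardy inequality comes from the Keith--Zhong self-improvement of the
  Poincare inequality, carried out here in pointwise form. Let \<open>A\<close> be the best constant in
  \<open>\<bar>u x - u y\<bar> \<le> A s d(x,y)\<close>, where the maximal function of \<open>g\<^sup>q\<close> is at most \<open>s\<^sup>q\<close> at \<open>x\<close> and \<open>y\<close>.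
  On the set \<open>F\<^sub>i\<close> where it is at most \<open>(2\<^sup>i s)\<^sup>q\<close>, \<open>u\<close> is \<open>2\<^sup>i A s\<close>-Lipschitz; averaging the McShane
  extensions of \<open>u\<close> from \<open>F\<^sub>1, \<dots>, F\<^sub>N\<close> gives a function with the same values at \<open>x\<close> and \<open>y\<close> and with an
  upper gradient whose \<open>p\<close>-th power has, by the weak type estimate, averages at most
  \<open>C (A / N + 1)\<^sup>p N s\<^sup>p\<close>, provided \<open>q\<close> is close to \<open>p\<close>. The \<open>p\<close>-Poincare inequality then yields
  \<open>A \<le> C N powr (1 / p - 1) A + C'\<close>, and since \<open>p > 1\<close> a large \<open>N\<close> bounds \<open>A\<close> in terms of the data alone.

  Gluing needs bounded upper gradients. A general upper gradient is first dominated by an increasing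
  limit of bounded continuous \<open>g\<^sub>n\<close> (Vitali--Caratheodory); the estimate is applied to the potentials
  given by the \<open>g\<^sub>n\<close>-cost of chains with mesh tending to zero, and if it failed in the limit, cheap
  chains would converge to a curve contradicting the upper gradient inequality. This is where
  completeness enters.

  For the Hardy inequality, \<open>u\<close> vanishes at every boundary point \<open>w\<close>. If \<open>\<bar>u x\<bar>\<close> were large, telescoping
  over balls shrinking to \<open>w\<close> would give for each \<open>w\<close> near \<open>x\<close> a ball on which the weighted integral of
  \<open>g\<^sup>q\<close> is large compared with \<open>\<mu>(B) r powr -t\<close>, and a covering argument contradicts the lower bound
  for the Hausdorff content.
\<close>

section \<open>Curves and upper gradients\<close>

text \<open>Absorbing \<open>A\<close> presupposes a finite \<open>A\<close>: therefore
  \<open>g\<close> is kept above some \<open>\<kappa> > 0\<close>, which makes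
  \<open>L / \<kappa>\<close> admissible at the start, and repeated halving then removes every trace
  of \<open>L\<close> and \<open>\<kappa>\<close>. A single McShane extension would only reproduce a
  multiple of \<open>A\<close>. With \<open>N\<close> nested sets, a point outside the
  \<open>j\<close>-th but inside the next one pays the slopes \<open>A 2^i s\<close> for
  \<open>i \<le> j\<close> only; this sum is geometric, so averaging really divides \<open>A\<close>
  by \<open>N\<close>, while every level contributes about the same to the integral of the
  \<open>p\<close>-th power. Goodness is a global condition, so a local estimate needs a cut-off.
  Its slope enters the upper gradient, and the dilation \<open>\<Lambda> = 1 + 16 A\<close> makes
  that slope absorbable. The local estimate is recorded as small oscillation on a set of almost full
  measure: such sets in consecutive balls intersect, which is all that telescoping requires. Finally
  \<open>\<beta> \<le> 0\<close> bounds the weight below on a ball by a power of its largest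
  boundary distance, and \<open>t < p - \<beta>\<close> leaves room for \<open>q < p\<close> with
  \<open>t < q (1 - \<beta> / p)\<close>, which makes the telescoping series at a boundary point
  converge.\<close>

lemma curve_length_ge_sum:
  assumes "s 0 = a" "s n = b" "\<And>i. i < n \<Longrightarrow> s i \<le> s (Suc i)"
  shows "ennreal (\<Sum>i<n. dist (\<gamma> (s i)) (\<gamma> (s (Suc i)))) \<le> curve_length \<gamma> a b"
  unfolding curve_length_def
  by (rule SUP_upper2[where i="(n, s)"]) (use assms in auto)

lemma curve_length_le:
  assumes "\<And>n s. s 0 = a \<Longrightarrow> s n = b \<Longrightarrow> (\<forall>i<n. s i \<le> s (Suc i)) \<Longrightarrow>
     ennreal (\<Sum>i<n. dist (\<gamma> (s i)) (\<gamma> (s (Suc i)))) \<le> c"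
  shows "curve_length \<gamma> a b \<le> c"
  unfolding curve_length_def by (rule SUP_least) (use assms in auto)

lemma curve_length_ge_dist:
  assumes "a \<le> b" shows "ennreal (dist (\<gamma> a) (\<gamma> b)) \<le> curve_length \<gamma> a b"
  using curve_length_ge_sum[of "\<lambda>i. if i = 0 then a else b" a 1 b \<gamma>] assms by auto

lemma partition_mono:
  fixes s :: "nat \<Rightarrow> real"
  assumes "\<forall>i<n. s i \<le> s (Suc i)" "i \<le> j" "j \<le> n"
  shows "s i \<le> s j"
  using assms(2,3)
proof (induction j rule: dec_induct)
  case (step k)
  then show ?case using assms(1) by (meson Suc_le_lessD less_imp_le order_trans)
qed simp

lemma arclength_dist_le:
  assumes "arclength_curve \<gamma> l" "s \<in> {0..l}" "t \<in> {0..l}"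
  shows "dist (\<gamma> s) (\<gamma> t) \<le> \<bar>s - t\<bar>"
proof -
  have *: "dist (\<gamma> a) (\<gamma> b) \<le> b - a" if "0 \<le> a" "a \<le> b" "b \<le> l" for a b
  proof -
    have "ennreal (dist (\<gamma> a) (\<gamma> b)) \<le> ennreal (b - a)"
      using curve_length_ge_dist[of a b \<gamma>] assms(1) that by (auto simp: arclength_curve_def)
    then show ?thesis using that by (simp add: ennreal_le_iff)
  qed
  show ?thesis
    using *[of s t] *[of t s] assms by (cases "s \<le> t") (auto simp: dist_commute)
qed

text \<open>A curve is controlled only on \<open>[0, l]\<close>. Freezing it outside gives a
  continuous map on the whole line, whose compositions with Borel functions are Borel.\<close>

definition clamp_to :: "real \<Rightarrow> real \<Rightarrow> real" where
  "clamp_to l s = max 0 (min l s)"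

lemma clamp_to_in: "0 \<le> l \<Longrightarrow> clamp_to l s \<in> {0..l}"
  by (auto simp: clamp_to_def)

lemma clamp_to_id: "s \<in> {0..l} \<Longrightarrow> clamp_to l s = s"
  by (auto simp: clamp_to_def)

lemma arclength_clamp_continuous:
  assumes "arclength_curve \<gamma> l"
  shows "continuous_on UNIV (\<lambda>s. \<gamma> (clamp_to l s))"
proof -
  have l: "0 \<le> l" using assms by (simp add: arclength_curve_def)
  have "dist (\<gamma> (clamp_to l s)) (\<gamma> (clamp_to l t)) \<le> 1 * dist s t" for s t
  proof -
    have "dist (\<gamma> (clamp_to l s)) (\<gamma> (clamp_to l t)) \<le> \<bar>clamp_to l s - clamp_to l t\<bar>"
      by (rule arclength_dist_le[OF assms clamp_to_in[OF l] clamp_to_in[OF l]])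
    also have "\<dots> \<le> 1 * dist s t" by (auto simp: clamp_to_def dist_real_def)
    finally show ?thesis .
  qed
  then have "1-lipschitz_on UNIV (\<lambda>s. \<gamma> (clamp_to l s))" by (auto intro: lipschitz_onI)
  then show ?thesis by (rule lipschitz_on_continuous_on)
qed

lemma clamp_measurable:
  assumes "arclength_curve \<gamma> l" and [measurable]: "g \<in> borel_measurable borel"
  shows "(\<lambda>s. g (\<gamma> (clamp_to l s))) \<in> borel_measurable borel"
proof -
  have [measurable]: "(\<lambda>s. \<gamma> (clamp_to l s)) \<in> borel_measurable borel"
    by (rule borel_measurable_continuous_onI[OF arclength_clamp_continuous[OF assms(1)]])
  show ?thesis by measurable
qed

lemma integral_clamp:
  assumes "0 \<le> a" "b \<le> l"
  shows "(\<integral>\<^sup>+s\<in>{a..b}. g (\<gamma> (clamp_to l s)) \<partial>lborel)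
       = (\<integral>\<^sup>+s\<in>{a..b}. g (\<gamma> s) \<partial>lborel)"
  by (rule nn_integral_cong) (use assms in \<open>auto simp: indicator_def clamp_to_def\<close>)

lemma nn_integral_Icc_add_le:
  fixes H :: "real \<Rightarrow> ennreal"
  assumes [measurable]: "H \<in> borel_measurable borel" and "a \<le> b" "b \<le> c"
  shows "(\<integral>\<^sup>+s\<in>{a..b}. H s \<partial>lborel) + (\<integral>\<^sup>+s\<in>{b..c}. H s \<partial>lborel)
      \<le> (\<integral>\<^sup>+s\<in>{a..c}. H s \<partial>lborel)"
proof -
  have "(\<integral>\<^sup>+s\<in>{a..b}. H s \<partial>lborel) = (\<integral>\<^sup>+s\<in>{a..<b}. H s \<partial>lborel)"
    by (rule nn_integral_cong_AE) (use AE_lborel_singleton[of b] in \<open>auto simp: indicator_def\<close>)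
  then have "?thesis \<longleftrightarrow> (\<integral>\<^sup>+s. H s * indicator {a..<b} s + H s * indicator {b..c} s \<partial>lborel)
      \<le> (\<integral>\<^sup>+s\<in>{a..c}. H s \<partial>lborel)"
    by (simp add: nn_integral_add)
  also have \<dots>
    by (rule nn_integral_mono) (use assms in \<open>auto simp: indicator_def\<close>)
  finally show ?thesis .
qed

text \<open>Over a partition of \<open>[0, l]\<close> the left side is subadditive and the right
  side additive. Upper gradient inequalities thus need checking only on short arcs, where uniform
  continuity or closeness to a set can be exploited.\<close>

lemma local_to_global:
  fixes H :: "real \<Rightarrow> ennreal" and \<phi> :: "real \<Rightarrow> real"
  assumes H: "H \<in> borel_measurable borel" and l: "0 \<le> l" and \<delta>: "0 < \<delta>"
    and loc: "\<And>a b. 0 \<le> a \<Longrightarrow> a \<le> b \<Longrightarrow> b \<le> l \<Longrightarrow> b - a \<le> \<delta> \<Longrightarrow>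
        ennreal \<bar>\<phi> a - \<phi> b\<bar> \<le> (\<integral>\<^sup>+s\<in>{a..b}. H s \<partial>lborel)"
  shows "ennreal \<bar>\<phi> 0 - \<phi> l\<bar> \<le> (\<integral>\<^sup>+s\<in>{0..l}. H s \<partial>lborel)"
proof -
  obtain n :: nat where n: "l / \<delta> < real n" using reals_Archimedean2 by blast
  moreover have "0 \<le> l / \<delta>" using l \<delta> by simp
  ultimately have n0: "0 < n" by (cases n) auto
  define t where "t k = l * real k / real n" for k
  have step: "t (Suc k) - t k \<le> \<delta>" for k
  proof -
    have "t (Suc k) - t k = l / real n" by (simp add: t_def distrib_left add_divide_distrib)
    also have "\<dots> \<le> \<delta>" using n n0 \<delta> by (simp add: field_simps)
    finally show ?thesis .
  qed
  have tmono: "t k \<le> t (Suc k)" for k using l n0 by (simp add: t_def divide_right_mono mult_left_mono)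
  have t0: "0 \<le> t k" for k using l by (simp add: t_def)
  have tl: "t k \<le> l" if "k \<le> n" for k
  proof -
    have "l * real k \<le> l * real n" using that l by (simp add: mult_left_mono)
    then show ?thesis using n0 by (simp add: t_def field_simps)
  qed
  have "k \<le> n \<Longrightarrow> ennreal \<bar>\<phi> 0 - \<phi> (t k)\<bar> \<le> (\<integral>\<^sup>+s\<in>{0..t k}. H s \<partial>lborel)" for k
  proof (induction k)
    case 0
    then show ?case by (simp add: t_def)
  next
    case (Suc k)
    have "ennreal \<bar>\<phi> 0 - \<phi> (t (Suc k))\<bar> \<le> ennreal (\<bar>\<phi> 0 - \<phi> (t k)\<bar> + \<bar>\<phi> (t k) - \<phi> (t (Suc k))\<bar>)"
      by (rule ennreal_leI) auto
    also have "\<dots> = ennreal \<bar>\<phi> 0 - \<phi> (t k)\<bar> + ennreal \<bar>\<phi> (t k) - \<phi> (t (Suc k))\<bar>" by simp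
    also have "\<dots> \<le> (\<integral>\<^sup>+s\<in>{0..t k}. H s \<partial>lborel)
        + (\<integral>\<^sup>+s\<in>{t k..t (Suc k)}. H s \<partial>lborel)"
      by (rule add_mono[OF Suc.IH loc]) (use Suc.prems t0 tmono tl step in auto)
    also have "\<dots> \<le> (\<integral>\<^sup>+s\<in>{0..t (Suc k)}. H s \<partial>lborel)"
      by (rule nn_integral_Icc_add_le[OF H t0 tmono])
    finally show ?case .
  qed
  from this[of n] show ?thesis using n0 by (simp add: t_def)
qed

section \<open>Upper gradients along subarcs, zero extension, truncation and gluing\<close>

lemma arclength_subcurve:
  assumes \<gamma>: "arclength_curve \<gamma> l" and ab: "0 \<le> a" "a \<le> b" "b \<le> l"
  shows "arclength_curve (\<lambda>s. \<gamma> (a + s)) (b - a)"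
proof -
  have "curve_length (\<lambda>s. \<gamma> (a + s)) s t = ennreal (t - s)"
    if st: "0 \<le> s" "s \<le> t" "t \<le> b - a" for s t
  proof -
    have "curve_length (\<lambda>s. \<gamma> (a + s)) s t = curve_length \<gamma> (a + s) (a + t)"
    proof (rule antisym; rule curve_length_le)
      fix n p assume "p 0 = s" "p n = t" "\<forall>i<n. p i \<le> p (Suc i)"
      then show "ennreal (\<Sum>i<n. dist (\<gamma> (a + p i)) (\<gamma> (a + p (Suc i)))) \<le> curve_length \<gamma> (a + s) (a + t)"
        using curve_length_ge_sum[of "\<lambda>i. a + p i" "a + s" n "a + t" \<gamma>] by auto
    next
      fix n p assume "p 0 = a + s" "p n = a + t" "\<forall>i<n. p i \<le> p (Suc i)"
      then show "ennreal (\<Sum>i<n. dist (\<gamma> (p i)) (\<gamma> (p (Suc i)))) \<le> curve_length (\<lambda>s. \<gamma> (a + s)) s t"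
        using curve_length_ge_sum[of "\<lambda>i. p i - a" s n t "\<lambda>s. \<gamma> (a + s)"] by auto
    qed
    also have "\<dots> = ennreal ((a + t) - (a + s))"
      using \<gamma> st ab by (auto simp: arclength_curve_def)
    finally show ?thesis by simp
  qed
  then show ?thesis using ab by (auto simp: arclength_curve_def)
qed

lemma upper_gradient_interval:
  assumes ug: "upper_gradient_on \<Omega> u g" and \<gamma>: "arclength_curve \<gamma> l"
    and ab: "0 \<le> a" "a \<le> b" "b \<le> l" and sub: "\<gamma> ` {a..b} \<subseteq> \<Omega>"
  shows "ennreal \<bar>u (\<gamma> a) - u (\<gamma> b)\<bar> \<le> (\<integral>\<^sup>+s\<in>{a..b}. g (\<gamma> s) \<partial>lborel)"
proof -
  have [measurable]: "g \<in> borel_measurable borel" using ug by (simp add: upper_gradient_on_def)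
  note [measurable] = clamp_measurable[OF \<gamma>, of g]
  have "(\<lambda>s. \<gamma> (a + s)) ` {0..b - a} \<subseteq> \<Omega>" using sub ab by (auto simp: image_subset_iff)
  then have "ennreal \<bar>u (\<gamma> (a + 0)) - u (\<gamma> (a + (b - a)))\<bar>
      \<le> (\<integral>\<^sup>+s\<in>{0..b - a}. g (\<gamma> (a + s)) \<partial>lborel)"
    using ug arclength_subcurve[OF \<gamma> ab] unfolding upper_gradient_on_def by blast
  also have "\<dots> = (\<integral>\<^sup>+s. g (\<gamma> (clamp_to l (a + 1 * s))) * indicator {a..b} (a + 1 * s) \<partial>lborel)"
    by (rule nn_integral_cong) (use ab in \<open>auto simp: indicator_def clamp_to_def\<close>)
  also have "\<dots> = (\<integral>\<^sup>+s\<in>{a..b}. g (\<gamma> (clamp_to l s)) \<partial>lborel)"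
    using nn_integral_real_affine[of "\<lambda>s. g (\<gamma> (clamp_to l s)) * indicator {a..b} s" 1 a] by simp
  also have "\<dots> = (\<integral>\<^sup>+s\<in>{a..b}. g (\<gamma> s) \<partial>lborel)"
    by (rule integral_clamp) (use ab in auto)
  finally show ?thesis by simp
qed

text \<open>A curve that leaves \<open>U\<close> has a first and a last time outside it, and
  \<open>v\<close> vanishes at both. The end values are therefore controlled by the initial and the
  final arc, which run inside \<open>U\<close>; excursions in between cost nothing.\<close>

lemma upper_gradient_zero_extension:
  fixes v :: "'a::metric_space \<Rightarrow> real"
  assumes ug: "upper_gradient_on U v G" and U: "open U" and cont: "continuous_on UNIV v"
    and zero: "\<And>z. z \<notin> U \<Longrightarrow> v z = 0"
  shows "upper_gradient_on UNIV v (\<lambda>z. G z * indicator U z)"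
  unfolding upper_gradient_on_def
proof (intro conjI allI impI)
  have [measurable]: "G \<in> borel_measurable borel" using ug by (simp add: upper_gradient_on_def)
  have [measurable]: "U \<in> sets borel" using U by simp
  show Gm: "(\<lambda>z. G z * indicator U z) \<in> borel_measurable borel" by measurable
  fix \<gamma> :: "real \<Rightarrow> 'a" and l assume "arclength_curve \<gamma> l \<and> \<gamma> ` {0..l} \<subseteq> UNIV"
  then have \<gamma>: "arclength_curve \<gamma> l" and l: "0 \<le> l" by (auto simp: arclength_curve_def)
  let ?I = "\<lambda>A. \<integral>\<^sup>+s\<in>A. G (\<gamma> s) * indicator U (\<gamma> s) \<partial>lborel"
  note [measurable] = clamp_measurable[OF \<gamma> Gm]
  have inside: "ennreal \<bar>v (\<gamma> a) - v (\<gamma> b)\<bar> \<le> ?I {a..b}"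
    if "0 \<le> a" "a \<le> b" "b \<le> l" "\<gamma> ` {a..b} \<subseteq> U" for a b
  proof -
    have "ennreal \<bar>v (\<gamma> a) - v (\<gamma> b)\<bar> \<le> (\<integral>\<^sup>+s\<in>{a..b}. G (\<gamma> s) \<partial>lborel)"
      by (rule upper_gradient_interval[OF ug \<gamma> that])
    also have "\<dots> = ?I {a..b}"
      by (rule nn_integral_cong) (use that in \<open>auto simp: indicator_def image_subset_iff\<close>)
    finally show ?thesis .
  qed
  have vc: "continuous_on {0..l} (\<lambda>s. v (\<gamma> s))"
  proof -
    have "continuous_on {0..l} (\<lambda>s. v (\<gamma> (clamp_to l s)))"
      by (rule continuous_on_compose2[OF cont])
         (use arclength_clamp_continuous[OF \<gamma>] continuous_on_subset in blast)+
    then show ?thesis by (rule continuous_on_eq) (simp add: clamp_to_id)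
  qed
  show "ennreal \<bar>v (\<gamma> 0) - v (\<gamma> l)\<bar> \<le> ?I {0..l}"
  proof (cases "\<gamma> ` {0..l} \<subseteq> U")
    case True
    then show ?thesis using inside[of 0 l] l by simp
  next
    case False
    define T where "T = {s \<in> {0..l}. \<gamma> (clamp_to l s) \<in> - U}"
    have "closed T" unfolding T_def
      by (rule continuous_closed_preimage[unfolded vimage_def Collect_conj_eq[symmetric], of "{0..l}" "\<lambda>s. \<gamma> (clamp_to l s)" "-U", simplified Int_def mem_Collect_eq])
         (use U arclength_clamp_continuous[OF \<gamma>] continuous_on_subset in auto)
    moreover have "T \<subseteq> {0..l}" by (auto simp: T_def)
    ultimately have T: "compact T" using compact_Icc[of 0 l] by (metis compact_Int_closed inf.absorb_iff2 inf_commute)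
    have Tne: "T \<noteq> {}" using False by (auto simp: T_def clamp_to_id)
    obtain a where a: "a \<in> T" "\<And>t. t \<in> T \<Longrightarrow> a \<le> t" using compact_attains_inf[OF T Tne] by blast
    obtain b where b: "b \<in> T" "\<And>t. t \<in> T \<Longrightarrow> t \<le> b" using compact_attains_sup[OF T Tne] by blast
    have ab: "0 \<le> a" "a \<le> b" "b \<le> l" using a b by (auto simp: T_def)
    have out: "v (\<gamma> a) = 0" "v (\<gamma> b) = 0"
      using a(1) b(1) zero by (auto simp: T_def clamp_to_id)
    have inT: "\<gamma> s \<in> U" if "0 \<le> s" "s \<le> l" "s \<notin> T" for s
      using that by (auto simp: T_def clamp_to_id)
    \<comment> \<open>The hypothesis applies on \<open>[0, t]\<close> for \<open>t < a\<close> only,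
      since the curve is outside \<open>U\<close> at time \<open>a\<close>; continuity of
      \<open>v\<close> permits \<open>t\<close> to tend to \<open>a\<close>. The half-open interval
      keeps the two arcs disjoint even if \<open>a = b\<close>.\<close>
    have 1: "ennreal \<bar>v (\<gamma> 0)\<bar> \<le> ?I {0..<a}"
    proof (cases "a = 0")
      case True
      then show ?thesis using out by simp
    next
      case False
      then have a0: "0 < a" using ab by simp
      have "((\<lambda>t. ennreal \<bar>v (\<gamma> 0) - v (\<gamma> t)\<bar>) \<longlongrightarrow> ennreal \<bar>v (\<gamma> 0) - v (\<gamma> a)\<bar>) (at_left a)"
      proof -
        have "((\<lambda>s. v (\<gamma> s)) \<longlongrightarrow> v (\<gamma> a)) (at a within {0..l})"
          using vc ab by (auto simp: continuous_on_def)
        then have "((\<lambda>s. v (\<gamma> s)) \<longlongrightarrow> v (\<gamma> a)) (at a within {0..a})"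
          by (rule tendsto_within_subset) (use ab in auto)
        moreover have "at a within {0..a} = at_left a" using a0 by (simp add: at_within_Icc_at_left)
        ultimately have "((\<lambda>s. v (\<gamma> s)) \<longlongrightarrow> v (\<gamma> a)) (at_left a)" by simp
        then show ?thesis by (intro tendsto_intros)
      qed
      moreover have "eventually (\<lambda>t. ennreal \<bar>v (\<gamma> 0) - v (\<gamma> t)\<bar> \<le> ?I {0..<a}) (at_left a)"
        unfolding eventually_at_left[OF a0]
      proof (intro exI[of _ 0] conjI allI impI a0)
        fix t assume t: "0 < t" "t < a"
        have "ennreal \<bar>v (\<gamma> 0) - v (\<gamma> t)\<bar> \<le> ?I {0..t}"
          by (rule inside) (use t ab a(2) in \<open>auto intro!: inT dest: a(2)\<close>)
        also have "\<dots> \<le> ?I {0..<a}"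
          by (rule nn_integral_mono) (use t in \<open>auto simp: indicator_def\<close>)
        finally show "ennreal \<bar>v (\<gamma> 0) - v (\<gamma> t)\<bar> \<le> ?I {0..<a}" .
      qed
      ultimately have "ennreal \<bar>v (\<gamma> 0) - v (\<gamma> a)\<bar> \<le> ?I {0..<a}"
        by (intro tendsto_upperbound[of _ _ "at_left a"]) auto
      then show ?thesis using out by simp
    qed
    have 2: "ennreal \<bar>v (\<gamma> l)\<bar> \<le> ?I {b<..l}"
    proof (cases "b = l")
      case True
      then show ?thesis using out by simp
    next
      case False
      then have bl: "b < l" using ab by simp
      have "((\<lambda>t. ennreal \<bar>v (\<gamma> t) - v (\<gamma> l)\<bar>) \<longlongrightarrow> ennreal \<bar>v (\<gamma> b) - v (\<gamma> l)\<bar>) (at_right b)"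
      proof -
        have "((\<lambda>s. v (\<gamma> s)) \<longlongrightarrow> v (\<gamma> b)) (at b within {0..l})"
          using vc ab by (auto simp: continuous_on_def)
        then have "((\<lambda>s. v (\<gamma> s)) \<longlongrightarrow> v (\<gamma> b)) (at b within {b..l})"
          by (rule tendsto_within_subset) (use ab in auto)
        moreover have "at b within {b..l} = at_right b" using bl by (simp add: at_within_Icc_at_right)
        ultimately have "((\<lambda>s. v (\<gamma> s)) \<longlongrightarrow> v (\<gamma> b)) (at_right b)" by simp
        then show ?thesis by (intro tendsto_intros)
      qed
      moreover have "eventually (\<lambda>t. ennreal \<bar>v (\<gamma> t) - v (\<gamma> l)\<bar> \<le> ?I {b<..l}) (at_right b)"
        unfolding eventually_at_right[OF bl]
      proof (intro exI[of _ l] conjI allI impI bl)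
        fix t assume t: "b < t" "t < l"
        have "ennreal \<bar>v (\<gamma> t) - v (\<gamma> l)\<bar> \<le> ?I {t..l}"
          by (rule inside) (use t ab b(2) in \<open>auto intro!: inT dest: b(2)\<close>)
        also have "\<dots> \<le> ?I {b<..l}"
          by (rule nn_integral_mono) (use t in \<open>auto simp: indicator_def\<close>)
        finally show "ennreal \<bar>v (\<gamma> t) - v (\<gamma> l)\<bar> \<le> ?I {b<..l}" .
      qed
      ultimately have "ennreal \<bar>v (\<gamma> b) - v (\<gamma> l)\<bar> \<le> ?I {b<..l}"
        by (intro tendsto_upperbound[of _ _ "at_right b"]) auto
      then show ?thesis using out by simp
    qed
    let ?J = "\<lambda>A. \<integral>\<^sup>+s\<in>A. G (\<gamma> (clamp_to l s)) * indicator U (\<gamma> (clamp_to l s)) \<partial>lborel"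
    have J: "?I A = ?J A" if "A \<subseteq> {0..l}" for A
      by (rule nn_integral_cong) (use that in \<open>auto simp: indicator_def clamp_to_def subset_eq\<close>)
    have "ennreal \<bar>v (\<gamma> 0) - v (\<gamma> l)\<bar> \<le> ennreal (\<bar>v (\<gamma> 0)\<bar> + \<bar>v (\<gamma> l)\<bar>)" by (rule ennreal_leI) auto
    also have "\<dots> \<le> ?I {0..<a} + ?I {b<..l}" using add_mono[OF 1 2] by simp
    also have "\<dots> = ?J {0..<a} + ?J {b<..l}" using J[of "{0..<a}"] J[of "{b<..l}"] ab by (simp add: subset_eq)
    also have "\<dots> = (\<integral>\<^sup>+s. G (\<gamma> (clamp_to l s)) * indicator U (\<gamma> (clamp_to l s)) * indicator {0..<a} s
         + G (\<gamma> (clamp_to l s)) * indicator U (\<gamma> (clamp_to l s)) * indicator {b<..l} s \<partial>lborel)"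
      by (subst nn_integral_add) auto
    also have "\<dots> \<le> ?J {0..l}"
      by (rule nn_integral_mono) (use ab in \<open>auto simp: indicator_def\<close>)
    finally show ?thesis using J[of "{0..l}"] by simp
  qed
qed

text \<open>The endpoints of an arc-length curve are at most \<open>l\<close> apart, so integrating
  the constant \<open>C\<close> along it pays for the Lipschitz error. This is how a cut-off is
  charged to the upper gradient.\<close>

lemma upper_gradient_add_lipschitz:
  assumes ug: "upper_gradient_on \<Omega> u g" and C: "0 \<le> C"
    and le: "\<And>x y. \<bar>v x - v y\<bar> \<le> \<bar>u x - u y\<bar> + C * dist x y"
  shows "upper_gradient_on \<Omega> v (\<lambda>z. g z + ennreal C)"
  unfolding upper_gradient_on_def
proof (intro conjI allI impI)
  have [measurable]: "g \<in> borel_measurable borel" using ug by (simp add: upper_gradient_on_def)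
  show "(\<lambda>z. g z + ennreal C) \<in> borel_measurable borel" by measurable
  fix \<gamma> l assume *: "arclength_curve \<gamma> l \<and> \<gamma> ` {0..l} \<subseteq> \<Omega>"
  then have \<gamma>: "arclength_curve \<gamma> l" and l: "0 \<le> l" by (auto simp: arclength_curve_def)
  note [measurable] = clamp_measurable[OF \<gamma>, of g]
  have "dist (\<gamma> 0) (\<gamma> l) \<le> l" using arclength_dist_le[OF \<gamma>, of 0 l] l by auto
  then have "\<bar>v (\<gamma> 0) - v (\<gamma> l)\<bar> \<le> \<bar>u (\<gamma> 0) - u (\<gamma> l)\<bar> + C * l"
    using le[of "\<gamma> 0" "\<gamma> l"] mult_left_mono[OF _ C] by fastforce
  then have "ennreal \<bar>v (\<gamma> 0) - v (\<gamma> l)\<bar> \<le> ennreal \<bar>u (\<gamma> 0) - u (\<gamma> l)\<bar> + ennreal (C * l)"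
    using C l ennreal_leI by (metis abs_ge_zero ennreal_plus mult_nonneg_nonneg)
  also have "\<dots> \<le> (\<integral>\<^sup>+s\<in>{0..l}. g (\<gamma> s) \<partial>lborel) + (\<integral>\<^sup>+s\<in>{0..l}. ennreal C \<partial>lborel)"
    using ug * l C by (intro add_mono) (auto simp: upper_gradient_on_def nn_integral_cmult_indicator ennreal_mult)
  also have "\<dots> = (\<integral>\<^sup>+s. g (\<gamma> (clamp_to l s)) * indicator {0..l} s + ennreal C * indicator {0..l} s \<partial>lborel)"
    by (subst nn_integral_add) (auto simp: integral_clamp)
  also have "\<dots> = (\<integral>\<^sup>+s\<in>{0..l}. (g (\<gamma> s) + ennreal C) \<partial>lborel)"
    by (rule nn_integral_cong) (auto simp: indicator_def clamp_to_id)
  finally show "ennreal \<bar>v (\<gamma> 0) - v (\<gamma> l)\<bar> \<le> (\<integral>\<^sup>+s\<in>{0..l}. (g (\<gamma> s) + ennreal C) \<partial>lborel)" .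
qed

text \<open>Boundedness of \<open>g\<close> is essential: if \<open>g\<close> may have infinite integral along curves that
  leave \<open>F\<close>, its restriction to \<open>F\<close> carries no information about \<open>u\<close>.\<close>

lemma upper_gradient_glue:
  fixes u v :: "'a::metric_space \<Rightarrow> real"
  assumes ug: "upper_gradient_on UNIV u g" and gK: "\<And>z. g z \<le> ennreal K"
    and F: "closed F" and vu: "\<And>z. z \<in> F \<Longrightarrow> v z = u z" and v: "L-lipschitz_on UNIV v"
  shows "upper_gradient_on UNIV v (\<lambda>z. g z * indicator F z + ennreal L * indicator (- F) z)"
  unfolding upper_gradient_on_def
proof (intro conjI allI impI)
  have gm[measurable]: "g \<in> borel_measurable borel" using ug by (simp add: upper_gradient_on_def)
  have [measurable]: "F \<in> sets borel" using F by simp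
  define G where "G = (\<lambda>z. g z * indicator F z + ennreal L * indicator (- F) z)"
  show "(\<lambda>z. g z * indicator F z + ennreal L * indicator (- F) z) \<in> borel_measurable borel" by measurable
  then have Gm: "G \<in> borel_measurable borel" by (simp add: G_def)
  fix \<gamma> :: "real \<Rightarrow> 'a" and l assume "arclength_curve \<gamma> l \<and> \<gamma> ` {0..l} \<subseteq> UNIV"
  then have \<gamma>: "arclength_curve \<gamma> l" and l: "0 \<le> l" by (auto simp: arclength_curve_def)
  note [measurable] = clamp_measurable[OF \<gamma> gm] clamp_measurable[OF \<gamma> Gm]
  have L0: "0 \<le> L" using v by (rule lipschitz_on_nonneg)
  have vL: "\<bar>v (\<gamma> s) - v (\<gamma> t)\<bar> \<le> L * \<bar>s - t\<bar>" if "s \<in> {0..l}" "t \<in> {0..l}" for s t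
  proof -
    have "\<bar>v (\<gamma> s) - v (\<gamma> t)\<bar> \<le> L * dist (\<gamma> s) (\<gamma> t)"
      using lipschitz_onD[OF v, of "\<gamma> s" "\<gamma> t"] by (simp add: dist_real_def)
    also have "\<dots> \<le> L * \<bar>s - t\<bar>" by (rule mult_left_mono[OF arclength_dist_le[OF \<gamma> that] L0])
    finally show ?thesis .
  qed
  define S where "S = {s \<in> {0..l}. \<gamma> (clamp_to l s) \<in> F}"
  have "closed S" unfolding S_def
    by (rule continuous_closed_preimage[unfolded vimage_def Collect_conj_eq[symmetric], of "{0..l}" "\<lambda>s. \<gamma> (clamp_to l s)" F, simplified Int_def mem_Collect_eq])
       (use F arclength_clamp_continuous[OF \<gamma>] continuous_on_subset in auto)
  have S01: "S \<subseteq> {0..l}" by (auto simp: S_def)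
  have S_iff: "s \<in> S \<longleftrightarrow> \<gamma> s \<in> F" if "s \<in> {0..l}" for s using that by (auto simp: S_def clamp_to_id)
  have "S \<in> sets borel" using \<open>closed S\<close> by simp
  \<comment> \<open>The times outside \<open>S\<close> but close to it. Since \<open>S\<close> is
    closed these sets decrease to the empty set, so their measures tend to 0; they carry the error
    made by using \<open>g\<close> off \<open>F\<close>.\<close>
  define U where "U n = (\<Union>s\<in>S. ball s (1 / Suc n)) \<inter> {0..l} - S" for n :: nat
  have Um[measurable]: "U n \<in> sets borel" for n
  proof -
    have "open (\<Union>s\<in>S. ball s (1 / Suc n))" by auto
    then have "(\<Union>s\<in>S. ball s (1 / Suc n)) \<in> sets borel" by simp
    then show ?thesis unfolding U_def using \<open>S \<in> sets borel\<close> by (intro sets.Diff sets.Int) auto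
  qed
  have "antimono U"
  proof (rule decseq_SucI)
    fix n
    have "1 / real (Suc (Suc n)) \<le> 1 / real (Suc n)" by (simp add: frac_le)
    then have "ball s (1 / real (Suc (Suc n))) \<subseteq> ball s (1 / real (Suc n))" for s :: real by (rule subset_ball)
    then show "U (Suc n) \<le> U n" unfolding U_def by blast
  qed
  have "(\<Inter>n. U n) = {}"
  proof -
    have False if "\<And>n. x \<in> U n" for x
    proof -
      have "x \<in> closure S" unfolding closure_approachable
      proof (intro allI impI)
        fix e :: real assume "0 < e"
        then obtain n where n: "1 / Suc n < e" using nat_approx_posE by blast
        from that[of n] obtain s where "s \<in> S" "dist s x < 1 / Suc n" by (auto simp: U_def)
        then show "\<exists>y\<in>S. dist y x < e" using n by force
      qed
      then show False using that[of 0] \<open>closed S\<close> by (simp add: U_def)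
    qed
    then show ?thesis by blast
  qed
  have fin: "emeasure lborel (U n) \<noteq> \<infinity>" for n
  proof -
    have "emeasure lborel (U n) \<le> emeasure lborel {0..l}" by (rule emeasure_mono) (auto simp: U_def)
    then show ?thesis using l by (auto simp: top_unique)
  qed
  have lim: "(\<lambda>n. emeasure lborel (U n)) \<longlonglongrightarrow> 0"
    using Lim_emeasure_decseq[of U lborel, OF _ \<open>antimono U\<close> fin] \<open>(\<Inter>n. U n) = {}\<close> Um
    by (auto simp: image_subset_iff)
  have main: "ennreal \<bar>v (\<gamma> 0) - v (\<gamma> l)\<bar> \<le>
      (\<integral>\<^sup>+s\<in>{0..l}. G (\<gamma> s) \<partial>lborel) + ennreal K * emeasure lborel (U n)" for n
  proof -
    define H where "H s = G (\<gamma> (clamp_to l s)) + ennreal K * indicator (U n) s" for s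
    have Hm[measurable]: "H \<in> borel_measurable borel" unfolding H_def by measurable
    have "ennreal \<bar>v (\<gamma> 0) - v (\<gamma> l)\<bar> \<le> (\<integral>\<^sup>+s\<in>{0..l}. H s \<partial>lborel)"
    \<comment> \<open>The mesh is below \<open>1 / Suc n\<close>, so in a short interval that meets
      \<open>S\<close> every time outside \<open>S\<close> belongs to \<open>U n\<close>.\<close>
    proof (rule local_to_global[OF Hm l, of "1 / (2 * Suc n)"])
      show "0 < 1 / real (2 * Suc n)" by simp
      fix a b assume ab: "0 \<le> a" "a \<le> b" "b \<le> l" "b - a \<le> 1 / real (2 * Suc n)"
      have small: "b - a < 1 / Suc n"
        using ab(4) by (rule order.strict_trans1) (simp add: divide_simps)
      show "ennreal \<bar>v (\<gamma> a) - v (\<gamma> b)\<bar> \<le> (\<integral>\<^sup>+s\<in>{a..b}. H s \<partial>lborel)"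
      proof (cases "S \<inter> {a..b} = {}")
        case True
        have "ennreal \<bar>v (\<gamma> a) - v (\<gamma> b)\<bar> \<le> ennreal (L * (b - a))"
          using vL[of a b] ab by (intro ennreal_leI) auto
        also have "\<dots> = (\<integral>\<^sup>+s\<in>{a..b}. ennreal L \<partial>lborel)"
          using ab L0 by (simp add: nn_integral_cmult_indicator ennreal_mult)
        also have "\<dots> \<le> (\<integral>\<^sup>+s\<in>{a..b}. H s \<partial>lborel)"
        proof (rule nn_integral_mono)
          fix s
          show "ennreal L * indicator {a..b} s \<le> H s * indicator {a..b} s"
            using True ab S_iff[of s] by (auto simp: indicator_def H_def G_def clamp_to_id)
        qed
        finally show ?thesis .
      next
        case False
        have cpt: "compact (S \<inter> {a..b})" by (rule closed_Int_compact[OF \<open>closed S\<close> compact_Icc])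
        \<comment> \<open>Between the first and last visits to \<open>F\<close> the function
          \<open>u\<close> is used with its gradient \<open>g\<close>, and the gaps are charged to
          \<open>K\<close> on \<open>U n\<close>. The two end pieces avoid \<open>F\<close> and use
          the slope \<open>L\<close>.\<close>
        obtain a' where a': "a' \<in> S \<inter> {a..b}" "\<And>t. t \<in> S \<inter> {a..b} \<Longrightarrow> a' \<le> t"
          using compact_attains_inf[OF cpt False] by blast
        obtain b' where b': "b' \<in> S \<inter> {a..b}" "\<And>t. t \<in> S \<inter> {a..b} \<Longrightarrow> t \<le> b'"
          using compact_attains_sup[OF cpt False] by blast
        have o: "a \<le> a'" "a' \<le> b'" "b' \<le> b" using a' b' by auto
        have inF: "\<gamma> a' \<in> F" "\<gamma> b' \<in> F" using a'(1) b'(1) S_iff ab by auto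
        have "\<bar>v (\<gamma> a) - v (\<gamma> b)\<bar> \<le> \<bar>v (\<gamma> a) - v (\<gamma> a')\<bar> + \<bar>u (\<gamma> a') - u (\<gamma> b')\<bar> + \<bar>v (\<gamma> b') - v (\<gamma> b)\<bar>"
          using vu[OF inF(1)] vu[OF inF(2)] by linarith
        also have "\<dots> \<le> L * (a' - a) + \<bar>u (\<gamma> a') - u (\<gamma> b')\<bar> + L * (b - b')"
          using vL[of a a'] vL[of b' b] ab o by auto
        finally have "ennreal \<bar>v (\<gamma> a) - v (\<gamma> b)\<bar> \<le> ennreal (L * (a' - a) + \<bar>u (\<gamma> a') - u (\<gamma> b')\<bar> + L * (b - b'))"
          by (rule ennreal_leI)
        also have "\<dots> = ennreal L * ennreal (a' - a) + ennreal \<bar>u (\<gamma> a') - u (\<gamma> b')\<bar> + ennreal L * ennreal (b - b')"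
          using L0 o by (simp add: ennreal_mult)
        also have "\<dots> \<le> (\<integral>\<^sup>+s\<in>{a..<a'}. ennreal L \<partial>lborel)
            + (\<integral>\<^sup>+s\<in>{a'..b'}. g (\<gamma> s) \<partial>lborel) + (\<integral>\<^sup>+s\<in>{b'<..b}. ennreal L \<partial>lborel)"
          using o ab upper_gradient_interval[OF ug \<gamma>, of a' b']
          by (intro add_mono) (auto simp: nn_integral_cmult_indicator)
        also have "\<dots> = (\<integral>\<^sup>+s. ennreal L * indicator {a..<a'} s
            + g (\<gamma> (clamp_to l s)) * indicator {a'..b'} s + ennreal L * indicator {b'<..b} s \<partial>lborel)"
          using o ab by (simp add: nn_integral_add integral_clamp)
        also have "\<dots> \<le> (\<integral>\<^sup>+s\<in>{a..b}. H s \<partial>lborel)"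
        proof (rule nn_integral_mono)
          fix s
          show "ennreal L * indicator {a..<a'} s
            + g (\<gamma> (clamp_to l s)) * indicator {a'..b'} s + ennreal L * indicator {b'<..b} s \<le> H s * indicator {a..b} s"
          proof (cases "s \<in> {a..b}")
            case False
            then show ?thesis using o by (auto simp: indicator_def)
          next
            case True
            then have s: "s \<in> {0..l}" using ab by auto
            consider "s < a'" | "b' < s" | "s \<in> {a'..b'}" "s \<in> S" | "s \<in> {a'..b'}" "s \<notin> S" by fastforce
            then show ?thesis
            proof cases
              case 1
              then have "s \<notin> S" using a'(2)[of s] True by auto
              then show ?thesis using 1 True S_iff[OF s] s o
                by (auto simp: indicator_def H_def G_def clamp_to_id)
            next
              case 2
              then have "s \<notin> S" using b'(2)[of s] True by auto
              then show ?thesis using 2 True S_iff[OF s] s o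
                by (auto simp: indicator_def H_def G_def clamp_to_id)
            next
              case 3
              then show ?thesis using True S_iff[OF s] s o
                by (auto simp: indicator_def H_def G_def clamp_to_id)
            next
              case 4
              have "dist a' s < 1 / Suc n" using 4 o True small by (auto simp: dist_real_def)
              then have "s \<in> U n" using a'(1) 4 s by (auto simp: U_def)
              then show ?thesis using 4 True S_iff[OF s] s o gK[of "\<gamma> s"]
                by (auto simp: indicator_def H_def clamp_to_id intro: add_increasing)
            qed
          qed
        qed
        finally show ?thesis .
      qed
    qed
    also have "\<dots> = (\<integral>\<^sup>+s. G (\<gamma> (clamp_to l s)) * indicator {0..l} s + ennreal K * indicator (U n) s \<partial>lborel)"
      by (rule nn_integral_cong) (auto simp: H_def indicator_def U_def)
    also have "\<dots> = (\<integral>\<^sup>+s\<in>{0..l}. G (\<gamma> (clamp_to l s)) \<partial>lborel) + ennreal K * emeasure lborel (U n)"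
      by (subst nn_integral_add) (auto simp: nn_integral_cmult_indicator)
    also have "\<dots> = (\<integral>\<^sup>+s\<in>{0..l}. G (\<gamma> s) \<partial>lborel) + ennreal K * emeasure lborel (U n)"
      by (subst integral_clamp) auto
    finally show ?thesis .
  qed
  \<comment> \<open>Here the bound on \<open>g\<close> matters: a finite \<open>K\<close> times a
    vanishing measure disappears in the limit.\<close>
  have "(\<lambda>n. (\<integral>\<^sup>+s\<in>{0..l}. G (\<gamma> s) \<partial>lborel) + ennreal K * emeasure lborel (U n))
      \<longlonglongrightarrow> (\<integral>\<^sup>+s\<in>{0..l}. G (\<gamma> s) \<partial>lborel) + ennreal K * 0"
    by (intro tendsto_add tendsto_const ennreal_tendsto_cmult lim) simp
  then have "ennreal \<bar>v (\<gamma> 0) - v (\<gamma> l)\<bar> \<le> (\<integral>\<^sup>+s\<in>{0..l}. G (\<gamma> s) \<partial>lborel) + ennreal K * 0"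
    by (rule tendsto_lowerbound) (use main in auto)
  then show "ennreal \<bar>v (\<gamma> 0) - v (\<gamma> l)\<bar> \<le> (\<integral>\<^sup>+s\<in>{0..l}. (g (\<gamma> s) * indicator F (\<gamma> s)
      + ennreal L * indicator (- F) (\<gamma> s)) \<partial>lborel)"
    by (simp add: G_def)
qed

section \<open>Doubling measures\<close>

lemma ball_in_sets[measurable]: "ball x r \<in> sets borel"
  by simp

text \<open>Greedy choice: a ball of largest radius swallows, after tripling, every ball that meets
  it; the remaining ones form a smaller family. Nonpositive radii are allowed, so the case of only
  empty balls is treated apart.\<close>

lemma finite_vitali:
  fixes c :: "'i \<Rightarrow> 'a::metric_space" and r :: "'i \<Rightarrow> real"
  assumes "finite I"
  shows "\<exists>J\<subseteq>I. disjoint_family_on (\<lambda>i. ball (c i) (r i)) J \<and>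
     (\<forall>i\<in>I. \<exists>j\<in>J. ball (c i) (r i) \<subseteq> ball (c j) (3 * r j))"
  using assms
proof (induction I rule: finite_psubset_induct)
  case (psubset I)
  show ?case
  proof (cases "\<exists>i\<in>I. 0 < r i")
    case False
    then have e: "ball (c i) (r i) = {}" if "i \<in> I" for i using that by (auto simp: not_less)
    show ?thesis
    proof (intro exI[of _ I] conjI ballI)
      show "disjoint_family_on (\<lambda>i. ball (c i) (r i)) I" unfolding disjoint_family_on_def using e by blast
      show "\<exists>j\<in>I. ball (c i) (r i) \<subseteq> ball (c j) (3 * r j)" if "i \<in> I" for i
        using e[OF that] that by (metis empty_subsetI)
    qed simp
  next
    case True
    have "Max (r ` I) \<in> r ` I" using True psubset.hyps by (intro Max_in) auto
    then obtain m where "m \<in> I" "r m = Max (r ` I)" by auto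
    then have m: "m \<in> I" "\<And>i. i \<in> I \<Longrightarrow> r i \<le> r m" using psubset.hyps by auto
    have rm: "0 < r m" using True m(2) by force
    define I' where "I' = {i \<in> I. ball (c i) (r i) \<inter> ball (c m) (r m) = {}}"
    have "m \<notin> I'" using rm by (auto simp: I'_def)
    moreover have "I' \<subseteq> I" by (auto simp: I'_def)
    ultimately have "I' \<subset> I" using m(1) by blast
    from psubset.IH[OF this] obtain J where J: "J \<subseteq> I'" "disjoint_family_on (\<lambda>i. ball (c i) (r i)) J"
      "\<And>i. i \<in> I' \<Longrightarrow> \<exists>j\<in>J. ball (c i) (r i) \<subseteq> ball (c j) (3 * r j)" by blast
    have "disjoint_family_on (\<lambda>i. ball (c i) (r i)) (insert m J)"
      using J(1,2) by (auto simp: disjoint_family_on_def I'_def)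
    moreover have "\<exists>j\<in>insert m J. ball (c i) (r i) \<subseteq> ball (c j) (3 * r j)" if i: "i \<in> I" for i
    proof (cases "i \<in> I'")
      case True then show ?thesis using J(3) by blast
    next
      case False
      then obtain z where z: "dist (c i) z < r i" "dist (c m) z < r m" using i by (auto simp: I'_def)
      have "ball (c i) (r i) \<subseteq> ball (c m) (3 * r m)"
      proof
        fix y assume "y \<in> ball (c i) (r i)"
        then have "dist (c m) y < 3 * r m"
          using z m(2)[OF i] dist_triangle[of "c m" y z] dist_triangle[of z y "c i"]
          by (auto simp: dist_commute)
        then show "y \<in> ball (c m) (3 * r m)" by simp
      qed
      then show ?thesis by blast
    qed
    ultimately show ?thesis using J(1) m(1) by (intro exI[of _ "insert m J"]) (auto simp: I'_def)
  qed
qed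

locale doubling_space =
  fixes \<mu> :: "'a::complete_space measure" and D :: real
  assumes sets_eq[measurable_cong]: "sets \<mu> = sets borel"
    and D_ge_1: "1 \<le> D"
    and ball_pos: "0 < r \<Longrightarrow> 0 < emeasure \<mu> (ball x r)"
    and ball_finite: "0 < r \<Longrightarrow> emeasure \<mu> (ball x r) < \<infinity>"
    and doubling: "0 < r \<Longrightarrow> emeasure \<mu> (ball x (2 * r)) \<le> ennreal D * emeasure \<mu> (ball x r)"
begin

definition V :: "'a \<Rightarrow> real \<Rightarrow> real" where "V x r = measure \<mu> (ball x r)"

lemma space_eq[simp]: "space \<mu> = UNIV"
  using sets_eq_imp_space_eq[OF sets_eq] by simp

lemma emeasure_ball: "0 < r \<Longrightarrow> emeasure \<mu> (ball x r) = ennreal (V x r)"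
  unfolding V_def using ball_finite[of r x] by (intro emeasure_eq_ennreal_measure) (auto simp: less_top)

lemma V_pos: "0 < r \<Longrightarrow> 0 < V x r"
  using ball_pos[of r x] by (simp add: emeasure_ball)

lemma V_nonneg[simp]: "0 \<le> V x r"
  by (simp add: V_def)

lemma V_mono: "ball x r \<subseteq> ball y s \<Longrightarrow> 0 < r \<Longrightarrow> 0 < s \<Longrightarrow> V x r \<le> V y s"
  using emeasure_mono[of "ball x r" "ball y s" \<mu>] by (simp add: emeasure_ball sets_eq)

lemma V_double: "0 < r \<Longrightarrow> V x (2 * r) \<le> D * V x r"
  using doubling[of r x] D_ge_1 by (simp add: emeasure_ball flip: ennreal_mult)

lemma V_pow: "0 < r \<Longrightarrow> V x (2 ^ n * r) \<le> D ^ n * V x r"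
proof (induction n)
  case (Suc n)
  have "V x (2 ^ Suc n * r) \<le> D * V x (2 ^ n * r)"
    using V_double[of "2 ^ n * r" x] Suc.prems by (simp add: mult.assoc)
  also have "\<dots> \<le> D * (D ^ n * V x r)" using Suc D_ge_1 by (intro mult_left_mono) auto
  finally show ?case by simp
qed simp

text \<open>The source of all powers of \<open>D\<close> below: the exponent counts the doublings
  that let a ball about \<open>x\<close> swallow the ball about \<open>y\<close>.\<close>

lemma V_compare:
  assumes "0 < r" "0 < s" "dist x y + s \<le> 2 ^ n * r"
  shows "V y s \<le> D ^ n * V x r"
proof -
  have "ball y s \<subseteq> ball x (2 ^ n * r)"
  proof
    fix z assume "z \<in> ball y s"
    then show "z \<in> ball x (2 ^ n * r)" using assms(3) dist_triangle[of x z y] by auto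
  qed
  then have "V y s \<le> V x (2 ^ n * r)" using assms by (intro V_mono) auto
  also have "\<dots> \<le> D ^ n * V x r" by (rule V_pow[OF assms(1)])
  finally show ?thesis .
qed

lemma emeasure_compare:
  assumes "0 < r" "0 < s" "dist x y + s \<le> 2 ^ n * r"
  shows "emeasure \<mu> (ball y s) \<le> ennreal (D ^ n) * emeasure \<mu> (ball x r)"
  using V_compare[OF assms] assms D_ge_1 by (simp add: emeasure_ball flip: ennreal_mult)

text \<open>Packing by volume: the balls of radius \<open>e / 2\<close> are disjoint, lie in one
  ball of radius \<open>R + e\<close>, and each occupies at least the fraction
  \<open>1 / D ^ k\<close> of it.\<close>

lemma separated_card_le:
  fixes x :: 'a
  assumes R: "0 < R" and e: "0 < e" and A: "finite A" "A \<subseteq> cball x R"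
    and sep: "\<And>a b. a \<in> A \<Longrightarrow> b \<in> A \<Longrightarrow> a \<noteq> b \<Longrightarrow> e \<le> dist a b"
    and k: "2 * R + e \<le> 2 ^ k * (e / 2)"
  shows "real (card A) \<le> D ^ k"
proof -
  have disj: "disjoint_family_on (\<lambda>a. ball a (e / 2)) A"
    unfolding disjoint_family_on_def
  proof (intro ballI impI)
    fix a b assume "a \<in> A" "b \<in> A" "a \<noteq> b"
    then have "e \<le> dist a b" by (rule sep)
    then have False if "dist a z < e / 2" "dist b z < e / 2" for z
      using that dist_triangle2[of a b z] by linarith
    then show "ball a (e / 2) \<inter> ball b (e / 2) = {}" by auto
  qed
  have low: "V x (R + e) / D ^ k \<le> V a (e / 2)" if "a \<in> A" for a
  proof -
    have "dist a x \<le> R" using A that by (auto simp: dist_commute)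
    then have "V x (R + e) \<le> D ^ k * V a (e / 2)" using R e k by (intro V_compare) auto
    then show ?thesis using D_ge_1 by (simp add: field_simps)
  qed
  have "ennreal (real (card A) * (V x (R + e) / D ^ k)) = ennreal (\<Sum>a\<in>A. V x (R + e) / D ^ k)" by simp
  also have "\<dots> \<le> ennreal (\<Sum>a\<in>A. V a (e / 2))" by (intro ennreal_leI sum_mono low)
  also have "\<dots> = (\<Sum>a\<in>A. emeasure \<mu> (ball a (e / 2)))" using e by (simp add: emeasure_ball)
  also have "\<dots> = emeasure \<mu> (\<Union>a\<in>A. ball a (e / 2))"
    by (rule sum_emeasure) (use disj A in \<open>auto simp: sets_eq\<close>)
  also have "\<dots> \<le> emeasure \<mu> (ball x (R + e))"
  proof (rule emeasure_mono)
    show "(\<Union>a\<in>A. ball a (e / 2)) \<subseteq> ball x (R + e)"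
    proof clarsimp
      fix a z assume "a \<in> A" "dist a z * 2 < e"
      moreover then have "dist x a \<le> R" using A by auto
      ultimately show "dist x z < R + e" using dist_triangle[of x z a] zero_le_dist[of a z] e by linarith
    qed
  qed (simp add: sets_eq)
  also have "\<dots> = ennreal (V x (R + e))" using R e by (simp add: emeasure_ball)
  finally have "real (card A) * (V x (R + e) / D ^ k) \<le> V x (R + e)" by (simp add: ennreal_le_iff)
  then have "(real (card A) / D ^ k) * V x (R + e) \<le> 1 * V x (R + e)" by (simp add: field_simps)
  then have "real (card A) / D ^ k \<le> 1" by (rule mult_right_le_imp_le) (use V_pos R e in auto)
  then show ?thesis using D_ge_1 by (simp add: field_simps)
qed

text \<open>The packing bound gives total boundedness, and completeness of the space then gives
  compactness. Failing total boundedness would allow separated sets of every finite size.\<close>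

lemma compact_cball:
  fixes x :: 'a
  shows "compact (cball x R)"
proof (cases "0 < R")
  case False
  then show ?thesis by (cases "R = 0") auto
next
  case R: True
  have "\<exists>k. finite k \<and> cball x R \<subseteq> (\<Union>z\<in>k. ball z e)" if e: "0 < e" for e
  proof (rule ccontr)
    assume no: "\<not> ?thesis"
    have sep: "\<exists>A. finite A \<and> card A = n \<and> A \<subseteq> cball x R \<and> (\<forall>a\<in>A. \<forall>b\<in>A. a \<noteq> b \<longrightarrow> e \<le> dist a b)" for n
    proof (induction n)
      case 0 then show ?case by auto
    next
      case (Suc n)
      then obtain A where "finite A \<and> card A = n \<and> A \<subseteq> cball x R \<and> (\<forall>a\<in>A. \<forall>b\<in>A. a \<noteq> b \<longrightarrow> e \<le> dist a b)" by (rule exE)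
      then have A: "finite A" "card A = n" "A \<subseteq> cball x R" "\<forall>a\<in>A. \<forall>b\<in>A. a \<noteq> b \<longrightarrow> e \<le> dist a b" by simp_all
      have "\<not> cball x R \<subseteq> (\<Union>z\<in>A. ball z e)" using no A(1) by (simp only: not_ex de_Morgan_conj) simp
      then obtain z where z: "z \<in> cball x R" "z \<notin> (\<Union>z\<in>A. ball z e)" by blast
      then have "z \<notin> A" using e by auto
      then show ?case using A z
        by (intro exI[of _ "insert z A"]) (auto simp: dist_commute not_less)
    qed
    obtain k where k: "2 * (2 * R + e) / e < 2 ^ k" using real_arch_pow[of 2 "2 * (2 * R + e) / e"] by auto
    then have k': "2 * R + e \<le> 2 ^ k * (e / 2)" using e by (simp add: field_simps)
    obtain n :: nat where n: "D ^ k < real n" using reals_Archimedean2 by blast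
    obtain A where "finite A \<and> card A = n \<and> A \<subseteq> cball x R \<and> (\<forall>a\<in>A. \<forall>b\<in>A. a \<noteq> b \<longrightarrow> e \<le> dist a b)"
      using sep[of n] by (rule exE)
    then have A: "finite A" "card A = n" "A \<subseteq> cball x R" "\<forall>a\<in>A. \<forall>b\<in>A. a \<noteq> b \<longrightarrow> e \<le> dist a b" by simp_all
    have "real (card A) \<le> D ^ k"
      by (rule separated_card_le[where e = e and A = A, OF R e A(1) A(3)]) (use A k' in auto)
    then show False using A n by simp
  qed
  moreover have "complete (cball x R)" by (simp add: complete_eq_closed)
  ultimately show ?thesis unfolding compact_eq_totally_bounded by blast
qed

section \<open>Weak type estimates for the maximal function\<close>

lemma finite_measure_subset_ball:
  assumes "A \<subseteq> ball x r" shows "emeasure \<mu> A < \<infinity>"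
proof -
  have "emeasure \<mu> A \<le> emeasure \<mu> (ball x (max r 1))"
    by (rule emeasure_mono) (use assms in \<open>auto simp: sets_eq\<close>)
  also have "\<dots> < \<infinity>" by (rule ball_finite) auto
  finally show ?thesis .
qed

text \<open>Compactness makes the family of balls finite, so the finite covering lemma suffices
  whatever the radii are. The factor \<open>D ^ 2\<close> pays for tripling, because 3 is at most
  4.\<close>

lemma weak_type_compact:
  assumes [measurable]: "f \<in> borel_measurable borel" and K: "compact K"
    and U[measurable]: "U \<in> sets borel"
    and cov: "\<And>z. z \<in> K \<Longrightarrow> \<exists>c r. 0 < r \<and> z \<in> ball c r \<and> ball c r \<subseteq> U \<and>
       \<Lambda> * emeasure \<mu> (ball c r) \<le> (\<integral>\<^sup>+y\<in>ball c r. f y \<partial>\<mu>)"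
  shows "\<Lambda> * emeasure \<mu> K \<le> ennreal (D ^ 2) * (\<integral>\<^sup>+y\<in>U. f y \<partial>\<mu>)"
proof -
  let ?P = "\<lambda>z b. 0 < snd b \<and> z \<in> ball (fst b) (snd b) \<and> ball (fst b) (snd b) \<subseteq> U \<and>
       \<Lambda> * emeasure \<mu> (ball (fst b) (snd b)) \<le> (\<integral>\<^sup>+y\<in>ball (fst b) (snd b). f y \<partial>\<mu>)"
  have "\<exists>b. ?P z b" if z: "z \<in> K" for z
  proof -
    obtain c r where "0 < r \<and> z \<in> ball c r \<and> ball c r \<subseteq> U \<and>
       \<Lambda> * emeasure \<mu> (ball c r) \<le> (\<integral>\<^sup>+y\<in>ball c r. f y \<partial>\<mu>)"
      using cov[OF z] by (elim exE)
    then show ?thesis by (intro exI[of _ "(c, r)"]) simp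
  qed
  then have "\<forall>z\<in>K. \<exists>b. ?P z b" by blast
  from bchoice[OF this] obtain b where b: "\<forall>z\<in>K. ?P z (b z)" by (rule exE)
  define c r where "c = fst \<circ> b" and "r = snd \<circ> b"
  have cr: "\<And>z. z \<in> K \<Longrightarrow> 0 < r z" "\<And>z. z \<in> K \<Longrightarrow> z \<in> ball (c z) (r z)"
    "\<And>z. z \<in> K \<Longrightarrow> ball (c z) (r z) \<subseteq> U"
    "\<And>z. z \<in> K \<Longrightarrow> \<Lambda> * emeasure \<mu> (ball (c z) (r z)) \<le> (\<integral>\<^sup>+y\<in>ball (c z) (r z). f y \<partial>\<mu>)"
    using b by (simp_all add: c_def r_def)
  obtain I where I: "I \<subseteq> K" "finite I" "K \<subseteq> (\<Union>z\<in>I. ball (c z) (r z))"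
  proof -
    have "K \<subseteq> (\<Union>z\<in>K. ball (c z) (r z))" using cr(2) by blast
    then show ?thesis by (rule compactE_image[OF K open_ball]) (use that in blast)
  qed
  obtain J where J: "J \<subseteq> I" "disjoint_family_on (\<lambda>i. ball (c i) (r i)) J"
      "\<And>i. i \<in> I \<Longrightarrow> \<exists>j\<in>J. ball (c i) (r i) \<subseteq> ball (c j) (3 * r j)"
    using finite_vitali[OF I(2), of c r] by blast
  have fJ: "finite J" using J(1) I(2) finite_subset by blast
  have JK: "j \<in> K" if "j \<in> J" for j using that J I by blast
  have "(\<Sum>j\<in>J. (\<integral>\<^sup>+y\<in>ball (c j) (r j). f y \<partial>\<mu>))
      = (\<integral>\<^sup>+y. (\<Sum>j\<in>J. f y * indicator (ball (c j) (r j)) y) \<partial>\<mu>)"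
    by (rule nn_integral_sum[symmetric]) measurable
  also have "\<dots> = (\<integral>\<^sup>+y\<in>\<Union>j\<in>J. ball (c j) (r j). f y \<partial>\<mu>)"
    by (rule nn_integral_cong) (simp add: indicator_UN_disjoint[OF fJ J(2)] sum_distrib_left)
  also have "\<dots> \<le> (\<integral>\<^sup>+y\<in>U. f y \<partial>\<mu>)"
    by (rule nn_integral_mono) (use cr(3) JK in \<open>fastforce simp: indicator_def\<close>)
  finally have sumle: "(\<Sum>j\<in>J. (\<integral>\<^sup>+y\<in>ball (c j) (r j). f y \<partial>\<mu>)) \<le> (\<integral>\<^sup>+y\<in>U. f y \<partial>\<mu>)" .
  have "K \<subseteq> (\<Union>j\<in>J. ball (c j) (3 * r j))" using I(3) J(3) by fastforce
  then have "emeasure \<mu> K \<le> emeasure \<mu> (\<Union>j\<in>J. ball (c j) (3 * r j))"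
    by (rule emeasure_mono) (use fJ in \<open>auto simp: sets_eq\<close>)
  also have "\<dots> \<le> (\<Sum>j\<in>J. emeasure \<mu> (ball (c j) (3 * r j)))"
    by (rule emeasure_subadditive_finite[OF fJ]) (auto simp: sets_eq)
  also have "\<dots> \<le> (\<Sum>j\<in>J. ennreal (D ^ 2) * emeasure \<mu> (ball (c j) (r j)))"
    by (rule sum_mono, rule emeasure_compare) (use cr(1) JK in \<open>auto simp: less_imp_le\<close>)
  finally have "\<Lambda> * emeasure \<mu> K \<le> \<Lambda> * (\<Sum>j\<in>J. ennreal (D ^ 2) * emeasure \<mu> (ball (c j) (r j)))"
    by (rule mult_left_mono) simp
  also have "\<dots> = ennreal (D ^ 2) * (\<Sum>j\<in>J. \<Lambda> * emeasure \<mu> (ball (c j) (r j)))"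
    by (simp add: sum_distrib_left mult.left_commute)
  also have "\<dots> \<le> ennreal (D ^ 2) * (\<Sum>j\<in>J. (\<integral>\<^sup>+y\<in>ball (c j) (r j). f y \<partial>\<mu>))"
    by (intro mult_left_mono sum_mono cr(4) JK) auto
  also have "\<dots> \<le> ennreal (D ^ 2) * (\<integral>\<^sup>+y\<in>U. f y \<partial>\<mu>)"
    by (rule mult_left_mono[OF sumle]) simp
  finally show ?thesis .
qed

lemma weak_type_open:
  assumes f: "f \<in> borel_measurable borel" and E: "open E" "E \<subseteq> cball x R"
    and U: "U \<in> sets borel"
    and cov: "\<And>z. z \<in> E \<Longrightarrow> \<exists>c r. 0 < r \<and> z \<in> ball c r \<and> ball c r \<subseteq> U \<and>
       \<Lambda> * emeasure \<mu> (ball c r) \<le> (\<integral>\<^sup>+y\<in>ball c r. f y \<partial>\<mu>)"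
  shows "\<Lambda> * emeasure \<mu> E \<le> ennreal (D ^ 2) * (\<integral>\<^sup>+y\<in>U. f y \<partial>\<mu>)"
proof -
  \<comment> \<open>An exhaustion of \<open>E\<close> by compact sets. The distance to the
    complement is expressed by an intersection, so an empty complement needs no separate case,
    whereas \<open>infdist\<close> to the empty set is 0.\<close>
  define K where "K n = (\<Inter>w\<in>-E. {z. 1 / Suc n \<le> dist z w}) \<inter> cball x R" for n :: nat
  have Kc: "compact (K n)" for n unfolding K_def
    by (intro closed_Int_compact compact_cball closed_INT ballI closed_Collect_le continuous_intros)
  have KE: "K n \<subseteq> E" for n
  proof
    fix z assume z: "z \<in> K n"
    show "z \<in> E"
    proof (rule ccontr)
      assume "z \<notin> E"
      then have "1 / Suc n \<le> dist z z" using z unfolding K_def by blast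
      then show False by simp
    qed
  qed
  have "incseq K"
  proof (rule incseq_SucI)
    fix n
    have "1 / real (Suc (Suc n)) \<le> 1 / real (Suc n)" by (simp add: frac_le)
    then show "K n \<le> K (Suc n)" unfolding K_def by force
  qed
  have "E \<subseteq> (\<Union>n. K n)"
  proof
    fix z assume z: "z \<in> E"
    then obtain e where e: "0 < e" "ball z e \<subseteq> E" using E open_contains_ball by blast
    obtain n where n: "1 / Suc n < e" using nat_approx_posE[OF e(1)] by blast
    have "1 / Suc n \<le> dist z w" if "w \<notin> E" for w
      using n e(2) that by (smt (verit) mem_ball subsetD)
    then show "z \<in> (\<Union>n. K n)" using z E by (auto simp: K_def)
  qed
  then have UK: "(\<Union>n. K n) = E" using KE by auto
  have "emeasure \<mu> E = (SUP n. emeasure \<mu> (K n))"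
    by (subst SUP_emeasure_incseq) (use \<open>incseq K\<close> UK Kc in \<open>auto simp: sets_eq intro!: borel_closed compact_imp_closed\<close>)
  then have "\<Lambda> * emeasure \<mu> E = (SUP n. \<Lambda> * emeasure \<mu> (K n))"
    by (simp add: SUP_mult_left_ennreal)
  also have "\<dots> \<le> ennreal (D ^ 2) * (\<integral>\<^sup>+y\<in>U. f y \<partial>\<mu>)"
    by (rule SUP_least, rule weak_type_compact[OF f Kc U]) (use cov KE in blast)
  finally show ?thesis .
qed

text \<open>\<open>good f \<Lambda> x\<close> says that the uncentered Hardy--Littlewood maximal function of \<open>f\<close>
  is at most \<open>\<Lambda>\<close> at \<open>x\<close>.\<close>

definition good :: "('a \<Rightarrow> ennreal) \<Rightarrow> ennreal \<Rightarrow> 'a \<Rightarrow> bool" where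
  "good f \<Lambda> x \<longleftrightarrow> (\<forall>c r. 0 < r \<longrightarrow> x \<in> ball c r \<longrightarrow>
     (\<integral>\<^sup>+y\<in>ball c r. f y \<partial>\<mu>) \<le> \<Lambda> * emeasure \<mu> (ball c r))"

lemma goodD:
  "good f \<Lambda> x \<Longrightarrow> 0 < r \<Longrightarrow> x \<in> ball c r \<Longrightarrow>
    (\<integral>\<^sup>+y\<in>ball c r. f y \<partial>\<mu>) \<le> \<Lambda> * emeasure \<mu> (ball c r)"
  by (auto simp: good_def)

lemma good_mono:
  assumes "good f \<Lambda> x" "\<Lambda> \<le> \<Lambda>'" "\<And>y. f' y \<le> f y"
  shows "good f' \<Lambda>' x"
  unfolding good_def
proof (intro allI impI)
  fix c r assume "0 < (r::real)" "x \<in> ball c r"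
  have "(\<integral>\<^sup>+y\<in>ball c r. f' y \<partial>\<mu>) \<le> (\<integral>\<^sup>+y\<in>ball c r. f y \<partial>\<mu>)"
    by (intro nn_integral_mono mult_right_mono assms) simp
  also have "\<dots> \<le> \<Lambda> * emeasure \<mu> (ball c r)" by (rule goodD) fact+
  also have "\<dots> \<le> \<Lambda>' * emeasure \<mu> (ball c r)" by (intro mult_right_mono assms) simp
  finally show "(\<integral>\<^sup>+y\<in>ball c r. f' y \<partial>\<mu>) \<le> \<Lambda>' * emeasure \<mu> (ball c r)" .
qed

text \<open>This is the benefit of uncentered balls: a ball that witnesses failure at one point does
  so at all of its points.\<close>

lemma open_not_good: "open {x. \<not> good f \<Lambda> x}"
proof -
  have "{x. \<not> good f \<Lambda> x} = (\<Union>c. \<Union>r\<in>{r. 0 < r \<and>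
     \<not> (\<integral>\<^sup>+y\<in>ball c r. f y \<partial>\<mu>) \<le> \<Lambda> * emeasure \<mu> (ball c r)}. ball c r)"
    unfolding good_def by blast
  also have "open \<dots>" by auto
  finally show ?thesis .
qed

lemma closed_good: "closed {x. good f \<Lambda> x}"
  using open_not_good[of f \<Lambda>] by (simp add: closed_def Collect_neg_eq)

text \<open>A local weak type estimate whose right side uses only goodness of the centre
  \<open>x\<close>. A large offending ball contains \<open>x\<close> after doubling, which forces
  \<open>b \<le> D a\<close> outright. If all offending balls are smaller than \<open>r\<close>,
  they stay in \<open>ball x (4 * r)\<close>, where the integral of \<open>f\<close> is controlled
  by goodness of \<open>x\<close>.\<close>

lemma weak_type_good:
  assumes f: "f \<in> borel_measurable borel" and x: "good f a x" and r: "0 < r"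
  shows "b * emeasure \<mu> (ball x r \<inter> {z. \<not> good f b z}) \<le> ennreal (D ^ 4) * a * emeasure \<mu> (ball x r)"
proof (cases "\<exists>c s z. r \<le> s \<and> z \<in> ball x r \<and> z \<in> ball c s \<and>
     \<not> (\<integral>\<^sup>+y\<in>ball c s. f y \<partial>\<mu>) \<le> b * emeasure \<mu> (ball c s)")
  case True
  then obtain c s z where s: "r \<le> s" "z \<in> ball x r" "z \<in> ball c s"
    "b * emeasure \<mu> (ball c s) < (\<integral>\<^sup>+y\<in>ball c s. f y \<partial>\<mu>)" by (auto simp: not_le)
  have s0: "0 < s" using r s by simp
  have "dist c x < 2 * s" using s dist_triangle[of c x z] by (auto simp: dist_commute)
  then have "(\<integral>\<^sup>+y\<in>ball c (2 * s). f y \<partial>\<mu>) \<le> a * emeasure \<mu> (ball c (2 * s))"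
    using goodD[OF x] s0 by simp
  moreover have "(\<integral>\<^sup>+y\<in>ball c s. f y \<partial>\<mu>) \<le> (\<integral>\<^sup>+y\<in>ball c (2 * s). f y \<partial>\<mu>)"
    by (rule nn_integral_mono) (use s0 in \<open>auto simp: indicator_def\<close>)
  moreover have "a * emeasure \<mu> (ball c (2 * s)) \<le> a * (ennreal D * emeasure \<mu> (ball c s))"
    by (intro mult_left_mono doubling s0) simp
  ultimately have "b * emeasure \<mu> (ball c s) \<le> (ennreal D * a) * emeasure \<mu> (ball c s)"
    using s(4) by (simp add: ac_simps)
  then have "b \<le> ennreal D * a"
    using ball_pos[OF s0, of c] ball_finite[OF s0, of c]
      ennreal_mult_le_mult_iff[of "emeasure \<mu> (ball c s)" b "ennreal D * a"]
    by (simp add: mult.commute less_top)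
  also have "\<dots> \<le> ennreal (D ^ 4) * a"
    using D_ge_1 by (intro mult_right_mono ennreal_leI) (auto intro: self_le_power)
  finally show ?thesis by (intro mult_mono emeasure_mono) (auto simp: sets_eq)
next
  case False
  let ?E = "ball x r \<inter> {z. \<not> good f b z}"
  have "b * emeasure \<mu> ?E \<le> ennreal (D ^ 2) * (\<integral>\<^sup>+y\<in>ball x (4 * r). f y \<partial>\<mu>)"
  proof (rule weak_type_open[OF f, of _ x r])
    fix z assume z: "z \<in> ?E"
    then obtain c s where s: "0 < s" "z \<in> ball c s"
      "\<not> (\<integral>\<^sup>+y\<in>ball c s. f y \<partial>\<mu>) \<le> b * emeasure \<mu> (ball c s)" by (auto simp: good_def)
    then have "s < r" using False z by (meson IntD1 not_le)
    have "ball c s \<subseteq> ball x (4 * r)"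
    proof
      fix y assume "y \<in> ball c s"
      then show "y \<in> ball x (4 * r)" using z s(2) r \<open>s < r\<close> dist_triangle[of x y z] dist_triangle[of z y c]
        by (auto simp: dist_commute)
    qed
    then show "\<exists>c s. 0 < s \<and> z \<in> ball c s \<and> ball c s \<subseteq> ball x (4 * r) \<and>
       b * emeasure \<mu> (ball c s) \<le> (\<integral>\<^sup>+y\<in>ball c s. f y \<partial>\<mu>)"
      using s by (intro exI[of _ c] exI[of _ s]) (auto simp: not_le less_imp_le)
  qed (auto intro: open_Int open_not_good)
  also have "\<dots> \<le> ennreal (D ^ 2) * (a * emeasure \<mu> (ball x (4 * r)))"
    using goodD[OF x, of "4 * r" x] r by (intro mult_left_mono) auto
  also have "\<dots> \<le> ennreal (D ^ 2) * (a * (ennreal (D ^ 2) * emeasure \<mu> (ball x r)))"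
    using emeasure_compare[of r "4 * r" x x 2] r by (intro mult_left_mono) auto
  also have "\<dots> = ennreal (D ^ 4) * a * emeasure \<mu> (ball x r)"
  proof -
    have "D ^ 4 = D ^ 2 * D ^ 2" by (simp flip: power_add)
    then have "ennreal (D ^ 4) = ennreal (D ^ 2) * ennreal (D ^ 2)" using D_ge_1 by (simp only: ennreal_mult zero_le_power2)
    then show ?thesis by (simp add: ac_simps)
  qed
  finally show ?thesis .
qed

end

section \<open>Pointwise estimates from the Poincare inequality\<close>

lemma epowr_ennreal: "0 \<le> a \<Longrightarrow> epowr (ennreal a) e = ennreal (a powr e)"
  by (simp add: epowr_def)

lemma epowr_mono:
  assumes "a \<le> b" "0 \<le> e" shows "epowr a e \<le> epowr b e"
proof (cases "b = top")
  case True then show ?thesis by (simp add: epowr_def)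
next
  case False
  then obtain b' where b: "b = ennreal b'" "0 \<le> b'" by (cases b) auto
  then obtain a' where a: "a = ennreal a'" "0 \<le> a'" using assms(1) False by (cases a) (auto simp: top_unique)
  have "a' \<le> b'" using assms(1) a b by simp
  then show ?thesis using a b assms(2) by (simp add: epowr_ennreal powr_mono2)
qed

lemma epowr_inverse: "0 \<le> s \<Longrightarrow> 0 < p \<Longrightarrow> epowr (ennreal (s powr p)) (1 / p) = ennreal s"
  by (simp add: epowr_ennreal powr_powr powr_one_gt_zero_iff)

lemma epowr_measurable[measurable]: "(\<lambda>a. epowr a e) \<in> borel_measurable borel"
  unfolding epowr_def by measurable

lemma telescope_limit:
  fixes a :: "nat \<Rightarrow> real"
  assumes step: "\<And>k. \<bar>a k - a (Suc k)\<bar> \<le> b k" and lim: "a \<longlonglongrightarrow> l" and b: "b sums S"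
  shows "\<bar>a 0 - l\<bar> \<le> S"
proof -
  have b0: "0 \<le> b k" for k using step[of k] by linarith
  have "\<bar>a 0 - a n\<bar> \<le> S" for n
  proof -
    have "\<bar>a 0 - a n\<bar> \<le> (\<Sum>k<n. b k)"
    proof (induction n)
      case (Suc n)
      then show ?case using step[of n] by simp
    qed simp
    also have "\<dots> \<le> S" using sum_le_suminf[OF sums_summable[OF b], of "{..<n}"] b0 sums_unique[OF b] by simp
    finally show ?thesis .
  qed
  moreover have "(\<lambda>n. \<bar>a 0 - a n\<bar>) \<longlonglongrightarrow> \<bar>a 0 - l\<bar>" by (intro tendsto_intros lim)
  ultimately show ?thesis by (intro LIMSEQ_le_const2) auto
qed

context doubling_space
begin

text \<open>The centered counterpart of \<open>good\<close>. The Poincare inequality is applied on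
  balls about a fixed point and their concentric dilates, so only these averages are
  relevant.\<close>

definition cgood :: "('a \<Rightarrow> ennreal) \<Rightarrow> ennreal \<Rightarrow> 'a \<Rightarrow> bool" where
  "cgood f \<Lambda> x \<longleftrightarrow> (\<forall>r>0. (\<integral>\<^sup>+y\<in>ball x r. f y \<partial>\<mu>) \<le> \<Lambda> * emeasure \<mu> (ball x r))"

definition avg :: "('a \<Rightarrow> real) \<Rightarrow> 'a \<Rightarrow> real \<Rightarrow> real" where
  "avg u x r = (\<integral>y. u y * indicator (ball x r) y \<partial>\<mu>) / measure \<mu> (ball x r)"

lemma integrable_ball:
  fixes u :: "'a \<Rightarrow> real"
  assumes u: "L-lipschitz_on UNIV u" and r: "0 < r"
  shows "integrable \<mu> (\<lambda>y. u y * indicator (ball x r) y)"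
proof (rule integrableI_bounded_set[where A="ball x r" and B="\<bar>u x\<bar> + L * r"])
  have [measurable]: "u \<in> borel_measurable borel"
    using lipschitz_on_continuous_on[OF u] by (rule borel_measurable_continuous_onI)
  show "(\<lambda>y. u y * indicator (ball x r) y) \<in> borel_measurable \<mu>" by measurable
  show "emeasure \<mu> (ball x r) < \<infinity>" by (rule ball_finite[OF r])
  show "AE y in \<mu>. y \<in> ball x r \<longrightarrow> norm (u y * indicator (ball x r) y) \<le> \<bar>u x\<bar> + L * r"
  proof (intro AE_I2 impI)
    fix y assume y: "y \<in> ball x r"
    have "\<bar>u x - u y\<bar> \<le> L * dist x y" using lipschitz_onD[OF u, of x y] by (simp add: dist_real_def)
    also have "\<dots> \<le> L * r" using y lipschitz_on_nonneg[OF u] by (intro mult_left_mono) auto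
    finally show "norm (u y * indicator (ball x r) y) \<le> \<bar>u x\<bar> + L * r" using y by auto
  qed
qed (auto simp: sets_eq)

lemma avg_diff:
  assumes u: "L-lipschitz_on UNIV u" and r: "0 < r"
  shows "ennreal (\<bar>avg u x r - a\<bar> * V x r) \<le> (\<integral>\<^sup>+y\<in>ball x r. ennreal \<bar>u y - a\<bar> \<partial>\<mu>)"
proof -
  have ia: "integrable \<mu> (\<lambda>y. a * indicator (ball x r) y)"
    using ball_finite[OF r, of x] by (auto simp: sets_eq)
  have i: "integrable \<mu> (\<lambda>y. u y * indicator (ball x r) y - a * indicator (ball x r) y)"
    by (rule Bochner_Integration.integrable_diff[OF integrable_ball[OF u r] ia])
  have "(\<integral>y. u y * indicator (ball x r) y - a * indicator (ball x r) y \<partial>\<mu>)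
     = (\<integral>y. u y * indicator (ball x r) y \<partial>\<mu>) - a * V x r"
    using Bochner_Integration.integral_diff[OF integrable_ball[OF u r] ia] by (simp add: V_def)
  also have "\<dots> = (avg u x r - a) * V x r"
    using V_pos[OF r, of x] by (simp add: avg_def V_def[symmetric] field_simps)
  finally have *: "(\<integral>y. u y * indicator (ball x r) y - a * indicator (ball x r) y \<partial>\<mu>) = (avg u x r - a) * V x r" .
  have "ennreal (\<bar>avg u x r - a\<bar> * V x r)
      = ennreal (norm (\<integral>y. u y * indicator (ball x r) y - a * indicator (ball x r) y \<partial>\<mu>))"
    using V_pos[OF r, of x] by (simp add: * abs_mult)
  also have "\<dots> \<le> (\<integral>\<^sup>+y. ennreal (norm (u y * indicator (ball x r) y - a * indicator (ball x r) y)) \<partial>\<mu>)"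
    by (rule integral_norm_bound_ennreal[OF i])
  also have "\<dots> = (\<integral>\<^sup>+y\<in>ball x r. ennreal \<bar>u y - a\<bar> \<partial>\<mu>)"
    by (rule nn_integral_cong) (auto simp: indicator_def)
  finally show ?thesis .
qed

lemma avg_tendsto:
  assumes u: "L-lipschitz_on UNIV u" and r: "0 < r"
  shows "\<bar>avg u x r - u x\<bar> \<le> L * r"
proof -
  have L: "0 \<le> L" by (rule lipschitz_on_nonneg[OF u])
  have "ennreal (\<bar>avg u x r - u x\<bar> * V x r) \<le> (\<integral>\<^sup>+y\<in>ball x r. ennreal \<bar>u y - u x\<bar> \<partial>\<mu>)"
    by (rule avg_diff[OF u r])
  also have "\<dots> \<le> (\<integral>\<^sup>+y\<in>ball x r. ennreal (L * r) \<partial>\<mu>)"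
  proof (rule nn_integral_mono)
    fix y
    show "ennreal \<bar>u y - u x\<bar> * indicator (ball x r) y \<le> ennreal (L * r) * indicator (ball x r) y"
    proof (cases "y \<in> ball x r")
      case True
      have "\<bar>u y - u x\<bar> \<le> L * dist y x" using lipschitz_onD[OF u, of y x] by (simp add: dist_real_def)
      also have "\<dots> \<le> L * r" using True L by (intro mult_left_mono) (auto simp: dist_commute)
      finally show ?thesis by (intro mult_right_mono ennreal_leI) auto
    qed auto
  qed
  also have "\<dots> = ennreal (L * r * V x r)"
    using r L by (simp add: nn_integral_cmult_indicator sets_eq emeasure_ball ennreal_mult)
  finally have "\<bar>avg u x r - u x\<bar> * V x r \<le> L * r * V x r" using L r by (simp add: ennreal_le_iff)
  then show ?thesis using V_pos[OF r, of x] by simp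
qed

text \<open>Goodness holds at every radius, hence also on the ball dilated by \<open>\<tau>\<close>;
  from here on the dilation has disappeared from the inequality.\<close>

lemma poincare_cgood:
  assumes p: "1 < p" and PI: "weak_poincare \<mu> p"
  obtains CP where "0 < CP"
    "\<And>u g s x r. continuous_on UNIV u \<Longrightarrow> upper_gradient_on UNIV u g \<Longrightarrow> 0 \<le> s \<Longrightarrow> 0 < r \<Longrightarrow>
       cgood (\<lambda>y. epowr (g y) p) (ennreal (s powr p)) x \<Longrightarrow>
      (\<integral>\<^sup>+y\<in>ball x r. ennreal \<bar>u y - avg u x r\<bar> \<partial>\<mu>) \<le> ennreal (CP * r * s * V x r)"
proof -
  obtain CP \<tau> where CP: "CP > 0" "\<tau> \<ge> 1" and
    PI': "\<And>x r u g. 0 < r \<Longrightarrow> continuous_on UNIV u \<Longrightarrow> upper_gradient_on UNIV u g \<Longrightarrow>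
          (\<integral>\<^sup>+ y. ennreal \<bar>u y - avg u x r\<bar> * indicator (ball x r) y \<partial>\<mu>) / emeasure \<mu> (ball x r)
          \<le> ennreal (CP * r) *
            epowr ((\<integral>\<^sup>+ y. epowr (g y) p * indicator (ball x (\<tau> * r)) y \<partial>\<mu>)
                     / emeasure \<mu> (ball x (\<tau> * r))) (1 / p)"
    using PI unfolding weak_poincare_def Let_def avg_def by blast
  show ?thesis
  proof (rule that[OF CP(1)])
    fix u :: "'a \<Rightarrow> real" and g s x and r :: real
    assume u: "continuous_on UNIV u" "upper_gradient_on UNIV u g" and s: "0 \<le> s" and r: "0 < r"
      and good: "cgood (\<lambda>y. epowr (g y) p) (ennreal (s powr p)) x"
    let ?X = "(\<integral>\<^sup>+ y. ennreal \<bar>u y - avg u x r\<bar> * indicator (ball x r) y \<partial>\<mu>)"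
    let ?Y = "(\<integral>\<^sup>+ y. epowr (g y) p * indicator (ball x (\<tau> * r)) y \<partial>\<mu>)"
    have \<tau>r: "0 < \<tau> * r" using CP r by auto
    have "?Y \<le> ennreal (s powr p) * emeasure \<mu> (ball x (\<tau> * r))" using good \<tau>r by (auto simp: cgood_def)
    then have "?Y / emeasure \<mu> (ball x (\<tau> * r)) \<le> ennreal (s powr p)"
      using ball_pos[OF \<tau>r] by (intro divide_le_posI_ennreal) (auto simp: mult.commute)
    then have "epowr (?Y / emeasure \<mu> (ball x (\<tau> * r))) (1 / p) \<le> epowr (ennreal (s powr p)) (1 / p)"
      using p by (intro epowr_mono) auto
    also have "\<dots> = ennreal s" using s p by (intro epowr_inverse) auto
    finally have "?X / emeasure \<mu> (ball x r) \<le> ennreal (CP * r) * ennreal s"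
      using PI'[OF r u, of x] by (meson mult_left_mono order_trans zero_le)
    also have "\<dots> = ennreal (CP * r * s)" using CP r s by (simp add: ennreal_mult)
    finally have 1: "?X / ennreal (V x r) \<le> ennreal (CP * r * s)" using r by (simp add: emeasure_ball)
    have "?X = ?X / ennreal (V x r) * ennreal (V x r)"
      using V_pos[OF r, of x] by (simp add: ennreal_divide_times ennreal_times_divide ennreal_divide_self)
    also have "\<dots> \<le> ennreal (CP * r * s) * ennreal (V x r)" by (rule mult_right_mono[OF 1]) simp
    also have "\<dots> = ennreal (CP * r * s * V x r)" using CP r s by (simp add: ennreal_mult)
    finally show "?X \<le> ennreal (CP * r * s * V x r)" .
  qed
qed

text \<open>Telescoping of means over balls halving down to each point. Lipschitz continuity
  identifies the limits with the values of \<open>u\<close> at the points themselves, with no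
  exceptional null set.\<close>

lemma pointwise_estimate:
  assumes p: "1 < p" and PI: "weak_poincare \<mu> p"
  obtains C1 where "0 < C1"
    "\<And>u g s x y. \<exists>L. L-lipschitz_on UNIV u \<Longrightarrow> upper_gradient_on UNIV u g \<Longrightarrow> 0 \<le> s \<Longrightarrow>
       cgood (\<lambda>y. epowr (g y) p) (ennreal (s powr p)) x \<Longrightarrow>
       cgood (\<lambda>y. epowr (g y) p) (ennreal (s powr p)) y \<Longrightarrow> \<bar>u x - u y\<bar> \<le> C1 * s * dist x y"
proof -
  obtain CP where CP: "0 < CP" and PI:
    "\<And>u g s x r. continuous_on UNIV u \<Longrightarrow> upper_gradient_on UNIV u g \<Longrightarrow> 0 \<le> s \<Longrightarrow> 0 < r \<Longrightarrow>
       cgood (\<lambda>y. epowr (g y) p) (ennreal (s powr p)) x \<Longrightarrow>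
      (\<integral>\<^sup>+y\<in>ball x r. ennreal \<bar>u y - avg u x r\<bar> \<partial>\<mu>) \<le> ennreal (CP * r * s * V x r)"
    using poincare_cgood[OF p PI] by blast
  have D0: "0 < D" using D_ge_1 by simp
  \<comment> \<open>The three terms come from telescoping at \<open>x\<close> from radius
    \<open>2 * d\<close>, telescoping at \<open>y\<close> from radius \<open>d\<close>, and
    comparing these two starting means, where \<open>d\<close> is the distance of the
    points.\<close>
  define C1 where "C1 = 4 * D * CP + 2 * D * CP + D ^ 2 * CP * 2"
  show ?thesis
  proof (rule that[of C1])
    show "0 < C1" using CP D0 by (auto simp: C1_def intro!: add_pos_pos)
    fix u :: "'a \<Rightarrow> real" and g s x y
    assume "\<exists>L. L-lipschitz_on UNIV u" and ug: "upper_gradient_on UNIV u g" and s: "0 \<le> s"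
      and gx: "cgood (\<lambda>y. epowr (g y) p) (ennreal (s powr p)) x"
      and gy: "cgood (\<lambda>y. epowr (g y) p) (ennreal (s powr p)) y"
    then obtain L where u: "L-lipschitz_on UNIV u" by blast
    have uc: "continuous_on UNIV u" by (rule lipschitz_on_continuous_on[OF u])
    \<comment> \<open>The mean over the smaller ball is compared with that over the larger one by
      enlarging the domain of integration; \<open>k\<close> is the price in volume.\<close>
    have cmp: "\<bar>avg u z' r' - avg u z r\<bar> \<le> k * CP * r * s"
      if good: "cgood (\<lambda>y. epowr (g y) p) (ennreal (s powr p)) z" and r: "0 < r" "0 < r'"
        and sub: "ball z' r' \<subseteq> ball z r" and k: "V z r \<le> k * V z' r'" "0 \<le> k" for z z' r r' k
    proof -
      have "ennreal (\<bar>avg u z' r' - avg u z r\<bar> * V z' r')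
          \<le> (\<integral>\<^sup>+y\<in>ball z' r'. ennreal \<bar>u y - avg u z r\<bar> \<partial>\<mu>)"
        by (rule avg_diff[OF u r(2)])
      also have "\<dots> \<le> (\<integral>\<^sup>+y\<in>ball z r. ennreal \<bar>u y - avg u z r\<bar> \<partial>\<mu>)"
        by (rule nn_integral_mono) (use sub in \<open>auto simp: indicator_def\<close>)
      also have "\<dots> \<le> ennreal (CP * r * s * V z r)" by (rule PI[OF uc ug s r(1) good])
      also have "\<dots> \<le> ennreal (CP * r * s * (k * V z' r'))"
        using CP r s k by (intro ennreal_leI mult_left_mono) auto
      finally have "\<bar>avg u z' r' - avg u z r\<bar> * V z' r' \<le> CP * r * s * (k * V z' r')"
        using CP r s k by (subst (asm) ennreal_le_iff) auto
      then have "\<bar>avg u z' r' - avg u z r\<bar> * V z' r' \<le> (k * CP * r * s) * V z' r'" by (simp add: ac_simps)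
      then show ?thesis using V_pos[OF r(2), of z'] by (simp only: mult_le_cancel_right_pos)
    qed
    have tel: "\<bar>avg u z r - u z\<bar> \<le> 2 * D * CP * r * s"
      if good: "cgood (\<lambda>y. epowr (g y) p) (ennreal (s powr p)) z" and r: "0 < r" for z r
    proof -
      define a where "a k = avg u z (r / 2 ^ k)" for k :: nat
      have rk: "0 < r / 2 ^ k" for k :: nat using r by simp
      have "\<bar>a 0 - u z\<bar> \<le> 2 * D * CP * r * s"
      proof (rule telescope_limit)
        show "\<bar>a k - a (Suc k)\<bar> \<le> D * CP * r * s * (1 / 2) ^ k" for k
        proof -
          have "\<bar>avg u z (r / 2 ^ Suc k) - avg u z (r / 2 ^ k)\<bar> \<le> D * CP * (r / 2 ^ k) * s"
            by (rule cmp[OF good rk rk]) (use V_double[OF rk[of "Suc k"], of z] D0 r in \<open>auto simp: divide_simps\<close>)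
          then show ?thesis by (simp add: a_def abs_minus_commute power_divide)
        qed
        show "a \<longlonglongrightarrow> u z"
        proof (rule LIM_zero_cancel, rule Lim_null_comparison)
          show "\<forall>\<^sub>F k in sequentially. norm (a k - u z) \<le> L * (r / 2 ^ k)"
            using avg_tendsto[OF u rk, of z] by (simp add: a_def)
          have "(\<lambda>k. L * r * (1 / 2) ^ k) \<longlonglongrightarrow> L * r * 0" by (intro tendsto_intros LIMSEQ_power_zero) auto
          then show "(\<lambda>k. L * (r / 2 ^ k)) \<longlonglongrightarrow> 0" by (simp add: power_divide)
        qed
        have "(\<lambda>k. D * CP * r * s * (1 / 2) ^ k) sums (D * CP * r * s * (1 / (1 - 1 / 2)))"
          by (intro sums_mult geometric_sums) auto
        then show "(\<lambda>k. D * CP * r * s * (1 / 2) ^ k) sums (2 * D * CP * r * s)" by (simp add: ac_simps)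
      qed
      then show ?thesis by (simp add: a_def)
    qed
    show "\<bar>u x - u y\<bar> \<le> C1 * s * dist x y"
    proof (cases "x = y")
      case False
      define d where "d = dist x y"
      have d: "0 < d" using False by (simp add: d_def)
      have 1: "\<bar>avg u x (2 * d) - u x\<bar> \<le> 2 * D * CP * (2 * d) * s" using tel[OF gx, of "2 * d"] d by simp
      have 2: "\<bar>avg u y d - u y\<bar> \<le> 2 * D * CP * d * s" using tel[OF gy d] .
      have 3: "\<bar>avg u y d - avg u x (2 * d)\<bar> \<le> D ^ 2 * CP * (2 * d) * s"
      proof (rule cmp[OF gx])
        show "ball y d \<subseteq> ball x (2 * d)"
        proof
          fix z assume "z \<in> ball y d"
          then show "z \<in> ball x (2 * d)" using dist_triangle[of x z y] by (auto simp: d_def)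
        qed
        show "V x (2 * d) \<le> D\<^sup>2 * V y d"
          by (rule V_compare) (use d in \<open>auto simp: d_def dist_commute\<close>)
      qed (use d D0 in auto)
      have "\<bar>u x - u y\<bar> \<le> 2 * D * CP * (2 * d) * s + 2 * D * CP * d * s + D ^ 2 * CP * (2 * d) * s"
        using 1 2 3 by linarith
      also have "\<dots> = C1 * s * d" by (simp add: C1_def algebra_simps)
      finally show ?thesis by (simp add: d_def)
    qed simp
  qed
qed

end

section \<open>Self-improvement for bounded continuous upper gradients\<close>

lemma mcshane_extension:
  fixes u :: "'a::metric_space \<Rightarrow> real"
  assumes ne: "S \<noteq> {}" and L: "0 \<le> L"
    and u: "\<And>x y. x \<in> S \<Longrightarrow> y \<in> S \<Longrightarrow> \<bar>u x - u y\<bar> \<le> L * dist x y"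
  obtains v where "L-lipschitz_on UNIV v" "\<And>x. x \<in> S \<Longrightarrow> v x = u x"
proof -
  define v where "v x = (INF a\<in>S. u a + L * dist x a)" for x
  obtain s where s: "s \<in> S" using ne by blast
  have bdd: "bdd_below ((\<lambda>a. u a + L * dist x a) ` S)" for x
  proof (rule bdd_belowI2)
    fix a assume "a \<in> S"
    then have "u s - u a \<le> L * dist s a" using u[OF s, of a] by auto
    also have "\<dots> \<le> L * (dist s x + dist x a)" by (intro mult_left_mono dist_triangle L)
    finally show "u s - L * dist s x \<le> u a + L * dist x a" by (simp add: algebra_simps)
  qed
  have le: "v x \<le> v y + L * dist x y" for x y
  proof -
    have "v x - L * dist x y \<le> u a + L * dist y a" if a: "a \<in> S" for a
    proof -
      have "v x \<le> u a + L * dist x a" unfolding v_def by (rule cINF_lower[OF bdd a])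
      also have "L * dist x a \<le> L * (dist x y + dist y a)" by (intro mult_left_mono dist_triangle L)
      finally show ?thesis by (simp add: algebra_simps)
    qed
    then have "v x - L * dist x y \<le> v y" unfolding v_def[of y] by (intro cINF_greatest[OF ne])
    then show ?thesis by simp
  qed
  show ?thesis
  proof (rule that)
    show "L-lipschitz_on UNIV v"
      by (rule lipschitz_onI[OF _ L]) (use le in \<open>force simp: dist_real_def abs_le_iff dist_commute algebra_simps\<close>)
    fix x assume x: "x \<in> S"
    have "v x \<le> u x + L * dist x x" unfolding v_def by (rule cINF_lower[OF bdd x])
    moreover have "u x \<le> v x" unfolding v_def
    proof (rule cINF_greatest[OF ne])
      fix a assume "a \<in> S"
      then show "u x \<le> u a + L * dist x a" using u[OF x, of a] by auto
    qed
    ultimately show "v x = u x" by simp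
  qed
qed

lemma upper_gradient_sum:
  fixes v :: "'i \<Rightarrow> 'a::metric_space \<Rightarrow> real"
  assumes ug: "\<And>i. i \<in> I \<Longrightarrow> upper_gradient_on UNIV (v i) (G i)" and c: "\<And>i. i \<in> I \<Longrightarrow> 0 \<le> c i"
  shows "upper_gradient_on UNIV (\<lambda>z. \<Sum>i\<in>I. c i * v i z) (\<lambda>z. \<Sum>i\<in>I. ennreal (c i) * G i z)"
  unfolding upper_gradient_on_def
proof (intro conjI allI impI)
  have Gm: "G i \<in> borel_measurable borel" if "i \<in> I" for i using ug[OF that] by (simp add: upper_gradient_on_def)
  show "(\<lambda>z. \<Sum>i\<in>I. ennreal (c i) * G i z) \<in> borel_measurable borel"
  proof (rule borel_measurable_sum)
    fix i assume "i \<in> I"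
    note [measurable] = Gm[OF this]
    show "(\<lambda>z. ennreal (c i) * G i z) \<in> borel_measurable borel" by measurable
  qed
  fix \<gamma> :: "real \<Rightarrow> 'a" and l assume \<gamma>': "arclength_curve \<gamma> l \<and> \<gamma> ` {0..l} \<subseteq> UNIV"
  then have \<gamma>: "arclength_curve \<gamma> l" by simp
  have "\<bar>(\<Sum>i\<in>I. c i * v i (\<gamma> 0)) - (\<Sum>i\<in>I. c i * v i (\<gamma> l))\<bar> = \<bar>\<Sum>i\<in>I. c i * (v i (\<gamma> 0) - v i (\<gamma> l))\<bar>"
    by (simp add: sum_subtractf right_diff_distrib)
  also have "\<dots> \<le> (\<Sum>i\<in>I. c i * \<bar>v i (\<gamma> 0) - v i (\<gamma> l)\<bar>)"
    by (rule order_trans[OF sum_abs]) (use c in \<open>auto simp: abs_mult intro!: sum_mono\<close>)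
  finally have "ennreal \<bar>(\<Sum>i\<in>I. c i * v i (\<gamma> 0)) - (\<Sum>i\<in>I. c i * v i (\<gamma> l))\<bar>
      \<le> ennreal (\<Sum>i\<in>I. c i * \<bar>v i (\<gamma> 0) - v i (\<gamma> l)\<bar>)" by (rule ennreal_leI)
  also have "\<dots> = (\<Sum>i\<in>I. ennreal (c i) * ennreal \<bar>v i (\<gamma> 0) - v i (\<gamma> l)\<bar>)"
    using c by (simp add: ennreal_mult sum_ennreal[symmetric])
  also have "\<dots> \<le> (\<Sum>i\<in>I. ennreal (c i) * (\<integral>\<^sup>+s\<in>{0..l}. G i (\<gamma> s) \<partial>lborel))"
    by (intro sum_mono mult_left_mono) (use ug \<gamma>' in \<open>auto simp: upper_gradient_on_def\<close>)
  also have "\<dots> = (\<Sum>i\<in>I. \<integral>\<^sup>+s. ennreal (c i) * (G i (\<gamma> (clamp_to l s)) * indicator {0..l} s) \<partial>lborel)"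
  proof (rule sum.cong)
    fix i assume i: "i \<in> I"
    note [measurable] = clamp_measurable[OF \<gamma> Gm[OF i]]
    show "ennreal (c i) * (\<integral>\<^sup>+s\<in>{0..l}. G i (\<gamma> s) \<partial>lborel)
      = (\<integral>\<^sup>+s. ennreal (c i) * (G i (\<gamma> (clamp_to l s)) * indicator {0..l} s) \<partial>lborel)"
      by (subst nn_integral_cmult) (auto simp: integral_clamp)
  qed simp
  also have "\<dots> = (\<integral>\<^sup>+s. (\<Sum>i\<in>I. ennreal (c i) * (G i (\<gamma> (clamp_to l s)) * indicator {0..l} s)) \<partial>lborel)"
  proof (rule nn_integral_sum[symmetric])
    fix i assume "i \<in> I"
    note [measurable] = clamp_measurable[OF \<gamma> Gm[OF this]]
    show "(\<lambda>s. ennreal (c i) * (G i (\<gamma> (clamp_to l s)) * indicator {0..l} s)) \<in> borel_measurable lborel" by measurable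
  qed
  also have "\<dots> = (\<integral>\<^sup>+s\<in>{0..l}. (\<Sum>i\<in>I. ennreal (c i) * G i (\<gamma> s)) \<partial>lborel)"
    by (rule nn_integral_cong) (auto simp: indicator_def clamp_to_id)
  finally show "ennreal \<bar>(\<Sum>i\<in>I. c i * v i (\<gamma> 0)) - (\<Sum>i\<in>I. c i * v i (\<gamma> l))\<bar>
     \<le> (\<integral>\<^sup>+s\<in>{0..l}. (\<Sum>i\<in>I. ennreal (c i) * G i (\<gamma> s)) \<partial>lborel)" .
qed

context doubling_space
begin

text \<open>The constant belongs to one fixed pair \<open>u\<close>, \<open>g\<close>: the
  improvement step returns to the same pair, so it can be iterated without a supremum over all
  functions.\<close>

definition pointwise_bound :: "real \<Rightarrow> ('a \<Rightarrow> real) \<Rightarrow> ('a \<Rightarrow> real) \<Rightarrow> real \<Rightarrow> bool" where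
  "pointwise_bound q u g A \<longleftrightarrow> (\<forall>x y s. 0 \<le> s \<longrightarrow> good (\<lambda>z. ennreal (g z powr q)) (ennreal (s powr q)) x \<longrightarrow>
     good (\<lambda>z. ennreal (g z powr q)) (ennreal (s powr q)) y \<longrightarrow> \<bar>u x - u y\<bar> \<le> A * s * dist x y)"

lemma pointwise_boundD:
  "pointwise_bound q u g A \<Longrightarrow> 0 \<le> s \<Longrightarrow> good (\<lambda>z. ennreal (g z powr q)) (ennreal (s powr q)) x \<Longrightarrow>
     good (\<lambda>z. ennreal (g z powr q)) (ennreal (s powr q)) y \<Longrightarrow> \<bar>u x - u y\<bar> \<le> A * s * dist x y"
  by (auto simp: pointwise_bound_def)

text \<open>Continuity replaces the Lebesgue differentiation theorem: if \<open>g\<close> exceeded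
  \<open>s\<close> at \<open>x\<close>, it would do so by a margin on a small ball. The bound
  therefore holds at every good point.\<close>

lemma good_continuous:
  assumes g: "continuous_on UNIV g" "\<And>z. 0 \<le> g z" and q: "0 < q" and s: "0 \<le> s"
    and good: "good (\<lambda>z. ennreal (g z powr q)) (ennreal (s powr q)) x"
  shows "g x \<le> s"
proof (rule ccontr)
  assume "\<not> g x \<le> s"
  then have gs: "s < g x" by simp
  define m where "m = (s + g x) / 2"
  have m: "s < m" "m < g x" using gs by (auto simp: m_def)
  have "open {z. m < g z}" by (intro open_Collect_less continuous_on_const g)
  then obtain r where r: "0 < r" "ball x r \<subseteq> {z. m < g z}" using m(2) open_contains_ball by blast
  have "ennreal (m powr q * V x r) = (\<integral>\<^sup>+y\<in>ball x r. ennreal (m powr q) \<partial>\<mu>)"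
    using r by (simp add: nn_integral_cmult_indicator sets_eq emeasure_ball ennreal_mult)
  also have "\<dots> \<le> (\<integral>\<^sup>+y\<in>ball x r. ennreal (g y powr q) \<partial>\<mu>)"
    by (rule nn_integral_mono) (use r m s q in \<open>auto simp: indicator_def intro!: ennreal_leI powr_mono2\<close>)
  also have "\<dots> \<le> ennreal (s powr q) * emeasure \<mu> (ball x r)" by (rule goodD[OF good]) (use r in auto)
  also have "\<dots> = ennreal (s powr q * V x r)" using r by (simp add: emeasure_ball ennreal_mult)
  finally have "m powr q * V x r \<le> s powr q * V x r" by (simp add: ennreal_le_iff)
  then have "m powr q \<le> s powr q" using V_pos[OF r(1), of x] by simp
  moreover have "s powr q < m powr q" using m s q by (intro powr_less_mono2) auto
  ultimately show False by simp
qed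

text \<open>Origin of the constant: \<open>C1\<close> from the \<open>p\<close>-estimate applied to
  the averaged function; \<open>2 * A / real N + 2\<close> from the ratio of its gradient to the
  level \<open>t j\<close>; \<open>D ^ 4\<close> from the weak type estimate; 2 from
  \<open>2 powr (N (p - q)) \<le> 2\<close>; and \<open>N + 1\<close> from the number of
  levels.\<close>

lemma self_improvement_step:
  assumes C1: "0 < C1"
    and P1: "\<And>u g s x y. \<exists>L. L-lipschitz_on UNIV u \<Longrightarrow> upper_gradient_on UNIV u g \<Longrightarrow> 0 \<le> s \<Longrightarrow>
       cgood (\<lambda>y. epowr (g y) p) (ennreal (s powr p)) x \<Longrightarrow>
       cgood (\<lambda>y. epowr (g y) p) (ennreal (s powr p)) y \<Longrightarrow> \<bar>u x - u y\<bar> \<le> C1 * s * dist x y"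
    and p: "1 < p" and q: "0 < q" "q < p" and N: "0 < N" "real N * (p - q) \<le> 1"
    and ug: "upper_gradient_on UNIV u (\<lambda>z. ennreal (g z))"
    and g: "continuous_on UNIV g" "\<And>z. 0 < g z" "\<And>z. g z \<le> K"
    and A: "0 \<le> A" and PW: "pointwise_bound q u g A"
  shows "pointwise_bound q u g (C1 * ((2 * A / real N + 2) * (2 * D ^ 4 * (real N + 1)) powr (1 / p)))"
  unfolding pointwise_bound_def
proof (intro allI impI)
  fix x y s
  assume s0: "0 \<le> s" and gx: "good (\<lambda>z. ennreal (g z powr q)) (ennreal (s powr q)) x"
    and gy: "good (\<lambda>z. ennreal (g z powr q)) (ennreal (s powr q)) y"
  define f where "f = (\<lambda>z. ennreal (g z powr q))"
  have gm[measurable]: "g \<in> borel_measurable borel" by (rule borel_measurable_continuous_onI[OF g(1)])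
  have fm: "f \<in> borel_measurable borel" unfolding f_def by measurable
  \<comment> \<open>Positivity of \<open>g\<close> at the good point \<open>x\<close> excludes
    \<open>s = 0\<close>, so all levels \<open>t i\<close> are positive.\<close>
  have "g x \<le> s" by (rule good_continuous[OF g(1) less_imp_le[OF g(2)] q(1) s0 gx])
  then have s: "0 < s" using g(2)[of x] by simp
  define t where "t i = 2 ^ i * s" for i :: nat
  have t0: "0 < t i" for i using s by (simp add: t_def)
  define F where "F i = {z. good f (ennreal (t i powr q)) z}" for i
  have Fc: "closed (F i)" for i unfolding F_def by (rule closed_good)
  have Fmono: "F i \<subseteq> F j" if "i \<le> j" for i j
  proof -
    have "t i \<le> t j" using that s by (auto simp: t_def intro!: mult_right_mono power_increasing)
    then have "ennreal (t i powr q) \<le> ennreal (t j powr q)" using t0[of i] q by (intro ennreal_leI powr_mono2) auto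
    then show ?thesis by (auto simp: F_def intro: good_mono)
  qed
  have gF: "g z \<le> t i" if "z \<in> F i" for z i
    using that good_continuous[OF g(1) less_imp_le[OF g(2)] q(1) less_imp_le[OF t0]] by (simp add: F_def f_def)
  have xyF: "x \<in> F i" "y \<in> F i" for i
  proof -
    have "x \<in> F 0" "y \<in> F 0" using gx gy by (auto simp: F_def f_def t_def)
    then show "x \<in> F i" "y \<in> F i" using Fmono[of 0 i] by auto
  qed
  have "\<exists>v. (A * t i)-lipschitz_on UNIV v \<and> (\<forall>z\<in>F i. v z = u z)" for i
  proof -
    have "\<bar>u a - u b\<bar> \<le> A * t i * dist a b" if "a \<in> F i" "b \<in> F i" for a b
      using pointwise_boundD[OF PW less_imp_le[OF t0[of i]]] that by (simp add: F_def f_def)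
    then show ?thesis using mcshane_extension[of "F i" "A * t i" u] xyF(1)[of i] A t0[of i]
      by (metis empty_iff less_imp_le mult_nonneg_nonneg)
  qed
  then obtain v where v: "\<And>i. (A * t i)-lipschitz_on UNIV (v i)" "\<And>i z. z \<in> F i \<Longrightarrow> v i z = u z" by metis
  \<comment> \<open>The glued gradient of the extension from \<open>F i\<close>: the original
    \<open>g\<close> on \<open>F i\<close>, the Lipschitz constant of the extension
    elsewhere.\<close>
  define G where "G i z = (if z \<in> F i then g z else A * t i)" for i z
  have G0: "0 \<le> G i z" for i z using g(2)[of z] A t0[of i] by (auto simp: G_def)
  have ugG: "upper_gradient_on UNIV (v i) (\<lambda>z. ennreal (G i z))" for i
  proof -
    have "upper_gradient_on UNIV (v i) (\<lambda>z. ennreal (g z) * indicator (F i) z + ennreal (A * t i) * indicator (- F i) z)"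
      by (rule upper_gradient_glue[OF ug _ Fc v(2) v(1)]) (auto intro: ennreal_leI g(3))
    also have "(\<lambda>z. ennreal (g z) * indicator (F i) z + ennreal (A * t i) * indicator (- F i) z) = (\<lambda>z. ennreal (G i z))"
      by (auto simp: G_def indicator_def)
    finally show ?thesis .
  qed
  define w where "w z = (\<Sum>i\<in>{1..N}. (1 / real N) * v i z)" for z
  define H where "H z = (\<Sum>i\<in>{1..N}. (1 / real N) * G i z)" for z
  have H0: "0 \<le> H z" for z unfolding H_def using G0 by (intro sum_nonneg) auto
  have ugw: "upper_gradient_on UNIV w (\<lambda>z. ennreal (H z))"
  proof -
    have "upper_gradient_on UNIV w (\<lambda>z. \<Sum>i\<in>{1..N}. ennreal (1 / real N) * ennreal (G i z))"
      unfolding w_def by (rule upper_gradient_sum[OF ugG]) simp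
    also have "(\<lambda>z. \<Sum>i\<in>{1..N}. ennreal (1 / real N) * ennreal (G i z)) = (\<lambda>z. ennreal (H z))"
      unfolding H_def using G0 by (simp add: ennreal_mult'[symmetric] sum_ennreal)
    finally show ?thesis .
  qed
  have wlip: "(\<Sum>i\<in>{1..N}. (1 / real N) * (A * t i))-lipschitz_on UNIV w"
  proof (rule lipschitz_onI)
    fix a b
    have "dist (w a) (w b) = \<bar>\<Sum>i\<in>{1..N}. (1 / real N) * (v i a - v i b)\<bar>"
      by (simp add: w_def dist_real_def sum_subtractf right_diff_distrib diff_divide_distrib)
    also have "\<dots> \<le> (\<Sum>i\<in>{1..N}. (1 / real N) * \<bar>v i a - v i b\<bar>)"
      by (rule order_trans[OF sum_abs]) (auto simp: abs_mult intro!: sum_mono)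
    also have "\<dots> \<le> (\<Sum>i\<in>{1..N}. (1 / real N) * ((A * t i) * dist a b))"
      using lipschitz_onD[OF v(1)] by (intro sum_mono mult_left_mono) (auto simp: dist_real_def)
    also have "\<dots> = (\<Sum>i\<in>{1..N}. (1 / real N) * (A * t i)) * dist a b"
      by (simp add: sum_distrib_right)
    finally show "dist (w a) (w b) \<le> (\<Sum>i\<in>{1..N}. (1 / real N) * (A * t i)) * dist a b" .
  qed (use A t0 in \<open>auto intro!: sum_nonneg mult_nonneg_nonneg divide_nonneg_nonneg simp: less_imp_le\<close>)
  have wxy: "w x = u x" "w y = u y" using v(2)[OF xyF(1)] v(2)[OF xyF(2)] N by (simp_all add: w_def)
  define c where "c = 2 * A / real N + 2"
  have c0: "0 < c" using A by (simp add: c_def add_nonneg_pos)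
  \<comment> \<open>Level 0 is the whole space, so every point has a last level \<open>j\<close> in
    \<open>{0..N}\<close> whose set contains it.\<close>
  define E where "E i = (if i = 0 then UNIV else - F i)" for i
  have Hp: "epowr (ennreal (H z)) p \<le> ennreal (c powr p) * (\<Sum>i\<in>{0..N}. ennreal (t i powr p) * indicator (E i) z)" for z
  proof -
    define j where "j = Max {i \<in> {0..N}. z \<in> E i}"
    have "j \<in> {i \<in> {0..N}. z \<in> E i}" unfolding j_def by (rule Max_in) (auto simp: E_def intro: exI[of _ 0])
    then have j: "j \<le> N" "z \<in> E j" by auto
    have jmax: "i \<le> j" if "i \<le> N" "z \<in> E i" for i unfolding j_def by (rule Max_ge) (use that in auto)
    have sumt: "(\<Sum>i\<in>{1..k}. t i) \<le> 2 * t k" for k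
    proof (induction k)
      case 0 then show ?case using t0[of 0] by simp
    next
      case (Suc k) then show ?case by (simp add: t_def ac_simps)
    qed
    \<comment> \<open>Beyond level \<open>j\<close> the point lies in \<open>F (Suc j)\<close>,
      where \<open>g\<close> is at most \<open>t (Suc j) = 2 * t j\<close>. Up to level
      \<open>j\<close> the slope \<open>A * t i\<close> may be paid, and these slopes add up to at
      most \<open>2 * A * t j\<close>.\<close>
    have Gi: "G i z \<le> (if i \<le> j then A * t i else 0) + 2 * t j" if i: "i \<in> {1..N}" for i
    proof (cases "i \<le> j")
      case True
      have "z \<notin> F i \<or> g z \<le> 2 * t j"
      proof (cases "z \<in> F i")
        case True2: True
        then have "g z \<le> t i" by (rule gF)
        also have "\<dots> \<le> t j" using True s by (auto simp: t_def intro!: power_increasing)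
        finally show ?thesis using t0[of j] by simp
      qed simp
      then show ?thesis using True A t0[of i] t0[of j] by (auto simp: G_def intro: add_increasing)
    next
      case False
      then have "Suc j \<le> N" "Suc j \<le> i" using i by auto
      then have "z \<notin> E (Suc j)" using jmax[of "Suc j"] by auto
      then have zF: "z \<in> F (Suc j)" by (simp add: E_def)
      then have "z \<in> F i" using Fmono[OF \<open>Suc j \<le> i\<close>] by auto
      then show ?thesis using False gF[OF zF] by (simp add: G_def t_def)
    qed
    have "H z \<le> (\<Sum>i\<in>{1..N}. (1 / real N) * ((if i \<le> j then A * t i else 0) + 2 * t j))"
      unfolding H_def by (intro sum_mono mult_left_mono Gi) auto
    also have "\<dots> = (1 / real N) * ((\<Sum>i\<in>{1..N}. if i \<le> j then A * t i else 0) + real N * (2 * t j))"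
      by (subst sum_distrib_left[symmetric]) (simp add: sum.distrib)
    also have "(\<Sum>i\<in>{1..N}. if i \<le> j then A * t i else 0) = (\<Sum>i\<in>{1..j}. A * t i)"
      by (rule sum.mono_neutral_cong_right) (use j in auto)
    also have "(1 / real N) * ((\<Sum>i\<in>{1..j}. A * t i) + real N * (2 * t j)) \<le> (1 / real N) * (A * (2 * t j) + real N * (2 * t j))"
      using sumt[of j] A by (intro mult_left_mono add_right_mono) (auto simp: sum_distrib_left[symmetric] intro: mult_left_mono)
    also have "\<dots> = c * t j" using N by (simp add: c_def field_simps)
    finally have "H z \<le> c * t j" .
    then have "H z powr p \<le> (c * t j) powr p" using H0 p by (intro powr_mono2) auto
    also have "\<dots> = c powr p * t j powr p" using c0 t0[of j] by (simp add: powr_mult)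
    finally have "epowr (ennreal (H z)) p \<le> ennreal (c powr p * t j powr p)"
      using H0 by (simp add: epowr_ennreal ennreal_leI)
    also have "\<dots> = ennreal (c powr p) * (\<Sum>i\<in>{j}. ennreal (t i powr p) * indicator (E i) z)"
      using j(2) by (simp add: ennreal_mult)
    also have "\<dots> \<le> ennreal (c powr p) * (\<Sum>i\<in>{0..N}. ennreal (t i powr p) * indicator (E i) z)"
      by (intro mult_left_mono sum_mono2) (use j(1) in auto)
    finally show ?thesis .
  qed
  \<comment> \<open>Chosen so that \<open>s' powr p\<close> equals the sum of the equal bounds for
    the \<open>N + 1\<close> levels.\<close>
  define s' where "s' = c * (2 * D ^ 4 * (real N + 1)) powr (1 / p) * s"
  have D0: "0 < D" using D_ge_1 by simp
  have s'p: "s' powr p = c powr p * ((real N + 1) * (2 * D ^ 4 * s powr p))"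
  proof -
    have "s' powr p = c powr p * ((2 * D ^ 4 * (real N + 1)) powr (1 / p)) powr p * s powr p"
      unfolding s'_def using c0 s by (simp add: powr_mult)
    also have "((2 * D ^ 4 * (real N + 1)) powr (1 / p)) powr p = 2 * D ^ 4 * (real N + 1)"
      using p D0 by (simp add: powr_powr)
    finally show ?thesis by (simp add: ac_simps)
  qed
  have Em[measurable]: "E i \<in> sets borel" for i using Fc[of i] by (auto simp: E_def)
  have cg: "cgood (\<lambda>z. epowr (ennreal (H z)) p) (ennreal (s' powr p)) a" if a: "a \<in> F 0" for a
    unfolding cgood_def
  proof (intro allI impI)
    fix r :: real assume r: "0 < r"
    let ?m = "emeasure \<mu> (ball a r)"
    \<comment> \<open>The weak type estimate controls \<open>t i powr q\<close> times the measure.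
      The missing factor is \<open>t i powr (p - q)\<close>, and it stays below
      \<open>2 * s powr (p - q)\<close> because \<open>N (p - q) \<le> 1\<close>.\<close>
    have Ei: "ennreal (t i powr p) * emeasure \<mu> (E i \<inter> ball a r) \<le> ennreal (2 * D ^ 4 * s powr p) * ?m"
      if i: "i \<in> {0..N}" for i
    proof (cases "i = 0")
      case True
      have "1 * s powr p \<le> 2 * D ^ 4 * s powr p"
        using one_le_power[OF D_ge_1, of 4] by (intro mult_right_mono) auto
      then show ?thesis using True by (simp add: E_def t_def) (intro mult_right_mono ennreal_leI, auto)
    next
      case False
      have "ennreal (t i powr q) * emeasure \<mu> (ball a r \<inter> {z. \<not> good f (ennreal (t i powr q)) z})
          \<le> ennreal (D ^ 4) * ennreal (s powr q) * ?m"
        by (rule weak_type_good[OF fm _ r]) (use a in \<open>simp add: F_def t_def\<close>)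
      also have "ball a r \<inter> {z. \<not> good f (ennreal (t i powr q)) z} = E i \<inter> ball a r"
        using False by (auto simp: E_def F_def)
      finally have w: "ennreal (t i powr q) * emeasure \<mu> (E i \<inter> ball a r) \<le> ennreal (D ^ 4) * ennreal (s powr q) * ?m" .
      have "ennreal (t i powr p) * emeasure \<mu> (E i \<inter> ball a r)
          = ennreal (t i powr (p - q)) * (ennreal (t i powr q) * emeasure \<mu> (E i \<inter> ball a r))"
        by (simp add: mult.assoc[symmetric] ennreal_mult[symmetric] powr_add[symmetric])
      also have "\<dots> \<le> ennreal (t i powr (p - q)) * (ennreal (D ^ 4) * ennreal (s powr q) * ?m)"
        by (rule mult_left_mono[OF w]) simp
      also have "\<dots> = ennreal (t i powr (p - q) * D ^ 4 * s powr q) * ?m"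
        using D0 by (simp add: ennreal_mult mult.assoc)
      also have "\<dots> \<le> ennreal (2 * D ^ 4 * s powr p) * ?m"
      proof (intro mult_right_mono ennreal_leI)
        have "t i powr (p - q) = (2 powr real i * s) powr (p - q)" by (simp add: t_def powr_realpow)
        also have "\<dots> = 2 powr (real i * (p - q)) * s powr (p - q)"
          using s by (simp add: powr_mult powr_powr)
        also have "\<dots> \<le> 2 powr 1 * s powr (p - q)"
        proof (intro mult_right_mono powr_mono)
          have "real i * (p - q) \<le> real N * (p - q)" using i q by (intro mult_right_mono) auto
          then show "real i * (p - q) \<le> 1" using N by simp
        qed auto
        finally have "t i powr (p - q) * D ^ 4 * s powr q \<le> 2 * s powr (p - q) * D ^ 4 * s powr q"
          using D0 by (intro mult_right_mono) auto
        also have "\<dots> = 2 * D ^ 4 * (s powr (p - q) * s powr q)" by simp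
        also have "s powr (p - q) * s powr q = s powr p" by (simp add: powr_add[symmetric])
        finally show "t i powr (p - q) * D ^ 4 * s powr q \<le> 2 * D ^ 4 * s powr p" .
      qed simp
      finally show ?thesis .
    qed
    have "(\<integral>\<^sup>+z\<in>ball a r. epowr (ennreal (H z)) p \<partial>\<mu>)
       \<le> (\<integral>\<^sup>+z. (\<Sum>i\<in>{0..N}. ennreal (c powr p) * (ennreal (t i powr p) * indicator (E i \<inter> ball a r) z)) \<partial>\<mu>)"
    proof (rule nn_integral_mono)
      fix z
      have "epowr (ennreal (H z)) p * indicator (ball a r) z
        \<le> ennreal (c powr p) * (\<Sum>i\<in>{0..N}. ennreal (t i powr p) * indicator (E i) z) * indicator (ball a r) z"
        by (rule mult_right_mono[OF Hp]) simp
      also have "\<dots> = (\<Sum>i\<in>{0..N}. ennreal (c powr p) * (ennreal (t i powr p) * indicator (E i \<inter> ball a r) z))"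
        unfolding sum_distrib_left sum_distrib_right indicator_inter_arith mult.assoc ..
      finally show "epowr (ennreal (H z)) p * indicator (ball a r) z
        \<le> (\<Sum>i\<in>{0..N}. ennreal (c powr p) * (ennreal (t i powr p) * indicator (E i \<inter> ball a r) z))" .
    qed
    also have "\<dots> = (\<Sum>i\<in>{0..N}. (\<integral>\<^sup>+z. ennreal (c powr p) * (ennreal (t i powr p) * indicator (E i \<inter> ball a r) z) \<partial>\<mu>))"
      by (rule nn_integral_sum) measurable
    also have "\<dots> = (\<Sum>i\<in>{0..N}. ennreal (c powr p) * (ennreal (t i powr p) * emeasure \<mu> (E i \<inter> ball a r)))"
      by (rule sum.cong) (auto simp: nn_integral_cmult nn_integral_cmult_indicator sets_eq)
    also have "\<dots> \<le> (\<Sum>i\<in>{0..N}. ennreal (c powr p) * (ennreal (2 * D ^ 4 * s powr p) * ?m))"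
      by (intro sum_mono mult_left_mono Ei) auto
    also have "\<dots> = ennreal (real N + 1) * (ennreal (c powr p) * (ennreal (2 * D ^ 4 * s powr p) * ?m))"
      by (simp add: ennreal_of_nat_eq_real_of_nat add.commute)
    also have "\<dots> = ennreal (s' powr p) * ?m"
      unfolding s'p using D0 by (simp add: ennreal_mult ac_simps)
    finally show "(\<integral>\<^sup>+z\<in>ball a r. epowr (ennreal (H z)) p \<partial>\<mu>) \<le> ennreal (s' powr p) * ?m" .
  qed
  have s'0: "0 \<le> s'" using c0 s by (simp add: s'_def)
  have wl: "\<exists>L. L-lipschitz_on UNIV w" using wlip by blast
  have "\<bar>w x - w y\<bar> \<le> C1 * s' * dist x y"
    by (rule P1[OF wl ugw s'0 cg[OF xyF(1)] cg[OF xyF(2)]])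
  then show "\<bar>u x - u y\<bar> \<le> C1 * ((2 * A / real N + 2) * (2 * D ^ 4 * (real N + 1)) powr (1 / p)) * s * dist x y"
    by (simp add: wxy s'_def c_def mult.assoc)
qed

lemma pointwise_bound_mono: "pointwise_bound q u g A \<Longrightarrow> A \<le> A' \<Longrightarrow> pointwise_bound q u g A'"
  unfolding pointwise_bound_def by (meson mult_right_mono order_trans zero_le_dist)

text \<open>Once \<open>N\<close> makes the coefficient of \<open>A\<close> at most 1/2, the step
  maps \<open>A\<close> to \<open>A / 2 + b\<close>, whose fixed point is \<open>2 * b\<close>. The
  resulting constant is independent of the Lipschitz constant of \<open>u\<close> and of both bounds
  for \<open>g\<close>.\<close>

lemma self_improvement_continuous:
  assumes p: "1 < p" and PI: "weak_poincare \<mu> p"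
  obtains A q0 where "0 < A" "1 \<le> q0" "q0 < p"
    "\<And>q u g \<kappa> K L. q0 < q \<Longrightarrow> q < p \<Longrightarrow> L-lipschitz_on UNIV u \<Longrightarrow>
       upper_gradient_on UNIV u (\<lambda>z. ennreal (g z)) \<Longrightarrow> continuous_on UNIV g \<Longrightarrow> 0 < \<kappa> \<Longrightarrow>
       (\<And>z. \<kappa> \<le> g z) \<Longrightarrow> (\<And>z. g z \<le> K) \<Longrightarrow> pointwise_bound q u g A"
proof -
  obtain C1 where C1: "0 < C1"
    and P1: "\<And>u g s x y. \<exists>L. L-lipschitz_on UNIV u \<Longrightarrow> upper_gradient_on UNIV u g \<Longrightarrow> 0 \<le> s \<Longrightarrow>
       cgood (\<lambda>y. epowr (g y) p) (ennreal (s powr p)) x \<Longrightarrow>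
       cgood (\<lambda>y. epowr (g y) p) (ennreal (s powr p)) y \<Longrightarrow> \<bar>u x - u y\<bar> \<le> C1 * s * dist x y"
    using pointwise_estimate[OF p PI] by blast
  have D0: "0 < D" using D_ge_1 by simp
  \<comment> \<open>With \<open>N + 1 \<le> 2 * N\<close>, the coefficient of \<open>A\<close> is at
    most \<open>B * real N powr (1 / p - 1)\<close>; since \<open>p > 1\<close> this tends to
    0.\<close>
  define B where "B = C1 * 2 * (4 * D ^ 4) powr (1 / p)"
  have B0: "0 < B" using C1 D0 by (simp add: B_def)
  have "(\<lambda>n. real n powr (1 / p - 1)) \<longlonglongrightarrow> 0"
    by (rule tendsto_neg_powr[OF _ filterlim_real_sequentially]) (use p in simp)
  then have "\<forall>\<^sub>F n in sequentially. real n powr (1 / p - 1) < 1 / (2 * B)"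
    by (rule order_tendstoD) (use B0 in simp)
  then have "\<forall>\<^sub>F n in sequentially. real n powr (1 / p - 1) < 1 / (2 * B) \<and> 1 \<le> n"
    by (intro eventually_conj eventually_ge_at_top)
  then obtain N :: nat where N: "real N powr (1 / p - 1) < 1 / (2 * B)" "1 \<le> N"
    using eventually_happens by (metis (no_types, lifting) sequentially_bot)
  define M where "M = (2 * D ^ 4 * (real N + 1)) powr (1 / p)"
  have M0: "0 < M" using D0 by (simp add: M_def)
  have a: "C1 * (2 / real N) * M \<le> 1 / 2"
  proof -
    have "M \<le> (4 * D ^ 4 * real N) powr (1 / p)"
      unfolding M_def using N(2) D0 p by (intro powr_mono2) auto
    also have "\<dots> = (4 * D ^ 4) powr (1 / p) * real N powr (1 / p)" using D0 by (simp add: powr_mult)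
    finally have "C1 * (2 / real N) * M \<le> C1 * (2 / real N) * ((4 * D ^ 4) powr (1 / p) * real N powr (1 / p))"
      using C1 by (intro mult_left_mono) auto
    also have "\<dots> = B * (real N powr (1 / p) / real N)" by (simp add: B_def)
    also have "real N powr (1 / p) / real N = real N powr (1 / p - 1)" using N(2) by (simp add: powr_diff)
    also have "B * real N powr (1 / p - 1) \<le> B * (1 / (2 * B))" using N(1) B0 by (intro mult_left_mono) auto
    finally show ?thesis using B0 by simp
  qed
  define b where "b = 2 * C1 * M"
  have b0: "0 < b" using C1 M0 by (simp add: b_def)
  show ?thesis
  \<comment> \<open>The lower end of the range of \<open>q\<close> is exactly what
    \<open>N (p - q) \<le> 1\<close> demands, raised to 1 if necessary.\<close>
  proof (rule that[of "2 * b" "max 1 (p - 1 / real N)"])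
    show "0 < 2 * b" "1 \<le> max 1 (p - 1 / real N)" "max 1 (p - 1 / real N) < p" using b0 p N(2) by auto
    fix q and u g :: "'a \<Rightarrow> real" and \<kappa> K L :: real
    assume q: "max 1 (p - 1 / real N) < q" "q < p" and u: "L-lipschitz_on UNIV u"
      and ug: "upper_gradient_on UNIV u (\<lambda>z. ennreal (g z))" and gc: "continuous_on UNIV g"
      and \<kappa>: "0 < \<kappa>" "\<And>z. \<kappa> \<le> g z" and K: "\<And>z. g z \<le> K"
    have g0: "0 < g z" for z using \<kappa>(1) \<kappa>(2)[of z] by simp
    have L0: "0 \<le> L" by (rule lipschitz_on_nonneg[OF u])
    have q0: "0 < q" "real N * (p - q) \<le> 1" using q N(2) by (auto simp: field_simps)
    have step: "pointwise_bound q u g (A / 2 + b)" if A: "0 \<le> A" "pointwise_bound q u g A" for A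
    proof (rule pointwise_bound_mono)
      show "pointwise_bound q u g (C1 * ((2 * A / real N + 2) * (2 * D ^ 4 * (real N + 1)) powr (1 / p)))"
        using self_improvement_step[OF C1 P1 p q0(1) q(2) _ q0(2) ug gc g0 K A] N(2) by simp
      have "C1 * ((2 * A / real N + 2) * M) = A * (C1 * (2 / real N) * M) + b"
        by (simp add: b_def algebra_simps)
      also have "\<dots> \<le> A * (1 / 2) + b" using a A(1) by (intro add_right_mono mult_left_mono) auto
      finally show "C1 * ((2 * A / real N + 2) * (2 * D ^ 4 * (real N + 1)) powr (1 / p)) \<le> A / 2 + b"
        by (simp add: M_def)
    qed
    \<comment> \<open>A good point satisfies \<open>\<kappa> \<le> g x \<le> s\<close>, so the
      Lipschitz bound for \<open>u\<close> may be multiplied by \<open>s / \<kappa>\<close>.\<close>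
    have apriori: "pointwise_bound q u g (L / \<kappa>)"
      unfolding pointwise_bound_def
    proof (intro allI impI)
      fix x y s
      assume s: "0 \<le> s" and gx: "good (\<lambda>z. ennreal (g z powr q)) (ennreal (s powr q)) x"
      have "g x \<le> s" by (rule good_continuous[OF gc less_imp_le[OF g0] q0(1) s gx])
      then have "1 \<le> s / \<kappa>" using \<kappa>(1) \<kappa>(2)[of x] by (simp add: field_simps)
      have "\<bar>u x - u y\<bar> \<le> L * dist x y * 1" using lipschitz_onD[OF u, of x y] by (simp add: dist_real_def)
      also have "\<dots> \<le> L * dist x y * (s / \<kappa>)" using L0 \<open>1 \<le> s / \<kappa>\<close> by (intro mult_left_mono) auto
      finally show "\<bar>u x - u y\<bar> \<le> L / \<kappa> * s * dist x y" by (simp add: ac_simps)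
    qed
    have iter: "pointwise_bound q u g (L / \<kappa> / 2 ^ n + 2 * b)" for n
    proof (induction n)
      case 0
      show ?case by (rule pointwise_bound_mono[OF apriori]) (use b0 in simp)
    next
      case (Suc n)
      have "pointwise_bound q u g ((L / \<kappa> / 2 ^ n + 2 * b) / 2 + b)"
        by (rule step[OF _ Suc]) (use L0 \<kappa>(1) b0 in \<open>auto intro!: add_nonneg_nonneg divide_nonneg_nonneg\<close>)
      moreover have "(L / \<kappa> / 2 ^ n + 2 * b) / 2 + b = L / \<kappa> / 2 ^ Suc n + 2 * b"
        using \<kappa>(1) by (simp add: field_simps)
      ultimately show ?case by (simp only:)
    qed
    show "pointwise_bound q u g (2 * b)"
      unfolding pointwise_bound_def
    proof (intro allI impI)
      fix x y s
      assume as: "0 \<le> s" "good (\<lambda>z. ennreal (g z powr q)) (ennreal (s powr q)) x"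
        "good (\<lambda>z. ennreal (g z powr q)) (ennreal (s powr q)) y"
      have "(\<lambda>n. (L / \<kappa> * (1 / 2) ^ n + 2 * b) * s * dist x y) \<longlonglongrightarrow> (L / \<kappa> * 0 + 2 * b) * s * dist x y"
        by (intro tendsto_intros LIMSEQ_power_zero) auto
      moreover have "\<bar>u x - u y\<bar> \<le> (L / \<kappa> * (1 / 2) ^ n + 2 * b) * s * dist x y" for n
        using pointwise_boundD[OF iter as, of n] by (simp add: power_divide)
      ultimately show "\<bar>u x - u y\<bar> \<le> 2 * b * s * dist x y" by (intro LIMSEQ_le_const) auto
    qed
  qed
qed

end

section \<open>Arc-length reparametrisation\<close>

lemma curve_length_add_le:
  assumes "a \<le> b" "b \<le> c"
  shows "curve_length \<gamma> a c \<le> curve_length \<gamma> a b + curve_length \<gamma> b c"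
proof (rule curve_length_le)
  fix n s assume s: "s 0 = a" "s n = c" "\<forall>i<n. s i \<le> s (Suc i)"
  let ?p = "\<lambda>i. min (s i) b" and ?q = "\<lambda>i. max (s i) b"
  have "dist (\<gamma> (s i)) (\<gamma> (s (Suc i))) \<le> dist (\<gamma> (?p i)) (\<gamma> (?p (Suc i))) + dist (\<gamma> (?q i)) (\<gamma> (?q (Suc i)))"
    if "i < n" for i
  proof -
    have "s i \<le> s (Suc i)" using s that by auto
    then consider "s (Suc i) \<le> b" | "b \<le> s i" | "s i < b" "b < s (Suc i)" by linarith
    then show ?thesis
      by cases (use \<open>s i \<le> s (Suc i)\<close> in \<open>auto simp: min_def max_def intro: dist_triangle\<close>)
  qed
  then have "(\<Sum>i<n. dist (\<gamma> (s i)) (\<gamma> (s (Suc i)))) \<le>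
      (\<Sum>i<n. dist (\<gamma> (?p i)) (\<gamma> (?p (Suc i)))) + (\<Sum>i<n. dist (\<gamma> (?q i)) (\<gamma> (?q (Suc i))))"
    by (subst sum.distrib[symmetric]) (auto intro: sum_mono)
  then have "ennreal (\<Sum>i<n. dist (\<gamma> (s i)) (\<gamma> (s (Suc i)))) \<le>
      ennreal ((\<Sum>i<n. dist (\<gamma> (?p i)) (\<gamma> (?p (Suc i)))) + (\<Sum>i<n. dist (\<gamma> (?q i)) (\<gamma> (?q (Suc i)))))"
    by (rule ennreal_leI)
  also have "\<dots> = ennreal (\<Sum>i<n. dist (\<gamma> (?p i)) (\<gamma> (?p (Suc i)))) + ennreal (\<Sum>i<n. dist (\<gamma> (?q i)) (\<gamma> (?q (Suc i))))"
    by (intro ennreal_plus sum_nonneg) auto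
  also have "\<dots> \<le> curve_length \<gamma> a b + curve_length \<gamma> b c"
    by (intro add_mono curve_length_ge_sum) (use s assms in \<open>auto simp: min_def max_def\<close>)
  finally show "ennreal (\<Sum>i<n. dist (\<gamma> (s i)) (\<gamma> (s (Suc i)))) \<le> curve_length \<gamma> a b + curve_length \<gamma> b c" .
qed

lemma curve_length_add_ge:
  assumes "a \<le> b" "b \<le> c"
  shows "curve_length \<gamma> a b + curve_length \<gamma> b c \<le> curve_length \<gamma> a c"
proof -
  let ?P = "\<lambda>a b. {(n::nat, s::nat \<Rightarrow> real). s 0 = a \<and> s n = b \<and> (\<forall>i<n. s i \<le> s (Suc i))}"
  let ?f = "\<lambda>(n::nat, s::nat \<Rightarrow> real). ennreal (\<Sum>i<n. dist (\<gamma> (s i)) (\<gamma> (s (Suc i))))"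
  have concat: "?f P + ?f Q \<le> curve_length \<gamma> a c" if PQ: "P \<in> ?P a b" "Q \<in> ?P b c" for P Q
  proof -
    obtain n s where P: "P = (n, s)" "s 0 = a" "s n = b" "\<forall>i<n. s i \<le> s (Suc i)" using PQ(1) by blast
    obtain m t where Q: "Q = (m, t)" "t 0 = b" "t m = c" "\<forall>i<m. t i \<le> t (Suc i)" using PQ(2) by blast
    define w where "w i = (if i \<le> n then s i else t (i - n))" for i
    have w2: "w (n + i) = t i" for i using P Q by (auto simp: w_def)
    have split: "(\<Sum>i<n + m. dist (\<gamma> (w i)) (\<gamma> (w (Suc i))))
      = (\<Sum>i<n. dist (\<gamma> (w i)) (\<gamma> (w (Suc i)))) + (\<Sum>i<m. dist (\<gamma> (w (n + i))) (\<gamma> (w (n + Suc i))))"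
      by (induction m) auto
    have "?f P + ?f Q = ennreal ((\<Sum>i<n. dist (\<gamma> (s i)) (\<gamma> (s (Suc i)))) + (\<Sum>i<m. dist (\<gamma> (t i)) (\<gamma> (t (Suc i)))))"
      by (simp add: P Q sum_nonneg)
    also have "\<dots> = ennreal (\<Sum>i<n + m. dist (\<gamma> (w i)) (\<gamma> (w (Suc i))))"
      unfolding split w2 by (simp add: w_def)
    also have "\<dots> \<le> curve_length \<gamma> a c"
    proof (rule curve_length_ge_sum)
      show "w 0 = a" "w (n + m) = c" using P Q w2 by (auto simp: w_def)
      fix i assume i: "i < n + m"
      show "w i \<le> w (Suc i)"
      proof (cases "i < n")
        case True
        then show ?thesis using P by (auto simp: w_def)
      next
        case False
        then have "w i = t (i - n)" "w (Suc i) = t (Suc (i - n))" using w2[of "i - n"] w2[of "Suc (i - n)"] by auto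
        then show ?thesis using Q i False by auto
      qed
    qed
    finally show ?thesis .
  qed
  have ne: "?P u v \<noteq> {}" if "u \<le> v" for u v :: real
  proof -
    have "(1::nat, \<lambda>i::nat. if i = 0 then u else v) \<in> ?P u v" using that by auto
    then show ?thesis by blast
  qed
  have "curve_length \<gamma> a b + curve_length \<gamma> b c = (SUP P\<in>?P a b. ?f P + curve_length \<gamma> b c)"
    unfolding curve_length_def[of \<gamma> a b] by (rule ennreal_SUP_add_left[symmetric, OF ne[OF assms(1)]])
  also have "\<dots> \<le> curve_length \<gamma> a c"
  proof (rule SUP_least)
    fix P assume P: "P \<in> ?P a b"
    have "?f P + curve_length \<gamma> b c = (SUP Q\<in>?P b c. ?f P + ?f Q)"
      unfolding curve_length_def[of \<gamma> b c] using ennreal_SUP_add_left[OF ne[OF assms(2)], of ?f "?f P"]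
      by (simp add: add.commute)
    also have "\<dots> \<le> curve_length \<gamma> a c" by (rule SUP_least) (rule concat[OF P])
    finally show "?f P + curve_length \<gamma> b c \<le> curve_length \<gamma> a c" .
  qed
  finally show ?thesis .
qed

text \<open>Limits of chains are merely 1-Lipschitz curves, whereas upper gradients are tested on
  arc-length curves. The length function \<open>L\<close> provides the change of parameter; it is
  nondecreasing and 1-Lipschitz.\<close>

lemma arclength_reparametrisation:
  fixes \<gamma> :: "real \<Rightarrow> 'a::metric_space"
  assumes l: "0 \<le> l" and lip: "\<And>s t. 0 \<le> s \<Longrightarrow> s \<le> t \<Longrightarrow> t \<le> l \<Longrightarrow> dist (\<gamma> s) (\<gamma> t) \<le> t - s"
  obtains \<gamma>' L where "arclength_curve \<gamma>' (L l)" "L 0 = (0::real)"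
    "\<And>s. s \<in> {0..l} \<Longrightarrow> \<gamma>' (L s) = \<gamma> s"
    "\<And>s t. 0 \<le> s \<Longrightarrow> s \<le> t \<Longrightarrow> t \<le> l \<Longrightarrow> L s \<le> L t \<and> L t - L s \<le> t - s"
proof -
  have len_le: "curve_length \<gamma> a b \<le> ennreal (b - a)" if "0 \<le> a" "a \<le> b" "b \<le> l" for a b
  proof (rule curve_length_le, rule ennreal_leI)
    fix n s assume s: "s 0 = a" "s n = b" "\<forall>i<n. s i \<le> s (Suc i)"
    have "(\<Sum>i<n. dist (\<gamma> (s i)) (\<gamma> (s (Suc i)))) \<le> (\<Sum>i<n. s (Suc i) - s i)"
    proof (rule sum_mono)
      fix i assume "i \<in> {..<n}"
      then show "dist (\<gamma> (s i)) (\<gamma> (s (Suc i))) \<le> s (Suc i) - s i"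
        using s that partition_mono[OF s(3), of 0 i] partition_mono[OF s(3), of "Suc i" n] by (intro lip) auto
    qed
    also have "\<dots> = b - a" by (simp add: sum_lessThan_telescope s)
    finally show "(\<Sum>i<n. dist (\<gamma> (s i)) (\<gamma> (s (Suc i)))) \<le> b - a" .
  qed
  define L where "L t = enn2real (curve_length \<gamma> 0 t)" for t
  have Lenn: "ennreal (L t) = curve_length \<gamma> 0 t" if "0 \<le> t" "t \<le> l" for t
  proof -
    have "curve_length \<gamma> 0 t \<le> ennreal (t - 0)" by (rule len_le) (use that in auto)
    also have "\<dots> < top" by simp
    finally show ?thesis unfolding L_def by (rule ennreal_enn2real)
  qed
  have Lnn: "0 \<le> L t" for t by (simp add: L_def)
  have Ldiff: "curve_length \<gamma> s t = ennreal (L t - L s)" "L s \<le> L t" if st: "0 \<le> s" "s \<le> t" "t \<le> l" for s t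
  proof -
    have "curve_length \<gamma> 0 t = curve_length \<gamma> 0 s + curve_length \<gamma> s t"
      by (rule antisym[OF curve_length_add_le curve_length_add_ge]) (use st in auto)
    then have eq: "ennreal (L t) = ennreal (L s) + curve_length \<gamma> s t" using Lenn st by auto
    then have "ennreal (L s) \<le> ennreal (L t)" by simp
    then show "L s \<le> L t" by (simp add: Lnn)
    have "curve_length \<gamma> s t = ennreal (L t) - ennreal (L s)" unfolding eq by simp
    then show "curve_length \<gamma> s t = ennreal (L t - L s)" by (simp add: ennreal_minus Lnn)
  qed
  have L1: "L t - L s \<le> t - s" if st: "0 \<le> s" "s \<le> t" "t \<le> l" for s t
  proof -
    have "ennreal (L t - L s) \<le> ennreal (t - s)" using len_le[OF st] unfolding Ldiff(1)[OF st] .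
    then show ?thesis by (subst (asm) ennreal_le_iff) (use st in auto)
  qed
  have L0: "L 0 = 0"
  proof -
    have "curve_length \<gamma> 0 0 \<le> ennreal (0 - 0)" by (rule len_le) (use l in auto)
    then show ?thesis by (simp add: L_def)
  qed
  have dL: "dist (\<gamma> s) (\<gamma> t) \<le> L t - L s" if st: "0 \<le> s" "s \<le> t" "t \<le> l" for s t
  proof -
    have "ennreal (dist (\<gamma> s) (\<gamma> t)) \<le> ennreal (L t - L s)"
      using curve_length_ge_dist[OF st(2), of \<gamma>] unfolding Ldiff(1)[OF st] .
    then show ?thesis by (subst (asm) ennreal_le_iff) (use Ldiff(2)[OF st] in auto)
  qed
  have Lcont: "continuous_on {0..l} L"
  proof (rule lipschitz_on_continuous_on)
    show "1-lipschitz_on {0..l} L"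
    proof (rule lipschitz_onI)
      fix s t assume "s \<in> {0..l}" "t \<in> {0..l}"
      then show "dist (L s) (L t) \<le> 1 * dist s t"
        using L1[of s t] L1[of t s] Ldiff(2)[of s t] Ldiff(2)[of t s] by (cases "s \<le> t") (auto simp: dist_real_def)
    qed simp
  qed
  have surj: "\<exists>t\<in>{0..l}. L t = s" if "0 \<le> s" "s \<le> L l" for s
    using IVT'[of L 0 s l] that l Lcont L0 by force
  \<comment> \<open>\<open>L\<close> may have plateaus, so an inverse is chosen. On a plateau
    \<open>\<gamma>\<close> is constant by \<open>dL\<close>, hence the value does not depend on the
    choice.\<close>
  define \<gamma>' where "\<gamma>' s = \<gamma> (SOME t. t \<in> {0..l} \<and> L t = s)" for s
  have \<gamma>'L: "\<gamma>' (L t) = \<gamma> t" if t: "t \<in> {0..l}" for t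
  proof -
    let ?t = "SOME t'. t' \<in> {0..l} \<and> L t' = L t"
    have "?t \<in> {0..l} \<and> L ?t = L t" by (rule someI[of _ t]) (use t in simp)
    then obtain t' where t': "t' = ?t" "t' \<in> {0..l}" "L t' = L t" by blast
    have "dist (\<gamma> t') (\<gamma> t) \<le> 0"
    proof (cases "t' \<le> t")
      case True
      then show ?thesis using dL[of t' t] t t' by simp
    next
      case False
      then show ?thesis using dL[of t t'] t t' by (simp add: dist_commute)
    qed
    then show ?thesis unfolding \<gamma>'_def t'(1)[symmetric] by simp
  qed
  have "curve_length \<gamma>' u v = ennreal (v - u)" if uv: "0 \<le> u" "u \<le> v" "v \<le> L l" for u v
  proof (rule antisym)
    have d': "dist (\<gamma>' u) (\<gamma>' v) \<le> v - u" if uv: "0 \<le> u" "u \<le> v" "v \<le> L l" for u v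
    proof -
      obtain a where a: "a \<in> {0..l}" "L a = u" using surj[of u] uv by auto
      obtain b where b: "b \<in> {0..l}" "L b = v" using surj[of v] uv by auto
      show ?thesis
      proof (cases "a \<le> b")
        case True
        then show ?thesis using dL[of a b] \<gamma>'L[OF a(1)] \<gamma>'L[OF b(1)] a b by auto
      next
        case False
        then have "L b \<le> L a" using Ldiff(2)[of b a] a b by auto
        then have "u = v" using a b uv by simp
        then show ?thesis by simp
      qed
    qed
    show "curve_length \<gamma>' u v \<le> ennreal (v - u)"
    proof (rule curve_length_le, rule ennreal_leI)
      fix n s assume s: "s 0 = u" "s n = v" "\<forall>i<n. s i \<le> s (Suc i)"
      have "(\<Sum>i<n. dist (\<gamma>' (s i)) (\<gamma>' (s (Suc i)))) \<le> (\<Sum>i<n. s (Suc i) - s i)"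
      proof (rule sum_mono)
        fix i assume "i \<in> {..<n}"
        then show "dist (\<gamma>' (s i)) (\<gamma>' (s (Suc i))) \<le> s (Suc i) - s i"
          using s uv partition_mono[OF s(3), of 0 i] partition_mono[OF s(3), of "Suc i" n] by (intro d') auto
      qed
      also have "\<dots> = v - u" by (simp add: sum_lessThan_telescope s)
      finally show "(\<Sum>i<n. dist (\<gamma>' (s i)) (\<gamma>' (s (Suc i)))) \<le> v - u" .
    qed
    obtain a where a: "a \<in> {0..l}" "L a = u" using surj[of u] uv by auto
    obtain b where b: "b \<in> {0..l}" "L b = v" using surj[of v] uv by auto
    show "ennreal (v - u) \<le> curve_length \<gamma>' u v"
    proof (cases "a \<le> b")
      case True
      have "ennreal (v - u) = curve_length \<gamma> a b" using Ldiff(1)[of a b] a b True by simp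
      also have "\<dots> \<le> curve_length \<gamma>' u v"
      proof (rule curve_length_le)
        fix n s assume s: "s 0 = a" "s n = b" "\<forall>i<n. s i \<le> s (Suc i)"
        have in01: "s i \<in> {0..l}" if "i \<le> n" for i
          using partition_mono[OF s(3), of 0 i] partition_mono[OF s(3), of i n] that s a b by auto
        have "(\<Sum>i<n. dist (\<gamma> (s i)) (\<gamma> (s (Suc i)))) = (\<Sum>i<n. dist (\<gamma>' (L (s i))) (\<gamma>' (L (s (Suc i)))))"
          using in01 by (intro sum.cong) (auto simp: \<gamma>'L)
        also have "ennreal \<dots> \<le> curve_length \<gamma>' u v"
        proof (rule curve_length_ge_sum)
          fix i assume "i < n"
          then show "L (s i) \<le> L (s (Suc i))" using in01[of i] in01[of "Suc i"] s(3) by (intro Ldiff(2)) auto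
        qed (use s a b in auto)
        finally show "ennreal (\<Sum>i<n. dist (\<gamma> (s i)) (\<gamma> (s (Suc i)))) \<le> curve_length \<gamma>' u v" .
      qed
      finally show ?thesis .
    next
      case False
      then have "L b \<le> L a" using Ldiff(2)[of b a] a b by auto
      then have "u = v" using a b uv by simp
      then show ?thesis by simp
    qed
  qed
  then have arc: "arclength_curve \<gamma>' (L l)" by (auto simp: arclength_curve_def Lnn)
  show ?thesis by (rule that[OF arc L0 \<gamma>'L]) (use Ldiff(2) L1 in auto)
qed

lemma nn_integral_continuous_Icc:
  fixes h :: "real \<Rightarrow> real"
  assumes h: "continuous_on UNIV h" "\<And>x. 0 \<le> h x"
  shows "(\<integral>\<^sup>+s\<in>{a..b}. ennreal (h s) \<partial>lborel) = ennreal (integral {a..b} h)"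
proof -
  have [measurable]: "h \<in> borel_measurable borel" by (rule borel_measurable_continuous_onI[OF h(1)])
  have "(h has_integral integral {a..b} h) {a..b}"
    by (intro integrable_integral integrable_continuous_real continuous_on_subset[OF h(1)]) simp
  then have "((\<lambda>s. if s \<in> {a..b} then h s else 0) has_integral integral {a..b} h) UNIV"
    by (simp only: has_integral_restrict_UNIV)
  then have "(\<integral>\<^sup>+s. ennreal (if s \<in> {a..b} then h s else 0) \<partial>lborel) = ennreal (integral {a..b} h)"
    by (intro nn_integral_has_integral_lborel) (auto simp: h)
  moreover have "(\<integral>\<^sup>+s\<in>{a..b}. ennreal (h s) \<partial>lborel) = (\<integral>\<^sup>+s. ennreal (if s \<in> {a..b} then h s else 0) \<partial>lborel)"
    by (rule nn_integral_cong) (auto simp: indicator_def)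
  ultimately show ?thesis by simp
qed

text \<open>A change of variables with speed at most 1. Instead of differentiating \<open>L\<close>
  almost everywhere, the two integrals are compared on short intervals by uniform continuity of
  \<open>h\<close>.\<close>

lemma integral_reparametrisation_le:
  fixes h :: "real \<Rightarrow> real" and L :: "real \<Rightarrow> real"
  assumes h: "continuous_on UNIV h" "\<And>x. 0 \<le> h x" and l: "0 \<le> l" and L0: "L 0 = 0"
    and L: "\<And>s t. 0 \<le> s \<Longrightarrow> s \<le> t \<Longrightarrow> t \<le> l \<Longrightarrow> L s \<le> L t \<and> L t - L s \<le> t - s"
  shows "(\<integral>\<^sup>+s\<in>{0..L l}. ennreal (h s) \<partial>lborel)
      \<le> (\<integral>\<^sup>+s\<in>{0..l}. ennreal (h (L s)) \<partial>lborel)"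
proof -
  have Lc: "continuous_on UNIV (\<lambda>s. L (clamp_to l s))"
  proof (rule lipschitz_on_continuous_on)
    show "1-lipschitz_on UNIV (\<lambda>s. L (clamp_to l s))"
    proof (rule lipschitz_onI)
      fix s t
      have *: "\<bar>L u - L v\<bar> \<le> \<bar>u - v\<bar>" if "u \<in> {0..l}" "v \<in> {0..l}" for u v
        using L[of u v] L[of v u] that by (cases "u \<le> v") auto
      have "\<bar>L (clamp_to l s) - L (clamp_to l t)\<bar> \<le> \<bar>clamp_to l s - clamp_to l t\<bar>"
        by (intro * clamp_to_in l)
      also have "\<dots> \<le> \<bar>s - t\<bar>" by (auto simp: clamp_to_def)
      finally show "dist (L (clamp_to l s)) (L (clamp_to l t)) \<le> 1 * dist s t" by (simp add: dist_real_def)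
    qed simp
  qed
  have [measurable]: "h \<in> borel_measurable borel" by (rule borel_measurable_continuous_onI[OF h(1)])
  have [measurable]: "(\<lambda>s. L (clamp_to l s)) \<in> borel_measurable borel" by (rule borel_measurable_continuous_onI[OF Lc])
  have Lin: "0 \<le> L t" "L t \<le> L l" if "t \<in> {0..l}" for t using L[of 0 t] L[of t l] that L0 by auto
  have main: "(\<integral>\<^sup>+s\<in>{0..L l}. ennreal (h s) \<partial>lborel)
      \<le> (\<integral>\<^sup>+s\<in>{0..l}. ennreal (h (L s)) \<partial>lborel) + ennreal (2 * \<epsilon> * l)" if \<epsilon>: "0 < \<epsilon>" for \<epsilon>
  proof -
    have "uniformly_continuous_on {0..L l} h"
      by (intro compact_uniformly_continuous continuous_on_subset[OF h(1)]) auto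
    then obtain \<delta> where \<delta>: "0 < \<delta>" "\<And>s t. s \<in> {0..L l} \<Longrightarrow> t \<in> {0..L l} \<Longrightarrow> dist t s < \<delta> \<Longrightarrow> dist (h t) (h s) < \<epsilon>"
      using \<epsilon> unfolding uniformly_continuous_on_def by metis
    define \<phi> where "\<phi> t = integral {0..L t} h" for t
    \<comment> \<open>One \<open>\<epsilon>\<close> replaces \<open>h\<close> on
      \<open>[L a, L b]\<close> by \<open>h (L a)\<close>, the other passes from
      \<open>h (L a)\<close> to \<open>h (L s)\<close>.\<close>
    define H where "H s = ennreal (h (L (clamp_to l s)) + 2 * \<epsilon>)" for s
    have Hm: "H \<in> borel_measurable borel" unfolding H_def by measurable
    have "ennreal \<bar>\<phi> 0 - \<phi> l\<bar> \<le> (\<integral>\<^sup>+s\<in>{0..l}. H s \<partial>lborel)"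
    proof (rule local_to_global[OF Hm l, of "\<delta> / 2"])
      fix a b assume ab: "0 \<le> a" "a \<le> b" "b \<le> l" "b - a \<le> \<delta> / 2"
      have Lab: "L a \<le> L b" "L b - L a \<le> b - a" using L[of a b] ab by auto
      have Li: "0 \<le> L a" "L b \<le> L l" using Lin[of a] Lin[of b] ab by auto
      have int: "h integrable_on {c..d}" for c d
        by (intro integrable_continuous_real continuous_on_subset[OF h(1)]) simp
      have "\<phi> b = \<phi> a + integral {L a..L b} h"
        unfolding \<phi>_def using Henstock_Kurzweil_Integration.integral_combine[of 0 "L a" "L b" h] Lab Li int by simp
      then have "\<bar>\<phi> a - \<phi> b\<bar> = integral {L a..L b} h" using integral_nonneg[OF int, of "L a" "L b"] h(2) by simp
      also have "\<dots> \<le> integral {L a..L b} (\<lambda>_. h (L a) + \<epsilon>)"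
      proof (rule integral_le[OF int])
        fix s assume s: "s \<in> {L a..L b}"
        then have "dist s (L a) < \<delta>" using Lab ab \<delta>(1) by (auto simp: dist_real_def)
        then have "dist (h s) (h (L a)) < \<epsilon>" using s Li Lab by (intro \<delta>(2)) auto
        then show "h s \<le> h (L a) + \<epsilon>" by (auto simp: dist_real_def)
      qed (intro integrable_const_ivl)
      also have "\<dots> = (h (L a) + \<epsilon>) * (L b - L a)" using Lab by simp
      also have "\<dots> \<le> (h (L a) + \<epsilon>) * (b - a)" using Lab h(2)[of "L a"] \<epsilon> by (intro mult_left_mono) auto
      finally have "ennreal \<bar>\<phi> a - \<phi> b\<bar> \<le> ennreal ((h (L a) + \<epsilon>) * (b - a))" by (rule ennreal_leI)
      also have "\<dots> = (\<integral>\<^sup>+s\<in>{a..b}. ennreal (h (L a) + \<epsilon>) \<partial>lborel)"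
        using ab h(2)[of "L a"] \<epsilon> by (simp add: nn_integral_cmult_indicator ennreal_mult)
      also have "\<dots> \<le> (\<integral>\<^sup>+s\<in>{a..b}. H s \<partial>lborel)"
      proof (rule nn_integral_mono)
        fix s
        show "ennreal (h (L a) + \<epsilon>) * indicator {a..b} s \<le> H s * indicator {a..b} s"
        proof (cases "s \<in> {a..b}")
          case True
          have "\<bar>L s - L a\<bar> < \<delta>" using L[of a s] True ab \<delta>(1) by auto
          moreover have "L s \<in> {0..L l}" "L a \<in> {0..L l}" using Lin True ab by auto
          ultimately have "dist (h (L a)) (h (L s)) < \<epsilon>" by (intro \<delta>(2)) (auto simp: dist_real_def abs_minus_commute)
          then have "h (L a) + \<epsilon> \<le> h (L s) + 2 * \<epsilon>" by (auto simp: dist_real_def)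
          then show ?thesis using True ab by (auto simp: H_def clamp_to_id intro: ennreal_leI)
        qed simp
      qed
      finally show "ennreal \<bar>\<phi> a - \<phi> b\<bar> \<le> (\<integral>\<^sup>+s\<in>{a..b}. H s \<partial>lborel)" .
    qed (use \<delta> in simp)
    also have "\<dots> = (\<integral>\<^sup>+s. ennreal (h (L (clamp_to l s))) * indicator {0..l} s + ennreal (2 * \<epsilon>) * indicator {0..l} s \<partial>lborel)"
      by (rule nn_integral_cong) (use \<epsilon> h(2) in \<open>auto simp: H_def indicator_def\<close>)
    also have "\<dots> = (\<integral>\<^sup>+s\<in>{0..l}. ennreal (h (L (clamp_to l s))) \<partial>lborel) + ennreal (2 * \<epsilon> * l)"
      using \<epsilon> l by (subst nn_integral_add) (auto simp: nn_integral_cmult_indicator ennreal_mult)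
    also have "(\<integral>\<^sup>+s\<in>{0..l}. ennreal (h (L (clamp_to l s))) \<partial>lborel)
        = (\<integral>\<^sup>+s\<in>{0..l}. ennreal (h (L s)) \<partial>lborel)"
      by (rule nn_integral_cong) (auto simp: indicator_def clamp_to_id)
    also have "\<bar>\<phi> 0 - \<phi> l\<bar> = integral {0..L l} h"
    proof -
      have "0 \<le> integral {0..L l} h" by (rule integral_nonneg) (use h in \<open>auto intro!: integrable_continuous_real continuous_on_subset[OF h(1)]\<close>)
      then show ?thesis by (simp add: \<phi>_def L0)
    qed
    finally show ?thesis by (simp add: nn_integral_continuous_Icc[OF h])
  qed
  show ?thesis
  proof (rule ennreal_le_epsilon)
    fix e :: real assume e: "0 < e"
    show "(\<integral>\<^sup>+s\<in>{0..L l}. ennreal (h s) \<partial>lborel)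
      \<le> (\<integral>\<^sup>+s\<in>{0..l}. ennreal (h (L s)) \<partial>lborel) + ennreal e"
    proof (rule order_trans[OF main[of "e / (2 * l + 2)"]])
      have "2 * (e / (2 * l + 2)) * l \<le> e" using e l by (simp add: field_simps)
      then show "(\<integral>\<^sup>+s\<in>{0..l}. ennreal (h (L s)) \<partial>lborel) + ennreal (2 * (e / (2 * l + 2)) * l)
        \<le> (\<integral>\<^sup>+s\<in>{0..l}. ennreal (h (L s)) \<partial>lborel) + ennreal e"
        by (intro add_left_mono ennreal_leI)
    qed (use e l in simp)
  qed
qed

section \<open>Discrete chains and the passage to lower semicontinuous upper gradients\<close>

text \<open>Riemann sums of \<open>g\<close> along finite sequences of points with jumps at most
  \<open>\<delta>\<close>, weighted at the left end of each jump. No curve has to exist between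
  consecutive points. The trivial chain \<open>m = 0\<close> gives cost 0 from \<open>x\<close> to
  itself.\<close>

definition chain_costs :: "('a::metric_space \<Rightarrow> real) \<Rightarrow> real \<Rightarrow> 'a \<Rightarrow> 'a \<Rightarrow> real set" where
  "chain_costs g \<delta> x y = {a. \<exists>m W. W 0 = x \<and> W m = y \<and> (\<forall>i<m. dist (W i) (W (Suc i)) \<le> \<delta>) \<and>
     a = (\<Sum>i<m. g (W i) * dist (W i) (W (Suc i)))}"

lemma chain_costs_step:
  assumes a: "a \<in> chain_costs g \<delta> x y" and d: "dist y z \<le> \<delta>"
  shows "a + g y * dist y z \<in> chain_costs g \<delta> x z"
proof -
  obtain m W where W: "W 0 = x" "W m = y" "\<forall>i<m. dist (W i) (W (Suc i)) \<le> \<delta>"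
    "a = (\<Sum>i<m. g (W i) * dist (W i) (W (Suc i)))" using a by (auto simp: chain_costs_def)
  define W' where "W' = W(Suc m := z)"
  have "(\<Sum>i<m. g (W' i) * dist (W' i) (W' (Suc i))) = a" using W(4) by (auto simp: W'_def intro: sum.cong)
  then have "a + g y * dist y z = (\<Sum>i<Suc m. g (W' i) * dist (W' i) (W' (Suc i)))"
    using W by (simp add: W'_def)
  moreover have "W' 0 = x" "W' (Suc m) = z" using W by (auto simp: W'_def)
  moreover have "\<forall>i<Suc m. dist (W' i) (W' (Suc i)) \<le> \<delta>"
    using W(2,3) d by (auto simp: W'_def less_Suc_eq)
  ultimately show ?thesis unfolding chain_costs_def by blast
qed

text \<open>The cheapest chain cost from \<open>x\<close>, truncated at \<open>h\<close>. Appending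
  one jump changes it by at most \<open>g\<close> times the length of the jump, and along a curve
  these increments add up to the line integral of \<open>g\<close>. A value below \<open>h\<close>
  can only come from an actual chain.\<close>

lemma chain_potential:
  fixes g :: "'a::metric_space \<Rightarrow> real"
  assumes g: "continuous_on UNIV g" "\<And>z. 0 \<le> g z" "\<And>z. g z \<le> K" and \<delta>: "0 < \<delta>" and h: "0 \<le> h"
  obtains w where "\<exists>L. L-lipschitz_on UNIV w" "upper_gradient_on UNIV w (\<lambda>z. ennreal (g z))" "w x = 0"
    "\<And>y c. w y < c \<Longrightarrow> c \<le> h \<Longrightarrow> \<exists>a\<in>chain_costs g \<delta> x y. a < c"
proof -
  \<comment> \<open>Inserting \<open>h\<close> keeps the infimum meaningful when no chain reaches
    \<open>z\<close>, and bounds the potential.\<close>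
  define w where "w z = Inf (insert h (chain_costs g \<delta> x z))" for z
  have nonneg: "0 \<le> a" if "a \<in> chain_costs g \<delta> x z" for a z
    using that g(2) by (auto simp: chain_costs_def intro!: sum_nonneg)
  then have bdd: "bdd_below (insert h (chain_costs g \<delta> x z))" for z
    using h by (intro bdd_belowI[of _ 0]) auto
  have w_le: "w z \<le> a" if "a \<in> insert h (chain_costs g \<delta> x z)" for a z
    unfolding w_def by (rule cInf_lower[OF that bdd])
  have w_h: "w z \<le> h" for z by (rule w_le) simp
  have w_0: "0 \<le> w z" for z unfolding w_def by (rule cInf_greatest) (use nonneg h in auto)
  have step: "w z' \<le> w z + g z * dist z z'" if d: "dist z z' \<le> \<delta>" for z z'
  proof -
    have "w z' - g z * dist z z' \<le> Inf (insert h (chain_costs g \<delta> x z))"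
    proof (rule cInf_greatest)
      fix a assume "a \<in> insert h (chain_costs g \<delta> x z)"
      then have "w z' \<le> a + g z * dist z z'"
      proof
        assume "a = h"
        then show ?thesis using w_h[of z'] g(2)[of z] by (simp add: add_increasing2)
      next
        assume "a \<in> chain_costs g \<delta> x z"
        then show ?thesis using chain_costs_step[OF _ d] by (intro w_le) blast
      qed
      then show "w z' - g z * dist z z' \<le> a" by simp
    qed simp
    then show ?thesis by (simp add: w_def)
  qed
  have step2: "\<bar>w z - w z'\<bar> \<le> max (g z) (g z') * dist z z'" if d: "dist z z' \<le> \<delta>" for z z'
  proof -
    have "g z * dist z z' \<le> max (g z) (g z') * dist z z'" "g z' * dist z z' \<le> max (g z) (g z') * dist z z'"
      by (auto intro: mult_right_mono)
    then show ?thesis using step[OF d] step[of z' z] d by (auto simp: dist_commute)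
  qed
  \<comment> \<open>Points within \<open>\<delta>\<close> are joined by a single jump, which gives
    \<open>K\<close>. For points farther apart the truncation at \<open>h\<close> suffices, which
    gives \<open>h / \<delta>\<close>.\<close>
  define L where "L = max K (h / \<delta>)"
  have L0: "0 \<le> L" using h \<delta> by (simp add: L_def le_max_iff_disj)
  have lip: "L-lipschitz_on UNIV w"
  proof (rule lipschitz_onI[OF _ L0])
    fix z z'
    show "dist (w z) (w z') \<le> L * dist z z'"
    proof (cases "dist z z' \<le> \<delta>")
      case True
      have "\<bar>w z - w z'\<bar> \<le> max (g z) (g z') * dist z z'" by (rule step2[OF True])
      also have "\<dots> \<le> L * dist z z'" using g(3) by (intro mult_right_mono) (auto simp: L_def le_max_iff_disj)
      finally show ?thesis by (simp add: dist_real_def)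
    next
      case False
      have "\<bar>w z - w z'\<bar> \<le> h" using w_0[of z] w_0[of z'] w_h[of z] w_h[of z'] by linarith
      also have "h = h / \<delta> * \<delta>" using \<delta> by simp
      also have "\<dots> \<le> L * dist z z'" using False h \<delta> L0 by (intro mult_mono) (auto simp: L_def)
      finally show ?thesis by (simp add: dist_real_def)
    qed
  qed
  have gm: "(\<lambda>z. ennreal (g z)) \<in> borel_measurable borel"
    using borel_measurable_continuous_onI[OF g(1)] by measurable
  have ug: "upper_gradient_on UNIV w (\<lambda>z. ennreal (g z))"
    unfolding upper_gradient_on_def
  proof (intro conjI allI impI gm)
    fix \<gamma> :: "real \<Rightarrow> 'a" and l assume "arclength_curve \<gamma> l \<and> \<gamma> ` {0..l} \<subseteq> UNIV"
    then have \<gamma>: "arclength_curve \<gamma> l" and l: "0 \<le> l" by (auto simp: arclength_curve_def)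
    note [measurable] = clamp_measurable[OF \<gamma> gm]
    have main: "ennreal \<bar>w (\<gamma> 0) - w (\<gamma> l)\<bar> \<le> (\<integral>\<^sup>+s\<in>{0..l}. ennreal (g (\<gamma> s)) \<partial>lborel) + ennreal (\<epsilon> * l)"
      if \<epsilon>: "0 < \<epsilon>" for \<epsilon>
    proof -
      have "continuous_on {0..l} (\<lambda>s. g (\<gamma> (clamp_to l s)))"
        by (rule continuous_on_compose2[OF g(1)]) (use arclength_clamp_continuous[OF \<gamma>] continuous_on_subset in blast)+
      then have "uniformly_continuous_on {0..l} (\<lambda>s. g (\<gamma> (clamp_to l s)))"
        by (intro compact_uniformly_continuous) auto
      then obtain d where d: "0 < d" "\<And>s t. s \<in> {0..l} \<Longrightarrow> t \<in> {0..l} \<Longrightarrow> dist t s < d \<Longrightarrow>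
          dist (g (\<gamma> (clamp_to l t))) (g (\<gamma> (clamp_to l s))) < \<epsilon>"
        using \<epsilon> unfolding uniformly_continuous_on_def by metis
      define H where "H s = ennreal (g (\<gamma> (clamp_to l s))) + ennreal \<epsilon>" for s
      have Hm: "H \<in> borel_measurable borel" unfolding H_def by measurable
      have "ennreal \<bar>w (\<gamma> 0) - w (\<gamma> l)\<bar> \<le> (\<integral>\<^sup>+s\<in>{0..l}. H s \<partial>lborel)"
      \<comment> \<open>The bound \<open>\<delta>\<close> makes both endpoints of the arc one jump
        apart; \<open>d\<close> controls the variation of \<open>g\<close> along it.\<close>
      proof (rule local_to_global[OF Hm l, of "min \<delta> (d / 2)"])
        fix a b assume ab: "0 \<le> a" "a \<le> b" "b \<le> l" "b - a \<le> min \<delta> (d / 2)"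
        have dab: "dist (\<gamma> a) (\<gamma> b) \<le> b - a" using arclength_dist_le[OF \<gamma>, of a b] ab by auto
        let ?c = "max (g (\<gamma> a)) (g (\<gamma> b))"
        have c0: "0 \<le> ?c" using g(2) by (simp add: le_max_iff_disj)
        have "\<bar>w (\<gamma> a) - w (\<gamma> b)\<bar> \<le> ?c * dist (\<gamma> a) (\<gamma> b)" by (rule step2) (use dab ab in auto)
        also have "\<dots> \<le> ?c * (b - a)" by (rule mult_left_mono[OF dab c0])
        finally have "ennreal \<bar>w (\<gamma> a) - w (\<gamma> b)\<bar> \<le> ennreal (?c * (b - a))" by (rule ennreal_leI)
        also have "\<dots> = (\<integral>\<^sup>+s\<in>{a..b}. ennreal ?c \<partial>lborel)"
          using ab c0 by (simp add: nn_integral_cmult_indicator ennreal_mult)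
        also have "\<dots> \<le> (\<integral>\<^sup>+s\<in>{a..b}. H s \<partial>lborel)"
        proof (rule nn_integral_mono)
          fix s
          show "ennreal ?c * indicator {a..b} s \<le> H s * indicator {a..b} s"
          proof (cases "s \<in> {a..b}")
            case True
            then have "dist a s < d" "dist b s < d" using ab d(1) by (auto simp: dist_real_def)
            then have "dist (g (\<gamma> (clamp_to l a))) (g (\<gamma> (clamp_to l s))) < \<epsilon>"
              "dist (g (\<gamma> (clamp_to l b))) (g (\<gamma> (clamp_to l s))) < \<epsilon>"
              using d(2)[of s a] d(2)[of s b] True ab by auto
            then have "?c \<le> g (\<gamma> s) + \<epsilon>" using True ab by (auto simp: clamp_to_id dist_real_def)
            then have "ennreal ?c \<le> ennreal (g (\<gamma> s) + \<epsilon>)" by (rule ennreal_leI)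
            then show ?thesis using True ab \<epsilon> g(2) by (auto simp: H_def clamp_to_id)
          qed simp
        qed
        finally show "ennreal \<bar>w (\<gamma> a) - w (\<gamma> b)\<bar> \<le> (\<integral>\<^sup>+s\<in>{a..b}. H s \<partial>lborel)" .
      qed (use \<delta> d in simp)
      also have "\<dots> = (\<integral>\<^sup>+s. ennreal (g (\<gamma> (clamp_to l s))) * indicator {0..l} s + ennreal \<epsilon> * indicator {0..l} s \<partial>lborel)"
        by (rule nn_integral_cong) (auto simp: H_def indicator_def)
      also have "\<dots> = (\<integral>\<^sup>+s\<in>{0..l}. ennreal (g (\<gamma> s)) \<partial>lborel) + ennreal (\<epsilon> * l)"
        using \<epsilon> l by (subst nn_integral_add) (auto simp: nn_integral_cmult_indicator ennreal_mult integral_clamp[of 0 l l "\<lambda>z. ennreal (g z)"])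
      finally show ?thesis .
    qed
    show "ennreal \<bar>w (\<gamma> 0) - w (\<gamma> l)\<bar> \<le> (\<integral>\<^sup>+s\<in>{0..l}. ennreal (g (\<gamma> s)) \<partial>lborel)"
    proof (rule ennreal_le_epsilon)
      fix e :: real assume e: "0 < e"
      show "ennreal \<bar>w (\<gamma> 0) - w (\<gamma> l)\<bar> \<le> (\<integral>\<^sup>+s\<in>{0..l}. ennreal (g (\<gamma> s)) \<partial>lborel) + ennreal e"
      proof (rule order_trans[OF main[of "e / (l + 1)"]])
        have "e / (l + 1) * l \<le> e" using e l by (simp add: field_simps)
        then show "(\<integral>\<^sup>+s\<in>{0..l}. ennreal (g (\<gamma> s)) \<partial>lborel) + ennreal (e / (l + 1) * l)
          \<le> (\<integral>\<^sup>+s\<in>{0..l}. ennreal (g (\<gamma> s)) \<partial>lborel) + ennreal e"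
          by (intro add_left_mono ennreal_leI)
      qed (use e l in simp)
    qed
  qed
  have "0 \<in> chain_costs g \<delta> x x"
    unfolding chain_costs_def by (auto intro!: exI[of _ "0::nat"] exI[of _ "\<lambda>_. x"])
  then have wx: "w x = 0" using w_le[of 0 x] w_0[of x] by auto
  have approx: "\<exists>a\<in>chain_costs g \<delta> x y. a < c" if "w y < c" "c \<le> h" for y c
    using cInf_lessD[of "insert h (chain_costs g \<delta> x y)" c] that by (auto simp: w_def)
  show ?thesis by (rule that[OF _ ug wx approx]) (use lip in blast)+
qed

text \<open>Tychonoff's theorem over the rationals. The index set is countable, so the function
  space is first countable and compactness yields convergent subsequences: the diagonal argument in
  one stroke.\<close>

lemma compact_pointwise:
  fixes K :: "'a::metric_space set"
  assumes "compact K"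
  shows "compact {f :: rat \<Rightarrow> 'a. \<forall>q. f q \<in> K}"
proof -
  have "compactin (product_topology (\<lambda>_::rat. euclidean) UNIV) (PiE UNIV (\<lambda>_. K))"
    unfolding compactin_PiE using assms by simp
  then have "compact (PiE (UNIV :: rat set) (\<lambda>_. K))"
    by (simp add: euclidean_product_topology)
  also have "PiE (UNIV :: rat set) (\<lambda>_. K) = {f. \<forall>q. f q \<in> K}" by (auto simp: PiE_def Pi_def)
  finally show ?thesis .
qed

text \<open>An Arzela-Ascoli theorem for step curves, which are discontinuous but 1-Lipschitz up to
  an error \<open>\<delta> n\<close> that vanishes in the limit.\<close>

lemma almost_lipschitz_curves_limit:
  fixes \<Gamma> :: "nat \<Rightarrow> real \<Rightarrow> 'a::complete_space"
  assumes K: "compact K" "\<And>n t. 0 \<le> t \<Longrightarrow> \<Gamma> n t \<in> K"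
    and lip: "\<And>n s t. 0 \<le> s \<Longrightarrow> s \<le> t \<Longrightarrow> dist (\<Gamma> n s) (\<Gamma> n t) \<le> t - s + \<delta> n"
    and \<delta>: "\<delta> \<longlonglongrightarrow> (0::real)"
  obtains r \<gamma> where "strict_mono (r :: nat \<Rightarrow> nat)" "\<And>t. 0 \<le> t \<Longrightarrow> (\<lambda>n. \<Gamma> (r n) t) \<longlonglongrightarrow> \<gamma> t"
    "\<And>s t. 0 \<le> s \<Longrightarrow> s \<le> t \<Longrightarrow> dist (\<gamma> s) (\<gamma> t) \<le> t - s"
proof -
  \<comment> \<open>Negative rationals are sent to parameter 0, where the hypotheses still
    apply.\<close>
  define F where "F n q = \<Gamma> n (max 0 (real_of_rat q))" for n q
  have "seq_compact {f :: rat \<Rightarrow> 'a. \<forall>q. f q \<in> K}"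
    by (rule compact_imp_seq_compact[OF compact_pointwise[OF K(1)]])
  moreover have "\<forall>n. F n \<in> {f. \<forall>q. f q \<in> K}" using K(2) by (simp add: F_def)
  ultimately obtain f r where r: "strict_mono (r :: nat \<Rightarrow> nat)" and lim: "(F \<circ> r) \<longlonglongrightarrow> f"
    unfolding seq_compact_def by blast
  have Fq: "(\<lambda>n. F (r n) q) \<longlonglongrightarrow> f q" for q
  proof -
    have "continuous_on UNIV (\<lambda>f :: rat \<Rightarrow> 'a. f q)" by simp
    then have "isCont (\<lambda>f :: rat \<Rightarrow> 'a. f q) f"
      by (metis UNIV_I continuous_on_eq_continuous_at open_UNIV)
    from isCont_tendsto_compose[OF this lim] show ?thesis by (simp add: o_def)
  qed
  have \<delta>r: "(\<lambda>n. \<delta> (r n)) \<longlonglongrightarrow> 0" using LIMSEQ_subseq_LIMSEQ[OF \<delta> r] by (simp add: o_def)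
  have conv: "convergent (\<lambda>n. \<Gamma> (r n) t)" if t: "0 \<le> t" for t
  proof (rule Cauchy_convergent, rule metric_CauchyI)
    fix e :: real assume e: "0 < e"
    \<comment> \<open>A rational time just after \<open>t\<close>: the almost Lipschitz bound
      transfers convergence from \<open>q\<close> to \<open>t\<close>.\<close>
    obtain q where q: "t < real_of_rat q" "real_of_rat q < t + e / 8" using of_rat_dense[of t "t + e / 8"] e by auto
    have "Cauchy (\<lambda>n. F (r n) q)" using Fq by (rule LIMSEQ_imp_Cauchy)
    then obtain N1 where N1: "\<And>m n. m \<ge> N1 \<Longrightarrow> n \<ge> N1 \<Longrightarrow> dist (F (r m) q) (F (r n) q) < e / 4"
      using metric_CauchyD[of _ "e / 4"] e by (metis divide_pos_pos zero_less_numeral)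
    obtain N2 where N2: "\<And>n. n \<ge> N2 \<Longrightarrow> \<delta> (r n) < e / 8"
      using order_tendstoD(2)[OF \<delta>r, of "e / 8"] e by (auto simp: eventually_sequentially)
    show "\<exists>M. \<forall>m\<ge>M. \<forall>n\<ge>M. dist (\<Gamma> (r m) t) (\<Gamma> (r n) t) < e"
    proof (intro exI[of _ "max N1 N2"] allI impI)
      fix m n assume mn: "max N1 N2 \<le> m" "max N1 N2 \<le> n"
      have near: "dist (\<Gamma> (r k) t) (F (r k) q) < e / 4" if "N2 \<le> k" for k
      proof -
        have "0 \<le> real_of_rat q" using q t by linarith
        then have "F (r k) q = \<Gamma> (r k) (real_of_rat q)" unfolding F_def by (simp only: max_absorb2)
        then show ?thesis using lip[OF t, of "real_of_rat q" "r k"] q N2[OF that] by simp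
      qed
      have "dist (\<Gamma> (r m) t) (\<Gamma> (r n) t) \<le> dist (\<Gamma> (r m) t) (F (r m) q) + dist (F (r m) q) (F (r n) q) + dist (F (r n) q) (\<Gamma> (r n) t)"
        using dist_triangle[of "\<Gamma> (r m) t" "\<Gamma> (r n) t" "F (r m) q"] dist_triangle[of "F (r m) q" "\<Gamma> (r n) t" "F (r n) q"] by linarith
      then show "dist (\<Gamma> (r m) t) (\<Gamma> (r n) t) < e"
        using near[of m] near[of n] N1[of m n] mn e by (simp add: dist_commute)
    qed
  qed
  define \<gamma> where "\<gamma> t = lim (\<lambda>n. \<Gamma> (r n) t)" for t
  have lim\<gamma>: "(\<lambda>n. \<Gamma> (r n) t) \<longlonglongrightarrow> \<gamma> t" if "0 \<le> t" for t
    using conv[OF that] by (simp add: \<gamma>_def convergent_LIMSEQ_iff)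
  have "dist (\<gamma> s) (\<gamma> t) \<le> t - s" if st: "0 \<le> s" "s \<le> t" for s t
  proof (rule LIMSEQ_le)
    show "(\<lambda>n. dist (\<Gamma> (r n) s) (\<Gamma> (r n) t)) \<longlonglongrightarrow> dist (\<gamma> s) (\<gamma> t)" using st by (intro tendsto_dist lim\<gamma>) auto
    show "(\<lambda>n. t - s + \<delta> (r n)) \<longlonglongrightarrow> t - s" using tendsto_add[OF tendsto_const[of "t - s"] \<delta>r] by simp
    show "\<exists>N. \<forall>n\<ge>N. dist (\<Gamma> (r n) s) (\<Gamma> (r n) t) \<le> t - s + \<delta> (r n)" using lip[OF st] by blast
  qed
  then show ?thesis using that[OF r lim\<gamma>] by blast
qed

text \<open>The lower bound \<open>\<kappa>\<close> turns bounded cost into bounded length, so the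
  chains stay in one compact ball and their step curves have a limit. Fatou's lemma passes the cost
  to the limit.\<close>

lemma chain_curve_limit:
  fixes g :: "nat \<Rightarrow> 'a::complete_space \<Rightarrow> real"
  assumes cpt: "\<And>(z::'a) R. compact (cball z R)"
    and g: "\<And>n. continuous_on UNIV (g n)" "\<And>n k z. k \<le> n \<Longrightarrow> g k z \<le> g n z" "\<And>n z. \<kappa> \<le> g n z" "0 < \<kappa>"
    and a: "\<And>n. a n \<in> chain_costs (g n) (1 / Suc n) x y" "\<And>n. a n \<le> c"
  obtains \<gamma> l where "0 \<le> l" "\<gamma> 0 = x" "\<gamma> l = y"
    "\<And>s t. 0 \<le> s \<Longrightarrow> s \<le> t \<Longrightarrow> t \<le> l \<Longrightarrow> dist (\<gamma> s) (\<gamma> t) \<le> t - s"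
    "(\<integral>\<^sup>+s\<in>{0..l}. (SUP k. ennreal (g k (\<gamma> s))) \<partial>lborel) \<le> ennreal c"
proof -
  have "\<forall>n. \<exists>m W. W 0 = x \<and> W m = y \<and> (\<forall>i<m. dist (W i) (W (Suc i)) \<le> 1 / Suc n) \<and>
     a n = (\<Sum>i<m. g n (W i) * dist (W i) (W (Suc i)))"
    using a(1) unfolding chain_costs_def by auto
  from choice[OF this] obtain m where
    "\<forall>n. \<exists>W. W 0 = x \<and> W (m n) = y \<and> (\<forall>i<m n. dist (W i) (W (Suc i)) \<le> 1 / Suc n) \<and>
     a n = (\<Sum>i<m n. g n (W i) * dist (W i) (W (Suc i)))" by (rule exE)
  from choice[OF this] obtain W where
    "\<forall>n. W n 0 = x \<and> W n (m n) = y \<and> (\<forall>i<m n. dist (W n i) (W n (Suc i)) \<le> 1 / Suc n) \<and>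
     a n = (\<Sum>i<m n. g n (W n i) * dist (W n i) (W n (Suc i)))" by (rule exE)
  then have W: "\<And>n. W n 0 = x" "\<And>n. W n (m n) = y"
    "\<And>n i. i < m n \<Longrightarrow> dist (W n i) (W n (Suc i)) \<le> 1 / Suc n"
    "\<And>n. a n = (\<Sum>i<m n. g n (W n i) * dist (W n i) (W n (Suc i)))" by blast+
  \<comment> \<open>The length travelled before the \<open>i\<close>-th point serves as time, so a
    jump of length \<open>\<ell>\<close> lasts for time \<open>\<ell>\<close>.\<close>
  define T where "T n i = (\<Sum>j<i. dist (W n j) (W n (Suc j)))" for n i
  have T0: "T n 0 = 0" for n by (simp add: T_def)
  have TSuc: "T n (Suc i) = T n i + dist (W n i) (W n (Suc i))" for n i by (simp add: T_def)
  have Tmono: "T n i \<le> T n j" if "i \<le> j" for n i j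
    unfolding T_def by (rule sum_mono2) (use that in auto)
  have dW: "dist (W n i) (W n j) \<le> T n j - T n i" if "i \<le> j" for n i j
    using that
  proof (induction j rule: dec_induct)
    case (step k)
    then show ?case using dist_triangle[of "W n i" "W n (Suc k)" "W n k"] by (simp add: TSuc)
  qed simp
  define len where "len n = T n (m n)" for n
  have len: "0 \<le> len n" "len n \<le> c / \<kappa>" for n
  proof -
    show "0 \<le> len n" using Tmono[of 0 "m n" n] by (simp add: len_def T0)
    have "\<kappa> * len n = (\<Sum>i<m n. \<kappa> * dist (W n i) (W n (Suc i)))" by (simp add: len_def T_def sum_distrib_left)
    also have "\<dots> \<le> a n" unfolding W(4) by (intro sum_mono mult_right_mono g) auto
    finally show "len n \<le> c / \<kappa>" using a(2)[of n] g(4) by (simp add: field_simps)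
  qed
  \<comment> \<open>Repeated points give equal times. Taking the largest index makes the next time
    strictly later, so \<open>t\<close> lies in the half-open interval assigned to its jump.\<close>
  define idx where "idx n t = Max {k. k \<le> m n \<and> T n k \<le> t}" for n t
  have idx: "idx n t \<le> m n" "T n (idx n t) \<le> t" "\<And>k. k \<le> m n \<Longrightarrow> T n k \<le> t \<Longrightarrow> k \<le> idx n t"
    if t: "0 \<le> t" for n t
  proof -
    have "finite {k. k \<le> m n \<and> T n k \<le> t}" "{k. k \<le> m n \<and> T n k \<le> t} \<noteq> {}" using t T0[of n] by auto
    from Max_in[OF this] Max_ge[OF this(1)] show "idx n t \<le> m n" "T n (idx n t) \<le> t"
      "\<And>k. k \<le> m n \<Longrightarrow> T n k \<le> t \<Longrightarrow> k \<le> idx n t" by (auto simp: idx_def)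
  qed
  have next_gt: "t < T n (Suc (idx n t))" if t: "0 \<le> t" "idx n t < m n" for n t
    using idx(3)[OF t(1), of "Suc (idx n t)" n] t(2) by (meson Suc_leI lessI not_le)
  define \<Gamma> where "\<Gamma> n t = W n (idx n t)" for n t
  \<comment> \<open>The error is the length of the jump in progress at time \<open>s\<close>: the
    curve is still at its left end.\<close>
  have \<Gamma>lip: "dist (\<Gamma> n s) (\<Gamma> n t) \<le> t - s + 1 / Suc n" if st: "0 \<le> s" "s \<le> t" for n s t
  proof -
    have t0: "0 \<le> t" using st by simp
    have k: "idx n s \<le> idx n t" using idx(1,2)[OF st(1), of n] st by (intro idx(3)[OF t0]) auto
    show ?thesis
    proof (cases "idx n s < m n")
      case True
      have "dist (\<Gamma> n s) (\<Gamma> n t) \<le> T n (idx n t) - T n (idx n s)" unfolding \<Gamma>_def by (rule dW[OF k])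
      also have "\<dots> \<le> t - T n (idx n s)" using idx(2)[OF t0] by simp
      also have "\<dots> \<le> t - s + 1 / Suc n"
        using next_gt[OF st(1) True] W(3)[OF True] by (simp add: TSuc)
      finally show ?thesis .
    next
      case False
      then have "idx n t = idx n s" using idx(1)[OF st(1), of n] idx(1)[OF t0, of n] k by linarith
      then show ?thesis using st by (simp add: \<Gamma>_def)
    qed
  qed
  \<comment> \<open>The index at time 0 need not be 0, because the first jumps may have length zero;
    the distance estimate settles this.\<close>
  have \<Gamma>0: "\<Gamma> n 0 = x" for n
    using dW[of 0 "idx n 0" n] idx(2)[of 0 n] Tmono[of 0 "idx n 0" n] T0[of n] W(1)[of n] by (simp add: \<Gamma>_def)
  have \<Gamma>len: "\<Gamma> n (len n) = y" for n
  proof -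
    have "m n \<le> idx n (len n)" by (rule idx(3)[OF len(1)]) (auto simp: len_def)
    then have "idx n (len n) = m n" using idx(1)[OF len(1), of n n] by simp
    then show ?thesis using W(2) by (simp add: \<Gamma>_def)
  qed
  have \<Gamma>in: "\<Gamma> n t \<in> cball x (c / \<kappa>)" if t: "0 \<le> t" for n t
  proof -
    have "dist x (\<Gamma> n t) \<le> T n (idx n t)" using dW[of 0 "idx n t" n] by (simp add: \<Gamma>_def W(1) T0)
    also have "\<dots> \<le> len n" unfolding len_def by (rule Tmono[OF idx(1)[OF t]])
    finally show ?thesis using len(2)[of n] by simp
  qed
  have \<delta>: "(\<lambda>n. 1 / real (Suc n)) \<longlonglongrightarrow> 0" by (rule LIMSEQ_Suc[OF lim_1_over_n])
  obtain l r1 where l: "l \<in> {0..c / \<kappa>}" and r1: "strict_mono r1" "(len \<circ> r1) \<longlonglongrightarrow> l"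
    using compact_Icc[of 0 "c / \<kappa>"] len unfolding compact_eq_seq_compact_metric seq_compact_def by (metis atLeastAtMost_iff)
  obtain r2 \<gamma> where r2: "strict_mono (r2 :: nat \<Rightarrow> nat)" and lim: "\<And>t. 0 \<le> t \<Longrightarrow> (\<lambda>n. \<Gamma> (r1 (r2 n)) t) \<longlonglongrightarrow> \<gamma> t"
    and \<gamma>lip: "\<And>s t. 0 \<le> s \<Longrightarrow> s \<le> t \<Longrightarrow> dist (\<gamma> s) (\<gamma> t) \<le> t - s"
    by (rule almost_lipschitz_curves_limit[of "cball x (c / \<kappa>)" "\<lambda>n. \<Gamma> (r1 n)" "\<lambda>n. 1 / real (Suc (r1 n))"])
       (use cpt \<Gamma>in \<Gamma>lip LIMSEQ_subseq_LIMSEQ[OF \<delta> r1(1)] in \<open>auto simp: o_def\<close>)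
  define r where "r = r1 \<circ> r2"
  have r: "strict_mono r" unfolding r_def by (rule strict_mono_o[OF r1(1) r2])
  have limr: "(\<lambda>n. \<Gamma> (r n) t) \<longlonglongrightarrow> \<gamma> t" if "0 \<le> t" for t using lim[OF that] by (simp add: r_def)
  have lenr: "(\<lambda>n. len (r n)) \<longlonglongrightarrow> l"
    using LIMSEQ_subseq_LIMSEQ[OF r1(2) r2] by (simp add: r_def o_def)
  have \<delta>r: "(\<lambda>n. 1 / real (Suc (r n))) \<longlonglongrightarrow> 0" using LIMSEQ_subseq_LIMSEQ[OF \<delta> r] by (simp add: o_def)
  have l0: "0 \<le> l" using l by simp
  have \<gamma>0: "\<gamma> 0 = x" using limr[of 0] \<Gamma>0 by (simp add: LIMSEQ_const_iff)
  have \<gamma>l: "\<gamma> l = y"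
  proof -
    \<comment> \<open>The terminal times vary with \<open>n\<close>, so the end point is reached by
      combining their convergence with the almost Lipschitz bound.\<close>
    have "(\<lambda>n. dist (\<Gamma> (r n) l) y) \<longlonglongrightarrow> 0"
    proof (rule Lim_null_comparison)
      have "dist (\<Gamma> n l) y \<le> \<bar>len n - l\<bar> + 1 / Suc n" for n
        using \<Gamma>lip[of l "len n" n] \<Gamma>lip[of "len n" l n] l0 len(1)[of n] \<Gamma>len[of n]
        by (cases "l \<le> len n") (auto simp: dist_commute)
      then show "\<forall>\<^sub>F n in sequentially. norm (dist (\<Gamma> (r n) l) y) \<le> \<bar>len (r n) - l\<bar> + 1 / Suc (r n)" by simp
      have "(\<lambda>n. \<bar>len (r n) - l\<bar> + 1 / real (Suc (r n))) \<longlonglongrightarrow> \<bar>l - l\<bar> + 0"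
        by (intro tendsto_intros lenr \<delta>r)
      then show "(\<lambda>n. \<bar>len (r n) - l\<bar> + 1 / real (Suc (r n))) \<longlonglongrightarrow> 0" by simp
    qed
    moreover have "(\<lambda>n. dist (\<Gamma> (r n) l) y) \<longlonglongrightarrow> dist (\<gamma> l) y" by (intro tendsto_intros limr l0)
    ultimately have "dist (\<gamma> l) y = 0" using LIMSEQ_unique by blast
    then show ?thesis by simp
  qed
  \<comment> \<open>The integrand of the chain cost as a step function of time: its integral is
    exactly \<open>a n\<close>.\<close>
  define \<phi> where "\<phi> n t = (\<Sum>i<m n. ennreal (g n (W n i)) * indicator {T n i..<T n (Suc i)} t)" for n t
  have g0: "0 \<le> g n z" for n z using g(3)[of n z] g(4) by simp
  have \<phi>m: "\<phi> n \<in> borel_measurable lborel" for n unfolding \<phi>_def by measurable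
  have \<phi>int: "(\<integral>\<^sup>+t. \<phi> n t \<partial>lborel) \<le> ennreal c" for n
  proof -
    have "(\<integral>\<^sup>+t. \<phi> n t \<partial>lborel) = (\<Sum>i<m n. \<integral>\<^sup>+t\<in>{T n i..<T n (Suc i)}. ennreal (g n (W n i)) \<partial>lborel)"
      unfolding \<phi>_def by (rule nn_integral_sum) measurable
    also have "\<dots> = (\<Sum>i<m n. ennreal (g n (W n i) * dist (W n i) (W n (Suc i))))"
      using Tmono[of _ "Suc _" n] g0 by (intro sum.cong) (auto simp: nn_integral_cmult_indicator TSuc ennreal_mult)
    also have "\<dots> = ennreal (a n)" unfolding W(4) by (rule sum_ennreal) (use g0 in auto)
    also have "\<dots> \<le> ennreal c" by (rule ennreal_leI[OF a(2)])
    finally show ?thesis .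
  qed
  have \<phi>ge: "ennreal (g n (\<Gamma> n t)) \<le> \<phi> n t" if t: "0 \<le> t" "t < len n" for n t
  proof -
    have i: "idx n t < m n"
      using idx(1,2)[OF t(1), of n] t(2) by (metis le_neq_implies_less len_def not_le)
    have "ennreal (g n (\<Gamma> n t)) = (\<Sum>i\<in>{idx n t}. ennreal (g n (W n i)) * indicator {T n i..<T n (Suc i)} t)"
      using idx(2)[OF t(1), of n] next_gt[OF t(1) i] by (simp add: \<Gamma>_def)
    also have "\<dots> \<le> \<phi> n t" unfolding \<phi>_def by (rule sum_mono2) (use i in auto)
    finally show ?thesis .
  qed
  \<comment> \<open>The index \<open>k\<close> is fixed first: monotonicity replaces
    \<open>g (r n)\<close> by the single continuous function \<open>g k\<close>, and only afterwards
    is the supremum over \<open>k\<close> taken.\<close>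
  have lower: "(SUP k. ennreal (g k (\<gamma> t))) \<le> liminf (\<lambda>n. \<phi> (r n) t)" if t: "0 \<le> t" "t < l" for t
  proof (rule SUP_least)
    fix k
    have "isCont (g k) (\<gamma> t)" using g(1)[of k] by (simp add: continuous_on_eq_continuous_at)
    then have "(\<lambda>n. ennreal (g k (\<Gamma> (r n) t))) \<longlonglongrightarrow> ennreal (g k (\<gamma> t))"
      by (intro tendsto_ennrealI isCont_tendsto_compose[OF _ limr[OF t(1)]])
    then have "ennreal (g k (\<gamma> t)) = liminf (\<lambda>n. ennreal (g k (\<Gamma> (r n) t)))"
      by (rule lim_imp_Liminf[symmetric, OF sequentially_bot])
    also have "\<dots> \<le> liminf (\<lambda>n. \<phi> (r n) t)"
    proof (rule Liminf_mono)
      have "\<forall>\<^sub>F n in sequentially. t < len (r n)" by (rule order_tendstoD(1)[OF lenr t(2)])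
      then show "\<forall>\<^sub>F n in sequentially. ennreal (g k (\<Gamma> (r n) t)) \<le> \<phi> (r n) t"
        using eventually_ge_at_top[of k]
      proof eventually_elim
        case (elim n)
        have "k \<le> r n" using elim(2) seq_suble[OF r, of n] by simp
        then have "ennreal (g k (\<Gamma> (r n) t)) \<le> ennreal (g (r n) (\<Gamma> (r n) t))" by (intro ennreal_leI g(2))
        also have "\<dots> \<le> \<phi> (r n) t" by (rule \<phi>ge[OF t(1) elim(1)])
        finally show ?case .
      qed
    qed
    finally show "ennreal (g k (\<gamma> t)) \<le> liminf (\<lambda>n. \<phi> (r n) t)" .
  qed
  have "(\<integral>\<^sup>+s\<in>{0..l}. (SUP k. ennreal (g k (\<gamma> s))) \<partial>lborel) \<le> (\<integral>\<^sup>+s. liminf (\<lambda>n. \<phi> (r n) s) \<partial>lborel)"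
  proof (rule nn_integral_mono_AE)
    \<comment> \<open>At \<open>s = l\<close> the step functions may already vanish; this single
      time is a null set.\<close>
    show "AE s in lborel. (SUP k. ennreal (g k (\<gamma> s))) * indicator {0..l} s \<le> liminf (\<lambda>n. \<phi> (r n) s)"
      using AE_lborel_singleton[of l]
    proof eventually_elim
      case (elim s)
      then show ?case using lower[of s] by (cases "s \<in> {0..l}") auto
    qed
  qed
  also have "\<dots> \<le> liminf (\<lambda>n. \<integral>\<^sup>+s. \<phi> (r n) s \<partial>lborel)" by (rule nn_integral_liminf[OF \<phi>m])
  also have "\<dots> \<le> liminf (\<lambda>n::nat. ennreal c)" by (rule Liminf_mono) (simp add: \<phi>int)
  also have "\<dots> = ennreal c" by (rule Liminf_const) simp
  finally have int: "(\<integral>\<^sup>+s\<in>{0..l}. (SUP k. ennreal (g k (\<gamma> s))) \<partial>lborel) \<le> ennreal c" .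
  show ?thesis by (rule that[OF l0 \<gamma>0 \<gamma>l _ int]) (use \<gamma>lip in auto)
qed

text \<open>The bound is assumed for every Lipschitz function with gradient \<open>g n\<close>, in
  particular for the chain potential, and not for \<open>v\<close> itself. If \<open>v\<close>
  violated it, every potential would yield a chain of cost below \<open>c\<close>, and their limit
  curve would have too small an integral of \<open>G\<close>.\<close>

lemma oscillation_bound_lsc:
  fixes g :: "nat \<Rightarrow> 'a::complete_space \<Rightarrow> real"
  assumes cpt: "\<And>(z::'a) R. compact (cball z R)"
    and g: "\<And>n. continuous_on UNIV (g n)" "\<And>n k z. k \<le> n \<Longrightarrow> g k z \<le> g n z" "\<And>n z. \<kappa> \<le> g n z" "0 < \<kappa>"
      "\<And>n z. g n z \<le> K n"
    and ug: "upper_gradient_on UNIV v G" and dom: "\<And>z. G z \<le> (SUP n. ennreal (g n z))"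
    and d: "0 \<le> d"
    and bound: "\<And>n w. \<exists>L. L-lipschitz_on UNIV w \<Longrightarrow> upper_gradient_on UNIV w (\<lambda>z. ennreal (g n z)) \<Longrightarrow> \<bar>w x - w y\<bar> \<le> d"
  shows "\<bar>v x - v y\<bar> \<le> d"
proof (rule ccontr)
  define h where "h = \<bar>v x - v y\<bar>"
  assume "\<not> \<bar>v x - v y\<bar> \<le> d"
  then have dh: "d < h" by (simp add: h_def)
  \<comment> \<open>Strictly between \<open>d\<close> and \<open>h\<close>: above \<open>d\<close>
    so that the potential lies below \<open>c\<close>, below \<open>h\<close> so that the final
    inequality is contradictory.\<close>
  define c where "c = (d + h) / 2"
  have c: "d < c" "c < h" using dh by (auto simp: c_def)
  have g0: "0 \<le> g n z" for n z using g(3)[of n z] g(4) by simp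
  have h0: "0 \<le> h" by (simp add: h_def)
  have "\<exists>a\<in>chain_costs (g n) (1 / Suc n) x y. a < c" for n
  proof -
    have \<delta>n: "0 < 1 / real (Suc n)" by simp
    obtain w where w: "\<exists>L. L-lipschitz_on UNIV w" "upper_gradient_on UNIV w (\<lambda>z. ennreal (g n z))" "w x = 0"
      "\<And>y c. w y < c \<Longrightarrow> c \<le> h \<Longrightarrow> \<exists>a\<in>chain_costs (g n) (1 / Suc n) x y. a < c"
      using chain_potential[OF g(1) g0 g(5) \<delta>n h0, of n x] by blast
    have "w y < c" using bound[OF w(1,2)] w(3) c by auto
    then show ?thesis using w(4) c by simp
  qed
  then have "\<forall>n. \<exists>a. a \<in> chain_costs (g n) (1 / Suc n) x y \<and> a < c" by blast
  from choice[OF this] obtain a where "\<forall>n. a n \<in> chain_costs (g n) (1 / Suc n) x y \<and> a n < c" by (rule exE)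
  then have a: "\<And>n. a n \<in> chain_costs (g n) (1 / Suc n) x y" "\<And>n. a n \<le> c" using less_imp_le by blast+
  obtain \<gamma> l where \<gamma>: "0 \<le> l" "\<gamma> 0 = x" "\<gamma> l = y"
    "\<And>s t. 0 \<le> s \<Longrightarrow> s \<le> t \<Longrightarrow> t \<le> l \<Longrightarrow> dist (\<gamma> s) (\<gamma> t) \<le> t - s"
    "(\<integral>\<^sup>+s\<in>{0..l}. (SUP k. ennreal (g k (\<gamma> s))) \<partial>lborel) \<le> ennreal c"
    using chain_curve_limit[OF cpt g(1-4) a] by blast
  obtain \<gamma>' L where \<gamma>': "arclength_curve \<gamma>' (L l)" and L: "L 0 = 0"
    "\<And>s. s \<in> {0..l} \<Longrightarrow> \<gamma>' (L s) = \<gamma> s"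
    "\<And>s t. 0 \<le> s \<Longrightarrow> s \<le> t \<Longrightarrow> t \<le> l \<Longrightarrow> L s \<le> L t \<and> L t - L s \<le> t - s"
    using arclength_reparametrisation[OF \<gamma>(1,4)] by blast
  have Ll: "0 \<le> L l" using \<gamma>' by (simp add: arclength_curve_def)
  have ends: "\<gamma>' 0 = x" "\<gamma>' (L l) = y" using L(2)[of 0] L(2)[of l] \<gamma> L(1) by auto
  define hh where "hh k s = g k (\<gamma>' (clamp_to (L l) s))" for k s
  have hhc: "continuous_on UNIV (hh k)" for k
    unfolding hh_def by (rule continuous_on_compose2[OF g(1) arclength_clamp_continuous[OF \<gamma>']]) simp
  have [measurable]: "hh k \<in> borel_measurable borel" for k by (rule borel_measurable_continuous_onI[OF hhc])
  have "ennreal h \<le> (\<integral>\<^sup>+s\<in>{0..L l}. G (\<gamma>' s) \<partial>lborel)"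
    using ug \<gamma>' ends unfolding upper_gradient_on_def h_def by fastforce
  also have "\<dots> \<le> (\<integral>\<^sup>+s. (SUP k. ennreal (hh k s) * indicator {0..L l} s) \<partial>lborel)"
  proof (rule nn_integral_mono)
    fix s
    show "G (\<gamma>' s) * indicator {0..L l} s \<le> (SUP k. ennreal (hh k s) * indicator {0..L l} s)"
      using dom[of "\<gamma>' s"] by (cases "s \<in> {0..L l}") (auto simp: hh_def clamp_to_id)
  qed
  \<comment> \<open>Monotone convergence reduces the supremum to the continuous integrands
    \<open>hh k\<close>, for which the change of variables was proved.\<close>
  also have "\<dots> = (SUP k. \<integral>\<^sup>+s\<in>{0..L l}. ennreal (hh k s) \<partial>lborel)"
  proof (rule nn_integral_monotone_convergence_SUP)
    show "incseq (\<lambda>k s. ennreal (hh k s) * indicator {0..L l} s)"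
      by (intro incseq_SucI le_funI mult_right_mono ennreal_leI) (auto simp: hh_def intro: g(2))
  qed measurable
  also have "\<dots> \<le> ennreal c"
  proof (rule SUP_least)
    fix k
    have "(\<integral>\<^sup>+s\<in>{0..L l}. ennreal (hh k s) \<partial>lborel)
        \<le> (\<integral>\<^sup>+s\<in>{0..l}. ennreal (hh k (L s)) \<partial>lborel)"
      by (rule integral_reparametrisation_le[OF hhc _ \<gamma>(1) L(1,3)]) (simp_all add: hh_def g0)
    also have "\<dots> \<le> (\<integral>\<^sup>+s\<in>{0..l}. (SUP k. ennreal (g k (\<gamma> s))) \<partial>lborel)"
    proof (rule nn_integral_mono)
      fix s
      show "ennreal (hh k (L s)) * indicator {0..l} s \<le> (SUP k. ennreal (g k (\<gamma> s))) * indicator {0..l} s"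
      proof (cases "s \<in> {0..l}")
        case True
        then have "L s \<in> {0..L l}" using L(3)[of 0 s] L(3)[of s l] L(1) by auto
        then have "hh k (L s) = g k (\<gamma> s)" using L(2)[OF True] by (simp add: hh_def clamp_to_id)
        then show ?thesis using True by (auto intro: SUP_upper)
      qed simp
    qed
    also have "\<dots> \<le> ennreal c" by (rule \<gamma>(5))
    finally show "(\<integral>\<^sup>+s\<in>{0..L l}. ennreal (hh k s) \<partial>lborel) \<le> ennreal c" .
  qed
  finally have "ennreal h \<le> ennreal c" .
  then show False using c h0 d by (auto simp: ennreal_le_iff2)
qed

section \<open>The improved Poincare inequality\<close>

lemma powr_sum_le:
  fixes a b q :: real
  assumes "0 \<le> a" "0 \<le> b" "1 \<le> q"
  shows "a powr q + b powr q \<le> (2 * (a + b)) powr q"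
proof -
  have "a powr q \<le> (a + b) powr q" "b powr q \<le> (a + b) powr q" using assms by (auto intro: powr_mono2)
  then have "a powr q + b powr q \<le> 2 * (a + b) powr q" by simp
  also have "\<dots> \<le> 2 powr q * (a + b) powr q"
    using powr_mono[of 1 q 2] assms by (intro mult_right_mono) auto
  also have "\<dots> = (2 * (a + b)) powr q" using assms by (subst powr_mult) auto
  finally show ?thesis .
qed

lemma powr_add_le:
  fixes a b q :: real
  assumes "0 \<le> a" "0 \<le> b" "1 \<le> q"
  shows "(a + b) powr q \<le> 2 powr q * (a powr q + b powr q)"
proof -
  have "(a + b) powr q \<le> (2 * max a b) powr q" using assms by (intro powr_mono2) auto
  also have "\<dots> = 2 powr q * max a b powr q" using assms by (subst powr_mult) auto
  also have "max a b powr q \<le> a powr q + b powr q" by (simp add: max_def)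
  finally show ?thesis by simp
qed

section \<open>Regularity of the measure, semicontinuous majorants and localisation\<close>

context doubling_space
begin

text \<open>Approximating from inside and outside at once makes the property symmetric under
  complements, so induction over the generated sigma-algebra goes through. Intersecting with a ball
  supplies the finite measure needed for continuity from above.\<close>

lemma regular:
  assumes A: "A \<in> sets borel" and e: "0 < (e::real)"
  shows "\<exists>C U. closed C \<and> open U \<and> C \<subseteq> A \<and> A \<subseteq> U \<and> emeasure \<mu> ((U - C) \<inter> ball c R) \<le> ennreal e"
proof -
  have fin: "emeasure \<mu> (S \<inter> ball c R) \<noteq> \<infinity>" for S
    using finite_measure_subset_ball[of "S \<inter> ball c R" c R] by simp
  have lim_ex: "\<exists>n::nat. emeasure \<mu> (S n \<inter> ball c R) \<le> emeasure \<mu> ((\<Inter>n. S n) \<inter> ball c R) + ennreal e"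
    if S: "decseq S" "\<And>n. S n \<in> sets borel" and e: "0 < e" for S and e :: real
  proof -
    have "(\<lambda>n. emeasure \<mu> (S n \<inter> ball c R)) \<longlonglongrightarrow> emeasure \<mu> (\<Inter>n. S n \<inter> ball c R)"
      by (rule Lim_emeasure_decseq) (use S fin in \<open>auto simp: sets_eq decseq_def\<close>)
    moreover have "(\<Inter>n. S n \<inter> ball c R) = (\<Inter>n. S n) \<inter> ball c R" by blast
    ultimately have lim: "(\<lambda>n. emeasure \<mu> (S n \<inter> ball c R)) \<longlonglongrightarrow> emeasure \<mu> ((\<Inter>n. S n) \<inter> ball c R)" by simp
    have "emeasure \<mu> ((\<Inter>n. S n) \<inter> ball c R) < emeasure \<mu> ((\<Inter>n. S n) \<inter> ball c R) + ennreal e"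
      using fin[of "\<Inter>n. S n"] e
      by (cases "emeasure \<mu> ((\<Inter>n. S n) \<inter> ball c R)") (auto simp: ennreal_less_iff simp flip: ennreal_plus)
    from order_tendstoD(2)[OF lim this] have "\<forall>\<^sub>F n in sequentially. emeasure \<mu> (S n \<inter> ball c R) < emeasure \<mu> ((\<Inter>n. S n) \<inter> ball c R) + ennreal e" .
    then show ?thesis unfolding eventually_sequentially using less_imp_le by blast
  qed
  have "A \<in> sigma_sets UNIV {S. open S}" using A by (simp add: borel_def)
  then show ?thesis using e
  proof (induction arbitrary: e)
    case (Basic A)
    define C where "C n = (\<Inter>w\<in>-A. {z. 1 / real (Suc n) \<le> dist z w})" for n :: nat
    have C: "closed (C n)" for n unfolding C_def by (intro closed_INT ballI closed_Collect_le continuous_intros)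
    have CA: "C n \<subseteq> A" for n
    proof
      fix z assume z: "z \<in> C n"
      show "z \<in> A"
      proof (rule ccontr)
        assume "z \<notin> A"
        then have "1 / real (Suc n) \<le> dist z z" using z unfolding C_def by blast
        then show False by simp
      qed
    qed
    have "A \<subseteq> (\<Union>n. C n)"
    proof
      fix z assume z: "z \<in> A"
      then obtain r where r: "0 < r" "ball z r \<subseteq> A" using Basic open_contains_ball by blast
      obtain n where n: "1 / Suc n < r" using nat_approx_posE[OF r(1)] by blast
      have "1 / real (Suc n) \<le> dist z w" if "w \<notin> A" for w
        using n r(2) that by (smt (verit) mem_ball subsetD)
      then show "z \<in> (\<Union>n. C n)" by (auto simp: C_def)
    qed
    then have empty: "(\<Inter>n. A - C n) = {}" by blast
    have "decseq (\<lambda>n. A - C n)"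
    proof (rule decseq_SucI)
      fix n
      have "1 / real (Suc (Suc n)) \<le> 1 / real (Suc n)" by (simp add: frac_le)
      then have "C n \<subseteq> C (Suc n)" unfolding C_def by force
      then show "A - C (Suc n) \<le> A - C n" by blast
    qed
    moreover have "A - C n \<in> sets borel" for n using Basic C by auto
    ultimately have "\<exists>n. emeasure \<mu> ((A - C n) \<inter> ball c R) \<le> emeasure \<mu> ((\<Inter>n. A - C n) \<inter> ball c R) + ennreal e"
      using Basic.prems by (intro lim_ex)
    then obtain n where "emeasure \<mu> ((A - C n) \<inter> ball c R) \<le> ennreal e"
      unfolding empty by auto
    then show ?case using Basic C CA by blast
  next
    case Empty
    show ?case by (intro exI[of _ "{}"]) auto
  next
    case (Compl A)
    from Compl.IH[OF Compl.prems] obtain C U where CU: "closed C" "open U" "C \<subseteq> A" "A \<subseteq> U"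
      "emeasure \<mu> ((U - C) \<inter> ball c R) \<le> ennreal e" by blast
    have "- C - - U = U - C" by blast
    then show ?case using CU by (intro exI[of _ "- U"] exI[of _ "- C"]) (auto simp: closed_def)
  next
    case (Union A)
    \<comment> \<open>Half of \<open>e\<close> is distributed over the sets of the union; the other
      half pays for keeping only finitely many closed sets, since an infinite union need not be
      closed.\<close>
    define \<epsilon> where "\<epsilon> i = e / 2 * (1 / 2) ^ Suc i" for i
    have \<epsilon>: "0 < \<epsilon> i" for i using Union.prems by (simp add: \<epsilon>_def)
    have "\<forall>i. \<exists>P. closed (fst P) \<and> open (snd P) \<and> fst P \<subseteq> A i \<and> A i \<subseteq> snd P \<and>
        emeasure \<mu> ((snd P - fst P) \<inter> ball c R) \<le> ennreal (\<epsilon> i)"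
    proof
      fix i
      from Union.IH[OF \<epsilon>[of i], of i] obtain C U where "closed C" "open U" "C \<subseteq> A i" "A i \<subseteq> U"
        "emeasure \<mu> ((U - C) \<inter> ball c R) \<le> ennreal (\<epsilon> i)" by blast
      then show "\<exists>P. closed (fst P) \<and> open (snd P) \<and> fst P \<subseteq> A i \<and> A i \<subseteq> snd P \<and>
        emeasure \<mu> ((snd P - fst P) \<inter> ball c R) \<le> ennreal (\<epsilon> i)" by (intro exI[of _ "(C, U)"]) simp
    qed
    from choice[OF this] obtain P where "\<forall>i. closed (fst (P i)) \<and> open (snd (P i)) \<and> fst (P i) \<subseteq> A i \<and>
      A i \<subseteq> snd (P i) \<and> emeasure \<mu> ((snd (P i) - fst (P i)) \<inter> ball c R) \<le> ennreal (\<epsilon> i)" by (rule exE)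
    then have P: "\<And>i. closed (fst (P i))" "\<And>i. open (snd (P i))"
      "\<And>i. fst (P i) \<subseteq> A i" "\<And>i. A i \<subseteq> snd (P i)"
      "\<And>i. emeasure \<mu> ((snd (P i) - fst (P i)) \<inter> ball c R) \<le> ennreal (\<epsilon> i)" by simp_all
    define U where "U = (\<Union>i. snd (P i))"
    define C where "C n = (\<Union>i\<in>{..n}. fst (P i))" for n
    have U: "open U" unfolding U_def using P(2) by auto
    have C: "closed (C n)" for n unfolding C_def by (rule closed_UN) (auto simp: P(1))
    have "decseq (\<lambda>n. U - C n)"
      by (rule decseq_SucI) (auto simp: C_def)
    moreover have "U - C n \<in> sets borel" for n using U C by auto
    ultimately obtain n where n: "emeasure \<mu> ((U - C n) \<inter> ball c R)
        \<le> emeasure \<mu> ((\<Inter>n. U - C n) \<inter> ball c R) + ennreal (e / 2)"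
      using lim_ex[of "\<lambda>n. U - C n" "e / 2"] Union.prems by auto
    have "emeasure \<mu> ((\<Inter>n. U - C n) \<inter> ball c R) \<le> emeasure \<mu> (\<Union>i. (snd (P i) - fst (P i)) \<inter> ball c R)"
    proof (rule emeasure_mono)
      show "(\<Inter>n. U - C n) \<inter> ball c R \<subseteq> (\<Union>i. (snd (P i) - fst (P i)) \<inter> ball c R)"
        unfolding U_def C_def by blast
      have "(snd (P i) - fst (P i)) \<inter> ball c R \<in> sets borel" for i using P(1,2)[of i] by auto
      then show "(\<Union>i. (snd (P i) - fst (P i)) \<inter> ball c R) \<in> sets \<mu>" unfolding sets_eq by blast
    qed
    also have "\<dots> \<le> (\<Sum>i. emeasure \<mu> ((snd (P i) - fst (P i)) \<inter> ball c R))"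
    proof (rule emeasure_subadditive_countably)
      have "(snd (P i) - fst (P i)) \<inter> ball c R \<in> sets borel" for i using P(1,2)[of i] by auto
      then show "range (\<lambda>i. (snd (P i) - fst (P i)) \<inter> ball c R) \<subseteq> sets \<mu>" unfolding sets_eq by blast
    qed
    also have "\<dots> \<le> (\<Sum>i. ennreal (\<epsilon> i))" by (rule suminf_le) (auto simp: P(5))
    also have "\<dots> = ennreal (e / 2)"
    proof (rule suminf_ennreal_eq)
      show "0 \<le> \<epsilon> i" for i using \<epsilon>[of i] by simp
      show "\<epsilon> sums (e / 2)" unfolding \<epsilon>_def using sums_mult[OF power_half_series, of "e / 2"] by simp
    qed
    finally have "emeasure \<mu> ((U - C n) \<inter> ball c R) \<le> ennreal (e / 2) + ennreal (e / 2)"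
      using n by (meson add_right_mono order_trans)
    also have "\<dots> = ennreal e" using Union.prems by (simp flip: ennreal_plus)
    finally have "emeasure \<mu> ((U - C n) \<inter> ball c R) \<le> ennreal e" .
    moreover have "C n \<subseteq> \<Union> (range A)" "\<Union> (range A) \<subseteq> U" using P(3,4) unfolding C_def U_def by blast+
    ultimately show ?case by (intro exI[of _ "C n"] exI[of _ U]) (simp add: U C)
  qed
qed

lemma outer_regular:
  assumes A: "A \<in> sets borel" "A \<subseteq> ball c R" and e: "0 < (e::real)"
  shows "\<exists>U. open U \<and> A \<subseteq> U \<and> U \<subseteq> ball c R \<and> emeasure \<mu> U \<le> emeasure \<mu> A + ennreal e"
proof -
  from regular[OF A(1) e, of c R] obtain C U where
    "closed C \<and> open U \<and> C \<subseteq> A \<and> A \<subseteq> U \<and> emeasure \<mu> ((U - C) \<inter> ball c R) \<le> ennreal e"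
    by (elim exE)
  then have CU: "closed C" "open U" "C \<subseteq> A" "A \<subseteq> U" "emeasure \<mu> ((U - C) \<inter> ball c R) \<le> ennreal e"
    by simp_all
  have UCm: "(U - C) \<inter> ball c R \<in> sets borel" using CU(1,2) by (intro sets.Int sets.Diff) auto
  have "emeasure \<mu> (U \<inter> ball c R) \<le> emeasure \<mu> (A \<union> (U - C) \<inter> ball c R)"
  proof (rule emeasure_mono)
    show "U \<inter> ball c R \<subseteq> A \<union> (U - C) \<inter> ball c R" using CU(3) by blast
    show "A \<union> (U - C) \<inter> ball c R \<in> sets \<mu>" unfolding sets_eq by (rule sets.Un[OF A(1) UCm])
  qed
  also have "\<dots> \<le> emeasure \<mu> A + emeasure \<mu> ((U - C) \<inter> ball c R)"
    by (rule emeasure_subadditive) (simp_all add: sets_eq A(1) UCm)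
  also have "\<dots> \<le> emeasure \<mu> A + ennreal e" by (intro add_left_mono CU)
  finally show ?thesis using CU(2,4) A(2) by (intro exI[of _ "U \<inter> ball c R"] conjI open_Int open_ball Int_greatest Int_lower2)
qed

text \<open>A layer decomposition: \<open>f\<close> is approximated by \<open>e\<close> times the
  number of superlevel sets containing a point, each of these sets is enlarged to an open set, and
  the indicator of an open set is an increasing limit of truncated multiples of the distance to its
  complement.\<close>

lemma vitali_caratheodory:
  assumes fm: "f \<in> borel_measurable borel" and f0: "\<And>z. z \<notin> ball c R \<Longrightarrow> f z = 0" and R: "0 < R" and \<eta>: "0 < (\<eta>::real)"
  obtains \<phi> :: "nat \<Rightarrow> 'a \<Rightarrow> real" where "\<And>n. continuous_on UNIV (\<phi> n)" "\<And>n z. 0 \<le> \<phi> n z"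
    "\<And>k n z. k \<le> n \<Longrightarrow> \<phi> k z \<le> \<phi> n z" "\<And>n. \<exists>K. \<forall>z. \<phi> n z \<le> K"
    "\<And>z. f z \<le> (SUP n. ennreal (\<phi> n z))"
    "(\<integral>\<^sup>+z. (SUP n. ennreal (\<phi> n z)) \<partial>\<mu>) \<le> (\<integral>\<^sup>+z. f z \<partial>\<mu>) + ennreal \<eta>"
proof -
  have Vp: "0 < V c R" by (rule V_pos[OF R])
  \<comment> \<open>Rounding \<open>f\<close> up to multiples of \<open>e\<close> costs at most
    \<open>e * V c R\<close>, and enlarging the layers costs the same; together this is
    \<open>\<eta>\<close>.\<close>
  define e where "e = \<eta> / (2 * V c R)"
  have e: "0 < e" using \<eta> Vp by (simp add: e_def)
  define A where "A k = {z. ennreal (e * real k) < f z}" for k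
  have Am[measurable]: "A k \<in> sets borel" for k unfolding A_def using fm by measurable
  have AB: "A k \<subseteq> ball c R" for k
  proof
    fix z assume "z \<in> A k"
    then have "f z \<noteq> 0" by (auto simp: A_def)
    then show "z \<in> ball c R" using f0 by blast
  qed
  define \<epsilon> where "\<epsilon> k = V c R * (1 / 2) ^ Suc k" for k
  have \<epsilon>: "0 < \<epsilon> k" for k using Vp by (simp add: \<epsilon>_def)
  have "\<forall>k. \<exists>U. open U \<and> A k \<subseteq> U \<and> U \<subseteq> ball c R \<and> emeasure \<mu> U \<le> emeasure \<mu> (A k) + ennreal (\<epsilon> k)"
    by (intro allI outer_regular Am AB \<epsilon>)
  from choice[OF this] obtain U where
    "\<forall>k. open (U k) \<and> A k \<subseteq> U k \<and> U k \<subseteq> ball c R \<and> emeasure \<mu> (U k) \<le> emeasure \<mu> (A k) + ennreal (\<epsilon> k)"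
    by (rule exE)
  then have U: "\<And>k. open (U k)" "\<And>k. A k \<subseteq> U k" "\<And>k. U k \<subseteq> ball c R"
    "\<And>k. emeasure \<mu> (U k) \<le> emeasure \<mu> (A k) + ennreal (\<epsilon> k)" by simp_all
  have [measurable]: "U k \<in> sets borel" for k using U(1) by auto
  \<comment> \<open>If \<open>U k\<close> is the whole space, \<open>infdist\<close> to its empty
    complement would be 0, so 1 is used instead.\<close>
  define d where "d k z = (if - U k = {} then 1 else infdist z (- U k))" for k z
  have d0: "0 \<le> d k z" for k z by (simp add: d_def infdist_nonneg)
  have dpos: "0 < d k z" if "z \<in> U k" for k z
  proof (cases "- U k = {}")
    case False
    have "closed (- U k)" using U(1) by auto
    then have "infdist z (- U k) \<noteq> 0" using in_closed_iff_infdist_zero[of "- U k" z] False that by auto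
    then show ?thesis using infdist_nonneg[of z "- U k"] False by (simp add: d_def)
  qed (simp add: d_def)
  have dzero: "d k z = 0" if "z \<notin> U k" for k z using that by (auto simp: d_def)
  have dc: "continuous_on UNIV (d k)" for k
    unfolding d_def by (cases "- U k = {}") (auto intro!: continuous_intros)
  define \<phi> where "\<phi> n z = (\<Sum>k<n. e * min 1 (real n * d k z))" for n z
  define H where "H z = (\<Sum>k. ennreal e * indicator (U k) z)" for z
  have \<phi>H: "ennreal (\<phi> n z) \<le> H z" for n z
  proof -
    have "ennreal (\<phi> n z) = (\<Sum>k<n. ennreal (e * min 1 (real n * d k z)))"
      unfolding \<phi>_def using e d0 by (intro sum_ennreal[symmetric]) auto
    also have "\<dots> \<le> (\<Sum>k<n. ennreal e * indicator (U k) z)"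
    proof (rule sum_mono)
      fix k
      show "ennreal (e * min 1 (real n * d k z)) \<le> ennreal e * indicator (U k) z"
        using e dzero[of z k] by (cases "z \<in> U k") (auto intro!: ennreal_leI)
    qed
    also have "\<dots> \<le> H z" unfolding H_def by (rule sum_le_suminf) auto
    finally show ?thesis .
  qed
  have Hle: "H z \<le> (SUP n. ennreal (\<phi> n z))" for z
    unfolding H_def suminf_eq_SUP
  proof (rule SUP_least)
    fix m
    \<comment> \<open>Finitely many layers are given; \<open>n\<close> must exceed their number and
      be steep enough for all of them at the point \<open>z\<close>. A sum of the individual
      thresholds dominates each.\<close>
    have ex: "\<exists>n\<ge>m. \<forall>k<m. z \<in> U k \<longrightarrow> 1 \<le> real n * d k z"
    proof -
      have "\<forall>k. \<exists>n::nat. z \<in> U k \<longrightarrow> 1 \<le> real n * d k z"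
      proof
        fix k
        show "\<exists>n::nat. z \<in> U k \<longrightarrow> 1 \<le> real n * d k z"
        proof (cases "z \<in> U k")
          case True
          obtain n :: nat where "1 / d k z < real n" using reals_Archimedean2 by blast
          then show ?thesis using dpos[OF True] by (intro exI[of _ n]) (simp add: field_simps)
        qed simp
      qed
      from choice[OF this] obtain N where N: "\<And>k. z \<in> U k \<Longrightarrow> 1 \<le> real (N k) * d k z" by blast
      define n where "n = m + (\<Sum>k<m. N k)"
      have "1 \<le> real n * d k z" if k: "k < m" "z \<in> U k" for k
      proof -
        have "N k \<le> (\<Sum>k<m. N k)" by (rule member_le_sum) (use k in auto)
        then have "N k \<le> n" by (simp add: n_def)
        then have "real (N k) \<le> real n" by (rule of_nat_mono)
        then have "real (N k) * d k z \<le> real n * d k z" by (rule mult_right_mono[OF _ d0])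
        then show ?thesis using N[OF k(2)] by simp
      qed
      then show ?thesis by (intro exI[of _ n]) (simp add: n_def)
    qed
    then obtain n where n: "m \<le> n" "\<And>k. k < m \<Longrightarrow> z \<in> U k \<Longrightarrow> 1 \<le> real n * d k z" by blast
    have "(\<Sum>k<m. ennreal e * indicator (U k) z) \<le> (\<Sum>k<m. ennreal (e * min 1 (real n * d k z)))"
    proof (rule sum_mono)
      fix k assume "k \<in> {..<m}"
      then show "ennreal e * indicator (U k) z \<le> ennreal (e * min 1 (real n * d k z))"
        using n(2)[of k] by (cases "z \<in> U k") auto
    qed
    also have "\<dots> \<le> (\<Sum>k<n. ennreal (e * min 1 (real n * d k z)))" by (rule sum_mono2) (use n in auto)
    also have "\<dots> = ennreal (\<phi> n z)" unfolding \<phi>_def using e d0 by (intro sum_ennreal) auto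
    also have "\<dots> \<le> (SUP n. ennreal (\<phi> n z))" by (rule SUP_upper) simp
    finally show "(\<Sum>k<m. ennreal e * indicator (U k) z) \<le> (SUP n. ennreal (\<phi> n z))" .
  qed
  have layer: "f z \<le> (\<Sum>k. ennreal e * indicator (A k) z) \<and>
      (\<Sum>k. ennreal e * indicator (A k) z) \<le> f z + ennreal e * indicator (ball c R) z" for z
  proof (cases "f z")
    case top
    have "(\<Sum>k. ennreal e * indicator (A k) z) = (\<Sum>k. ennreal e)"
      by (rule suminf_cong) (auto simp: A_def top)
    also have "\<dots> = top"
    proof (rule ccontr)
      assume "(\<Sum>k::nat. ennreal e) \<noteq> top"
      then obtain x where x: "(\<Sum>k::nat. ennreal e) = ennreal x" "0 \<le> x"
        by (cases "\<Sum>k::nat. ennreal e") auto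
      obtain n :: nat where n: "x / e < real n" using reals_Archimedean2 by blast
      have "(\<Sum>k<n. ennreal e) \<le> ennreal x" unfolding x(1)[symmetric] by (rule sum_le_suminf) auto
      moreover have "(\<Sum>k<n. ennreal e) = ennreal (real n * e)"
        using e by (simp add: ennreal_of_nat_eq_real_of_nat ennreal_mult)
      ultimately have "real n * e \<le> x" using x(2) by (simp add: ennreal_le_iff)
      then show False using n e by (simp add: field_simps)
    qed
    finally show ?thesis by (simp add: top)
  next
    case (real a)
    define K where "K = nat \<lceil>a / e\<rceil>"
    have in_iff: "z \<in> A k \<longleftrightarrow> k < K" for k
    proof -
      have "z \<in> A k \<longleftrightarrow> e * real k < a" using real e by (simp add: A_def ennreal_less_iff)
      also have "\<dots> \<longleftrightarrow> real k < a / e" using e by (simp add: field_simps)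
      also have "\<dots> \<longleftrightarrow> k < K" unfolding K_def by (simp add: zless_nat_eq_int_zless less_ceiling_iff)
      finally show ?thesis .
    qed
    have "(\<Sum>k. ennreal e * indicator (A k) z) = (\<Sum>k<K. ennreal e * indicator (A k) z)"
      by (rule suminf_finite) (auto simp: in_iff)
    also have "\<dots> = (\<Sum>k<K. ennreal e)" by (rule sum.cong) (auto simp: in_iff)
    also have "\<dots> = ennreal (real K * e)" using e by (simp add: ennreal_of_nat_eq_real_of_nat ennreal_mult)
    finally have S: "(\<Sum>k. ennreal e * indicator (A k) z) = ennreal (real K * e)" .
    have "0 \<le> a / e" using real e by simp
    then have "a / e \<le> real K" "real K < a / e + 1" unfolding K_def by linarith+
    then have K: "a \<le> real K * e" "real K * e \<le> a + e" using e by (simp_all add: field_simps)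
    have upper: "ennreal (real K * e) \<le> f z + ennreal e * indicator (ball c R) z"
    proof (cases "z \<in> ball c R")
      case True
      then show ?thesis using K(2) real e by (simp flip: ennreal_plus)
    next
      case False
      then have "a = 0" using f0[OF False] real by simp
      then show ?thesis by (simp add: K_def)
    qed
    show ?thesis unfolding S using upper K(1) real by (simp add: ennreal_leI)
  qed
  have Hm: "H \<in> borel_measurable borel" unfolding H_def by measurable
  have "(\<integral>\<^sup>+z. H z \<partial>\<mu>) = (\<Sum>k. ennreal e * emeasure \<mu> (U k))"
    unfolding H_def by (subst nn_integral_suminf) (auto simp: nn_integral_cmult_indicator sets_eq)
  also have "\<dots> \<le> (\<Sum>k. ennreal e * emeasure \<mu> (A k) + ennreal e * ennreal (\<epsilon> k))"
    using U(4) by (intro suminf_le) (auto simp flip: distrib_left intro: mult_left_mono)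
  also have "\<dots> = (\<Sum>k. ennreal e * emeasure \<mu> (A k)) + (\<Sum>k. ennreal e * ennreal (\<epsilon> k))"
    by (rule suminf_add[symmetric]) auto
  also have "(\<Sum>k. ennreal e * emeasure \<mu> (A k)) = (\<integral>\<^sup>+z. (\<Sum>k. ennreal e * indicator (A k) z) \<partial>\<mu>)"
    by (subst nn_integral_suminf) (auto simp: nn_integral_cmult_indicator sets_eq)
  also have "\<dots> \<le> (\<integral>\<^sup>+z. f z + ennreal e * indicator (ball c R) z \<partial>\<mu>)"
    by (rule nn_integral_mono) (use layer in blast)
  also have "\<dots> = (\<integral>\<^sup>+z. f z \<partial>\<mu>) + ennreal (e * V c R)"
    using fm e R by (subst nn_integral_add) (auto simp: nn_integral_cmult_indicator sets_eq emeasure_ball ennreal_mult)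
  also have "(\<Sum>k. ennreal e * ennreal (\<epsilon> k)) = ennreal (e * V c R)"
  proof -
    have "(\<lambda>k. e * \<epsilon> k) sums (e * V c R)"
      unfolding \<epsilon>_def using sums_mult[OF sums_mult[OF power_half_series, of "V c R"], of e] by simp
    then have "(\<Sum>k. ennreal (e * \<epsilon> k)) = ennreal (e * V c R)"
      by (rule suminf_ennreal_eq[rotated]) (use e \<epsilon> in \<open>simp add: less_imp_le\<close>)
    then show ?thesis using e \<epsilon> by (simp add: ennreal_mult less_imp_le)
  qed
  finally have Hint: "(\<integral>\<^sup>+z. H z \<partial>\<mu>) \<le> (\<integral>\<^sup>+z. f z \<partial>\<mu>) + ennreal (e * V c R) + ennreal (e * V c R)"
    by (auto intro: add_right_mono)
  also have "\<dots> = (\<integral>\<^sup>+z. f z \<partial>\<mu>) + ennreal \<eta>"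
  proof -
    have "e * V c R = \<eta> / 2" using Vp by (simp add: e_def)
    moreover have "ennreal (\<eta> / 2) + ennreal (\<eta> / 2) = ennreal \<eta>"
      using ennreal_plus[of "\<eta> / 2" "\<eta> / 2"] \<eta> by simp
    ultimately show ?thesis by (simp only: add.assoc)
  qed
  finally have Hint: "(\<integral>\<^sup>+z. H z \<partial>\<mu>) \<le> (\<integral>\<^sup>+z. f z \<partial>\<mu>) + ennreal \<eta>" .
  show ?thesis
  proof (rule that)
    show "continuous_on UNIV (\<phi> n)" for n unfolding \<phi>_def by (intro continuous_intros dc)
    show "0 \<le> \<phi> n z" for n z unfolding \<phi>_def using e d0 by (intro sum_nonneg) auto
    show "\<phi> k z \<le> \<phi> n z" if "k \<le> n" for k n z
    proof -
      have "\<phi> k z \<le> (\<Sum>i<k. e * min 1 (real n * d i z))"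
        unfolding \<phi>_def using e that d0 by (intro sum_mono mult_left_mono min.mono mult_right_mono) auto
      also have "\<dots> \<le> \<phi> n z" unfolding \<phi>_def by (rule sum_mono2) (use that e d0 in auto)
      finally show ?thesis .
    qed
    show "\<exists>K. \<forall>z. \<phi> n z \<le> K" for n
    proof (intro exI[of _ "\<Sum>k<n. e"] allI)
      show "\<phi> n z \<le> (\<Sum>k<n. e)" for z unfolding \<phi>_def using e by (intro sum_mono) auto
    qed
    show "f z \<le> (SUP n. ennreal (\<phi> n z))" for z
    proof -
      have "f z \<le> (\<Sum>k. ennreal e * indicator (A k) z)" using layer by blast
      also have "\<dots> \<le> H z" unfolding H_def
        by (rule suminf_le) (use U(2) in \<open>auto simp: indicator_def\<close>)
      also have "\<dots> \<le> (SUP n. ennreal (\<phi> n z))" by (rule Hle)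
      finally show ?thesis .
    qed
    have "(\<integral>\<^sup>+z. (SUP n. ennreal (\<phi> n z)) \<partial>\<mu>) \<le> (\<integral>\<^sup>+z. H z \<partial>\<mu>)"
      by (intro nn_integral_mono SUP_least \<phi>H)
    then show "(\<integral>\<^sup>+z. (SUP n. ennreal (\<phi> n z)) \<partial>\<mu>) \<le> (\<integral>\<^sup>+z. f z \<partial>\<mu>) + ennreal \<eta>" using Hint by (rule order_trans)
  qed
qed

lemma ball_integral_le_of_good:
  assumes "good f \<Lambda> z" "0 < r" "z \<in> ball c r"
    and [measurable]: "f \<in> borel_measurable borel" and "\<And>y. g y \<le> a * (f y + b)"
  shows "(\<integral>\<^sup>+y\<in>ball c r. g y \<partial>\<mu>) \<le> a * (\<Lambda> + b) * emeasure \<mu> (ball c r)"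
proof -
  have "(\<integral>\<^sup>+y\<in>ball c r. g y \<partial>\<mu>) \<le> (\<integral>\<^sup>+y. a * (f y * indicator (ball c r) y + b * indicator (ball c r) y) \<partial>\<mu>)"
    by (rule nn_integral_mono) (use assms(5) in \<open>auto simp: indicator_def\<close>)
  also have "\<dots> = a * ((\<integral>\<^sup>+y\<in>ball c r. f y \<partial>\<mu>) + b * emeasure \<mu> (ball c r))"
    by (subst nn_integral_cmult, measurable, subst nn_integral_add) (auto simp: nn_integral_cmult_indicator sets_eq)
  also have "\<dots> \<le> a * (\<Lambda> * emeasure \<mu> (ball c r) + b * emeasure \<mu> (ball c r))"
    by (intro mult_left_mono add_right_mono goodD[OF assms(1-3)]) auto
  finally show ?thesis by (simp add: distrib_right mult.assoc)
qed

lemma improved_poincare: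
  assumes p: "1 < p" and PI: "weak_poincare \<mu> p"
  obtains \<Lambda> q0 where "1 \<le> \<Lambda>" "1 \<le> q0" "q0 < p"
    "\<And>\<theta>. 0 < \<theta> \<Longrightarrow> \<exists>C>0. \<forall>q u g c r s. q0 < q \<longrightarrow> q < p \<longrightarrow> (\<exists>L. L-lipschitz_on UNIV u) \<longrightarrow>
       upper_gradient_on UNIV u g \<longrightarrow> 0 < r \<longrightarrow> 0 < s \<longrightarrow>
       (\<integral>\<^sup>+y\<in>ball c (\<Lambda> * r). epowr (g y) q \<partial>\<mu>) \<le> ennreal (s powr q) * emeasure \<mu> (ball c r) \<longrightarrow>
       (\<exists>G\<in>sets borel. G \<subseteq> ball c r \<and> emeasure \<mu> (ball c r - G) \<le> ennreal \<theta> * emeasure \<mu> (ball c r) \<and>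
          (\<forall>z\<in>G. \<forall>z'\<in>G. \<bar>u z - u z'\<bar> \<le> C * s * r))"
proof -
  obtain A q0 where A: "0 < A" and q0: "1 \<le> q0" "q0 < p" and SI:
    "\<And>q u g \<kappa> K L. q0 < q \<Longrightarrow> q < p \<Longrightarrow> L-lipschitz_on UNIV u \<Longrightarrow>
       upper_gradient_on UNIV u (\<lambda>z. ennreal (g z)) \<Longrightarrow> continuous_on UNIV g \<Longrightarrow> 0 < \<kappa> \<Longrightarrow>
       (\<And>z. \<kappa> \<le> g z) \<Longrightarrow> (\<And>z. g z \<le> K) \<Longrightarrow> pointwise_bound q u g A"
    using self_improvement_continuous[OF p PI] by blast
  \<comment> \<open>The width of the annulus for the cut-off. The term it contributes in the end is
    \<open>8 * A * h / (\<Lambda> - 1)\<close>, which equals \<open>h / 2\<close>.\<close>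
  define \<Lambda> where "\<Lambda> = 1 + 16 * A"
  have \<Lambda>1: "1 < \<Lambda>" using A by (simp add: \<Lambda>_def)
  have D0: "0 < D" using D_ge_1 by simp
  show ?thesis
  proof (rule that[of \<Lambda> q0])
    fix \<theta> :: real assume \<theta>: "0 < \<theta>"
    \<comment> \<open>The level at which the weak type estimate leaves a bad set of relative measure
      at most \<open>\<theta>\<close>: \<open>D ^ 2\<close> is its constant, and 2 comes from the
      approximation of the gradient. The lower bound 1 gives
      \<open>M \<le> M powr q\<close>.\<close>
    define M where "M = max 1 (2 * D ^ 2 / \<theta>)"
    have M1: "1 \<le> M" by (simp add: M_def)
    have M\<theta>: "2 * D ^ 2 \<le> \<theta> * M"
    proof -
      have "2 * D ^ 2 / \<theta> \<le> M" by (simp add: M_def)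
      then show ?thesis using \<theta> by (simp add: field_simps)
    qed
    show "\<exists>C>0. \<forall>q u g c r s. q0 < q \<longrightarrow> q < p \<longrightarrow> (\<exists>L. L-lipschitz_on UNIV u) \<longrightarrow>
       upper_gradient_on UNIV u g \<longrightarrow> 0 < r \<longrightarrow> 0 < s \<longrightarrow>
       (\<integral>\<^sup>+y\<in>ball c (\<Lambda> * r). epowr (g y) q \<partial>\<mu>) \<le> ennreal (s powr q) * emeasure \<mu> (ball c r) \<longrightarrow>
       (\<exists>G\<in>sets borel. G \<subseteq> ball c r \<and> emeasure \<mu> (ball c r - G) \<le> ennreal \<theta> * emeasure \<mu> (ball c r) \<and>
          (\<forall>z\<in>G. \<forall>z'\<in>G. \<bar>u z - u z'\<bar> \<le> C * s * r))"
    proof (intro exI[of _ "16 * A * M"] conjI allI impI)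
      show "0 < 16 * A * M" using A M1 by simp
      fix q and u :: "'a \<Rightarrow> real" and g c and r s :: real
      assume q: "q0 < q" "q < p" and "\<exists>L. L-lipschitz_on UNIV u" and ug: "upper_gradient_on UNIV u g"
        and r: "0 < r" and s: "0 < s"
        and int: "(\<integral>\<^sup>+y\<in>ball c (\<Lambda> * r). epowr (g y) q \<partial>\<mu>) \<le> ennreal (s powr q) * emeasure \<mu> (ball c r)"
      obtain L where L: "L-lipschitz_on UNIV u" using \<open>\<exists>L. L-lipschitz_on UNIV u\<close> by blast
      have q1: "1 < q" using q q0 by simp
      let ?B = "ball c (\<Lambda> * r)"
      have \<Lambda>r: "0 < \<Lambda> * r" using \<Lambda>1 r by simp
      have gm[measurable]: "g \<in> borel_measurable borel" using ug by (simp add: upper_gradient_on_def)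
      define f where "f y = epowr (g y) q * indicator ?B y" for y
      have fm: "f \<in> borel_measurable borel" unfolding f_def by measurable
      \<comment> \<open>The admissible error equals the given bound for the integral, so the
        approximation merely doubles it.\<close>
      have \<eta>: "0 < s powr q * V c r" using s V_pos[OF r, of c] by simp
      obtain \<phi> :: "nat \<Rightarrow> 'a \<Rightarrow> real" where \<phi>: "\<And>n. continuous_on UNIV (\<phi> n)" "\<And>n z. 0 \<le> \<phi> n z"
        "\<And>k n z. k \<le> n \<Longrightarrow> \<phi> k z \<le> \<phi> n z" "\<And>n. \<exists>K. \<forall>z. \<phi> n z \<le> K"
        "\<And>z. f z \<le> (SUP n. ennreal (\<phi> n z))"
        "(\<integral>\<^sup>+z. (SUP n. ennreal (\<phi> n z)) \<partial>\<mu>) \<le> (\<integral>\<^sup>+z. f z \<partial>\<mu>) + ennreal (s powr q * V c r)"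
        using vitali_caratheodory[OF fm _ \<Lambda>r \<eta>, of c] by (auto simp: f_def)
      define H where "H z = (SUP n. ennreal (\<phi> n z))" for z
      have [measurable]: "\<phi> n \<in> borel_measurable borel" for n by (rule borel_measurable_continuous_onI[OF \<phi>(1)])
      have Hm: "H \<in> borel_measurable borel" unfolding H_def by measurable
      have Hint: "(\<integral>\<^sup>+z. H z \<partial>\<mu>) \<le> ennreal (2 * (s powr q * V c r))"
      proof -
        have "(\<integral>\<^sup>+z. H z \<partial>\<mu>) \<le> ennreal (s powr q) * emeasure \<mu> (ball c r) + ennreal (s powr q * V c r)"
          using \<phi>(6) int unfolding H_def f_def by (meson add_right_mono order_trans)
        also have "\<dots> = ennreal (s powr q * V c r) + ennreal (s powr q * V c r)"
          using r by (simp add: emeasure_ball ennreal_mult)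
        also have "\<dots> = ennreal (s powr q * V c r + s powr q * V c r)" by (rule ennreal_plus[symmetric]) auto
        finally show ?thesis by simp
      qed
      define b where "b = ennreal (M * s powr q)"
      define G where "G = ball c r \<inter> {z. good H b z}"
      have Gm: "G \<in> sets borel" unfolding G_def by (simp add: sets.Int borel_closed[OF closed_good])
      have "emeasure \<mu> (ball c r - G) \<le> ennreal \<theta> * emeasure \<mu> (ball c r)"
      proof -
        have E: "ball c r - G = ball c r \<inter> {z. \<not> good H b z}" by (auto simp: G_def)
        have "b * emeasure \<mu> (ball c r \<inter> {z. \<not> good H b z}) \<le> ennreal (D ^ 2) * (\<integral>\<^sup>+y\<in>UNIV. H y \<partial>\<mu>)"
        proof (rule weak_type_open[OF Hm, of _ c r])
          fix z assume "z \<in> ball c r \<inter> {z. \<not> good H b z}"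
          then show "\<exists>c r. 0 < r \<and> z \<in> ball c r \<and> ball c r \<subseteq> UNIV \<and>
             b * emeasure \<mu> (ball c r) \<le> (\<integral>\<^sup>+y\<in>ball c r. H y \<partial>\<mu>)"
            unfolding good_def using less_imp_le not_le by blast
        qed (auto intro: open_Int open_not_good)
        also have "\<dots> \<le> ennreal (D ^ 2) * ennreal (2 * (s powr q * V c r))"
          using Hint by (intro mult_left_mono) auto
        also have "\<dots> = ennreal (2 * D ^ 2 * (s powr q * V c r))"
          using D0 by (simp add: ennreal_mult[symmetric] ac_simps)
        also have "\<dots> \<le> ennreal (\<theta> * M * (s powr q * V c r))"
          by (intro ennreal_leI mult_right_mono M\<theta>) auto
        also have "\<dots> = b * (ennreal \<theta> * emeasure \<mu> (ball c r))"
          unfolding b_def using \<theta> M1 r by (simp add: emeasure_ball ennreal_mult[symmetric] ac_simps)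
        finally have "b * emeasure \<mu> (ball c r \<inter> {z. \<not> good H b z}) \<le> b * (ennreal \<theta> * emeasure \<mu> (ball c r))" .
        moreover have "b \<noteq> 0" "b \<noteq> top" using M1 s by (auto simp: b_def)
        ultimately show ?thesis unfolding E by (simp add: ennreal_mult_le_mult_iff)
      qed
      moreover have le: "u z' - u z \<le> 16 * A * M * s * r" if zG: "z \<in> G" "z' \<in> G" for z z'
      proof (rule ccontr)
        assume neg: "\<not> u z' - u z \<le> 16 * A * M * s * r"
        define h where "h = u z' - u z"
        have "0 \<le> 16 * A * M * s * r" using A M1 s r by simp
        moreover have "16 * A * M * s * r < h" using neg unfolding h_def by linarith
        ultimately have h: "0 < h" "16 * A * M * s * r < h" by linarith+
        \<comment> \<open>The slope of a cut-off that falls from \<open>h\<close> to 0 across the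
          annulus between the radii \<open>r\<close> and \<open>\<Lambda> * r\<close>.\<close>
        define C' where "C' = h / ((\<Lambda> - 1) * r)"
        have C'0: "0 < C'" using h \<Lambda>1 r by (simp add: C'_def)
        define \<psi> where "\<psi> y = max 0 (min h (C' * (\<Lambda> * r - dist c y)))" for y
        \<comment> \<open>Truncation at height \<open>h\<close> preserves the difference
          \<open>h\<close> between \<open>z\<close> and \<open>z'\<close>, while the cut-off makes
          \<open>v\<close> vanish outside the large ball.\<close>
        define v where "v y = min (max (u y - u z) 0) (\<psi> y)" for y
        have \<psi>lip: "\<bar>\<psi> x - \<psi> y\<bar> \<le> C' * dist x y" for x y
        proof -
          have "\<bar>\<psi> x - \<psi> y\<bar> \<le> \<bar>C' * (\<Lambda> * r - dist c x) - C' * (\<Lambda> * r - dist c y)\<bar>" by (auto simp: \<psi>_def)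
          also have "\<dots> = C' * \<bar>dist c y - dist c x\<bar>" using C'0 by (simp add: right_diff_distrib[symmetric] abs_mult)
          also have "\<dots> \<le> C' * dist x y"
            using C'0 abs_dist_diff_le[of x c y] by (intro mult_left_mono) (auto simp: dist_commute abs_minus_commute)
          finally show ?thesis .
        qed
        have \<psi>B: "\<psi> y = h" if "y \<in> ball c r" for y
        proof -
          have "C' * ((\<Lambda> - 1) * r) \<le> C' * (\<Lambda> * r - dist c y)"
            using that C'0 by (intro mult_left_mono) (auto simp: algebra_simps)
          moreover have "C' * ((\<Lambda> - 1) * r) = h" using \<Lambda>1 r by (simp add: C'_def)
          ultimately show ?thesis using h by (simp add: \<psi>_def)
        qed
        have v0: "v y = 0" if "y \<notin> ?B" for y
        proof -
          have "C' * (\<Lambda> * r - dist c y) \<le> 0" using that C'0 by (simp add: mult_le_0_iff)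
          then show ?thesis using h by (simp add: v_def \<psi>_def)
        qed
        have vz: "v z = 0" "v z' = h" using \<psi>B[of z] \<psi>B[of z'] zG h by (auto simp: v_def G_def h_def)
        have vle: "\<bar>v x - v y\<bar> \<le> \<bar>u x - u y\<bar> + C' * dist x y" for x y
          using \<psi>lip[of x y] unfolding v_def by linarith
        have "upper_gradient_on UNIV v (\<lambda>y. g y + ennreal C')"
          by (rule upper_gradient_add_lipschitz[OF ug _ vle]) (use C'0 in simp)
        then have ugB: "upper_gradient_on ?B v (\<lambda>y. g y + ennreal C')"
          by (auto simp: upper_gradient_on_def)
        have vc: "continuous_on UNIV v"
        proof (rule lipschitz_on_continuous_on)
          show "(L + C')-lipschitz_on UNIV v"
          proof (rule lipschitz_onI)
            fix x y
            show "dist (v x) (v y) \<le> (L + C') * dist x y"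
              using vle[of x y] lipschitz_onD[OF L, of x y] by (simp add: dist_real_def algebra_simps)
          qed (use lipschitz_on_nonneg[OF L] C'0 in simp)
        qed
        have ugv: "upper_gradient_on UNIV v (\<lambda>y. (g y + ennreal C') * indicator ?B y)"
          by (rule upper_gradient_zero_extension[OF ugB _ vc v0]) auto
        \<comment> \<open>From approximations of the \<open>q\<close>-th power back to
          approximations of the gradient. The added cut-off slope is at the same time the positive
          lower bound required by the self-improvement.\<close>
        define gn where "gn n y = \<phi> n y powr (1 / q) + C'" for n y
        have dom: "(g y + ennreal C') * indicator ?B y \<le> (SUP n. ennreal (gn n y))" for y
        proof (cases "y \<in> ?B")
          case True
          show ?thesis
          proof (cases "(SUP n. ennreal (gn n y))")
            case top
            show ?thesis unfolding top by (rule top_greatest)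
          next
            case (real m)
            have gm: "gn n y \<le> m" for n
            proof -
              have "ennreal (gn n y) \<le> ennreal m" unfolding real(2)[symmetric] by (rule SUP_upper) simp
              then show ?thesis using real(1) by (simp add: ennreal_le_iff)
            qed
            \<comment> \<open>A finite supremum \<open>m\<close> bounds every \<open>gn n y\<close>.
              Undoing the shift and the root bounds \<open>H y\<close>, hence the
              \<open>q\<close>-th power of \<open>g y\<close>, by
              \<open>(m - C') powr q\<close>.\<close>
            have m: "C' \<le> m" using gm[of 0] by (simp add: gn_def add_nonneg_nonneg) (metis add_increasing powr_ge_zero order_trans order_refl)
            have "ennreal (\<phi> n y) \<le> ennreal ((m - C') powr q)" for n
            proof (rule ennreal_leI)
              have "\<phi> n y = (\<phi> n y powr (1 / q)) powr q" using \<phi>(2)[of n y] q1 by (simp add: powr_powr)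
              also have "\<dots> \<le> (m - C') powr q" using gm[of n] q1 by (intro powr_mono2) (auto simp: gn_def)
              finally show "\<phi> n y \<le> (m - C') powr q" .
            qed
            then have "H y \<le> ennreal ((m - C') powr q)" unfolding H_def by (rule SUP_least)
            then have gle: "epowr (g y) q \<le> ennreal ((m - C') powr q)"
              using \<phi>(5)[of y] True unfolding H_def f_def by simp
            have "g y \<le> ennreal (m - C')"
            proof (cases "g y")
              case top
              then show ?thesis using gle by (simp add: epowr_def top_unique)
            next
              case (real a)
              then have "a powr q \<le> (m - C') powr q" using gle by (simp add: epowr_ennreal)
              then have "a \<le> m - C'" using m real q1
                by (metis diff_ge_0_iff_ge less_imp_le linorder_not_le order_less_trans powr_less_mono2 zero_less_one)
              then show ?thesis using real by (simp add: ennreal_leI)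
            qed
            then have "g y + ennreal C' \<le> ennreal (m - C') + ennreal C'" by (rule add_right_mono)
            also have "\<dots> = ennreal m" using m C'0 by (simp flip: ennreal_plus)
            finally show ?thesis using True real by simp
          qed
        qed simp
        have gnc: "continuous_on UNIV (gn n)" for n
          unfolding gn_def using q1 by (intro continuous_intros continuous_on_powr' \<phi>) (auto simp: \<phi>)
        have gnmono: "gn k y \<le> gn n y" if "k \<le> n" for k n y
          unfolding gn_def using \<phi>(2,3) that q1 by (intro add_right_mono powr_mono2) auto
        have gnC: "C' \<le> gn n y" for n y by (simp add: gn_def)
        have "\<exists>K. \<forall>y. gn n y \<le> K" for n
        proof -
          obtain K where K: "\<And>y. \<phi> n y \<le> K" using \<phi>(4)[of n] by blast
          have "gn n y \<le> K powr (1 / q) + C'" for y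
            unfolding gn_def using \<phi>(2) K q1 by (intro add_right_mono powr_mono2) auto
          then show ?thesis by blast
        qed
        then obtain K where K: "\<And>n y. gn n y \<le> K n" by metis
        \<comment> \<open>One factor 2 comes from the \<open>q\<close>-th power of the sum in
          \<open>gn\<close>, the other from merging two \<open>q\<close>-th powers into one.\<close>
        define \<sigma> where "\<sigma> = 2 * (2 * (M * s + C'))"
        have \<sigma>0: "0 \<le> \<sigma>" using M1 s C'0 by (simp add: \<sigma>_def)
        have goodn: "good (\<lambda>y. ennreal (gn n y powr q)) (ennreal (\<sigma> powr q)) w" if "w \<in> G" for n w
          unfolding good_def
        proof (intro allI impI)
          fix c' r' assume r': "0 < (r'::real)" "w \<in> ball c' r'"
          have "(\<integral>\<^sup>+y\<in>ball c' r'. ennreal (gn n y powr q) \<partial>\<mu>)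
            \<le> ennreal (2 powr q) * (b + ennreal (C' powr q)) * emeasure \<mu> (ball c' r')"
          proof (rule ball_integral_le_of_good[OF _ r' Hm])
            show "good H b w" using that by (simp add: G_def)
            fix y
            have "gn n y powr q \<le> 2 powr q * ((\<phi> n y powr (1 / q)) powr q + C' powr q)"
              unfolding gn_def using C'0 q1 by (intro powr_add_le) auto
            also have "(\<phi> n y powr (1 / q)) powr q = \<phi> n y" using \<phi>(2)[of n y] q1 by (simp add: powr_powr)
            finally have "ennreal (gn n y powr q) \<le> ennreal (2 powr q * (\<phi> n y + C' powr q))" by (rule ennreal_leI)
            also have "\<dots> = ennreal (2 powr q) * (ennreal (\<phi> n y) + ennreal (C' powr q))"
              using \<phi>(2)[of n y] by (simp add: ennreal_mult)
            also have "\<dots> \<le> ennreal (2 powr q) * (H y + ennreal (C' powr q))"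
              unfolding H_def by (intro mult_left_mono add_right_mono SUP_upper) auto
            finally show "ennreal (gn n y powr q) \<le> ennreal (2 powr q) * (H y + ennreal (C' powr q))" .
          qed
          also have "\<dots> \<le> ennreal (\<sigma> powr q) * emeasure \<mu> (ball c' r')"
          proof (rule mult_right_mono)
            have "M \<le> M powr q" using powr_mono[of 1 q M] M1 q1 by simp
            then have "M * s powr q \<le> (M * s) powr q" using M1 s by (subst powr_mult) (auto intro: mult_right_mono)
            then have "M * s powr q + C' powr q \<le> (M * s) powr q + C' powr q" by simp
            also have "\<dots> \<le> (2 * (M * s + C')) powr q" using M1 s C'0 q1 by (intro powr_sum_le) auto
            finally have "2 powr q * (M * s powr q + C' powr q) \<le> 2 powr q * (2 * (M * s + C')) powr q"
              by (intro mult_left_mono) auto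
            also have "\<dots> = \<sigma> powr q" unfolding \<sigma>_def using M1 s C'0 by (subst powr_mult[of 2]) auto
            finally have "ennreal (2 powr q * (M * s powr q + C' powr q)) \<le> ennreal (\<sigma> powr q)" by (rule ennreal_leI)
            then show "ennreal (2 powr q) * (b + ennreal (C' powr q)) \<le> ennreal (\<sigma> powr q)"
              unfolding b_def using M1 by (simp add: ennreal_mult ennreal_plus)
          qed simp
          finally show "(\<integral>\<^sup>+y\<in>ball c' r'. ennreal (gn n y powr q) \<partial>\<mu>) \<le> ennreal (\<sigma> powr q) * emeasure \<mu> (ball c' r')" .
        qed
        have dzz: "dist z z' \<le> 2 * r" using zG dist_triangle[of z z' c] by (auto simp: G_def dist_commute)
        have "\<bar>v z - v z'\<bar> \<le> A * \<sigma> * (2 * r)"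
        proof (rule oscillation_bound_lsc[OF compact_cball gnc gnmono gnC C'0 K ugv dom])
          show "0 \<le> A * \<sigma> * (2 * r)" using A \<sigma>0 r by simp
          fix n and w :: "'a \<Rightarrow> real"
          assume "\<exists>L. L-lipschitz_on UNIV w" and ugw: "upper_gradient_on UNIV w (\<lambda>y. ennreal (gn n y))"
          then obtain L' where L': "L'-lipschitz_on UNIV w" by blast
          have "pointwise_bound q w (gn n) A" by (rule SI[OF q L' ugw gnc C'0 gnC K])
          then have "\<bar>w z - w z'\<bar> \<le> A * \<sigma> * dist z z'" by (rule pointwise_boundD[OF _ \<sigma>0 goodn[OF zG(1)] goodn[OF zG(2)]])
          also have "\<dots> \<le> A * \<sigma> * (2 * r)" using A \<sigma>0 dzz by (intro mult_left_mono) auto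
          finally show "\<bar>w z - w z'\<bar> \<le> A * \<sigma> * (2 * r)" .
        qed
        then have "h \<le> 8 * A * M * s * r + 8 * A * (C' * r)" using vz h by (simp add: \<sigma>_def algebra_simps)
        \<comment> \<open>Half of \<open>h\<close> is absorbed, and the rest contradicts
          \<open>h > 16 * A * M * s * r\<close>.\<close>
        also have "8 * A * (C' * r) = h / 2" using A r by (simp add: C'_def \<Lambda>_def)
        finally show False using h by simp
      qed
      moreover have "G \<subseteq> ball c r" by (auto simp: G_def)
      ultimately show "\<exists>G\<in>sets borel. G \<subseteq> ball c r \<and> emeasure \<mu> (ball c r - G) \<le> ennreal \<theta> * emeasure \<mu> (ball c r) \<and>
          (\<forall>z\<in>G. \<forall>z'\<in>G. \<bar>u z - u z'\<bar> \<le> 16 * A * M * s * r)"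
        using Gm le by (intro bexI[of _ G] conjI ballI) (auto simp: abs_le_iff)
    qed
  qed (use \<Lambda>1 q0 in auto)
qed

end

section \<open>From Hausdorff content to the pointwise Hardy inequality\<close>

context doubling_space
begin

text \<open>Oscillation at most \<open>b\<close> after discarding a fraction \<open>\<theta>\<close>
  of the ball; it takes the place of the mean oscillation.\<close>

definition osc :: "real \<Rightarrow> ('a \<Rightarrow> real) \<Rightarrow> 'a \<Rightarrow> real \<Rightarrow> real \<Rightarrow> bool" where
  "osc \<theta> u c r b \<longleftrightarrow> (\<exists>G\<in>sets borel. G \<subseteq> ball c r \<and>
     emeasure \<mu> (ball c r - G) \<le> ennreal \<theta> * emeasure \<mu> (ball c r) \<and> (\<forall>z\<in>G. \<forall>z'\<in>G. \<bar>u z - u z'\<bar> \<le> b))"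

text \<open>Otherwise the two exceptional sets would cover the smaller ball, although their total
  measure is below its measure. The power \<open>D ^ 3\<close> allows for passing from a ball of
  radius \<open>4 * R\<close> to one of radius \<open>R\<close> with centres \<open>2 * R\<close>
  apart.\<close>

lemma common_point:
  assumes G: "G \<in> sets borel" "emeasure \<mu> (ball c r - G) \<le> ennreal \<theta> * emeasure \<mu> (ball c r)"
    and G': "G' \<in> sets borel" "emeasure \<mu> (ball c' r' - G') \<le> ennreal \<theta> * emeasure \<mu> (ball c' r')"
    and r: "0 < r" "0 < r'" "ball c' r' \<subseteq> ball c r" "V c r \<le> D ^ 3 * V c' r'"
    and \<theta>: "0 \<le> \<theta>" "\<theta> * (D ^ 3 + 1) < 1"
  shows "\<exists>z\<in>G \<inter> G'. z \<in> ball c' r'"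
proof (rule ccontr)
  assume no: "\<not> ?thesis"
  have "emeasure \<mu> (ball c' r') \<le> emeasure \<mu> ((ball c r - G) \<union> (ball c' r' - G'))"
    by (rule emeasure_mono) (use no r(3) G(1) G'(1) in \<open>auto simp: sets_eq\<close>)
  also have "\<dots> \<le> emeasure \<mu> (ball c r - G) + emeasure \<mu> (ball c' r' - G')"
    by (rule emeasure_subadditive) (use G(1) G'(1) in \<open>auto simp: sets_eq\<close>)
  also have "\<dots> \<le> ennreal \<theta> * emeasure \<mu> (ball c r) + ennreal \<theta> * emeasure \<mu> (ball c' r')"
    by (rule add_mono[OF G(2) G'(2)])
  also have "\<dots> = ennreal (\<theta> * V c r + \<theta> * V c' r')"
    using r \<theta> by (simp add: emeasure_ball ennreal_mult)
  finally have "ennreal (V c' r') \<le> ennreal (\<theta> * V c r + \<theta> * V c' r')"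
    unfolding emeasure_ball[OF r(2)] .
  then have "V c' r' \<le> \<theta> * V c r + \<theta> * V c' r'"
    by (subst (asm) ennreal_le_iff) (use \<theta> in auto)
  also have "\<theta> * V c r \<le> \<theta> * (D ^ 3 * V c' r')" by (rule mult_left_mono[OF r(4) \<theta>(1)])
  finally have "V c' r' \<le> (\<theta> * (D ^ 3 + 1)) * V c' r'" by (simp add: algebra_simps)
  also have "\<dots> < 1 * V c' r'" by (rule mult_strict_right_mono[OF \<theta>(2) V_pos[OF r(2)]])
  finally show False by simp
qed

text \<open>Points common to consecutive large sets play the role of means: they converge to
  \<open>x\<close>, and moving from one to the next stays inside a single set of controlled
  oscillation.\<close>

lemma osc_telescope:
  fixes u :: "'a \<Rightarrow> real"
  assumes G: "\<And>k::nat. G k \<in> sets borel" "\<And>k. G k \<subseteq> ball x (\<rho> / 2 ^ k)"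
      "\<And>k. emeasure \<mu> (ball x (\<rho> / 2 ^ k) - G k) \<le> ennreal \<theta> * emeasure \<mu> (ball x (\<rho> / 2 ^ k))"
      "\<And>k z z'. z \<in> G k \<Longrightarrow> z' \<in> G k \<Longrightarrow> \<bar>u z - u z'\<bar> \<le> b k"
    and \<rho>: "0 < \<rho>" and u: "continuous_on UNIV u" and \<theta>: "0 \<le> \<theta>" "\<theta> * (D ^ 3 + 1) < 1"
    and b: "b sums S" and z: "z \<in> G 0"
  shows "\<bar>u z - u x\<bar> \<le> S"
proof -
  have "\<exists>y. y \<in> G k \<and> y \<in> G (Suc k)" for k
  proof -
    have "\<exists>z\<in>G k \<inter> G (Suc k). z \<in> ball x (\<rho> / 2 ^ Suc k)"
    proof (rule common_point[OF G(1,3) G(1,3) _ _ _ _ \<theta>])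
      show "ball x (\<rho> / 2 ^ Suc k) \<subseteq> ball x (\<rho> / 2 ^ k)" using \<rho> by (intro subset_ball) (simp add: field_simps)
      have "V x (2 * (\<rho> / 2 ^ Suc k)) \<le> D * V x (\<rho> / 2 ^ Suc k)" using \<rho> by (intro V_double) simp
      also have "\<dots> \<le> D ^ 3 * V x (\<rho> / 2 ^ Suc k)"
        using self_le_power[OF D_ge_1, of 3] by (intro mult_right_mono) auto
      finally show "V x (\<rho> / 2 ^ k) \<le> D ^ 3 * V x (\<rho> / 2 ^ Suc k)" by simp
    qed (use \<rho> in auto)
    then show ?thesis by blast
  qed
  then have "\<forall>k. \<exists>y. y \<in> G k \<and> y \<in> G (Suc k)" by blast
  from choice[OF this] obtain y where y: "\<And>k. y k \<in> G k" "\<And>k. y k \<in> G (Suc k)" by blast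
  \<comment> \<open>The sequence starts at the prescribed point \<open>z\<close> of the first set
    and then follows the common points, so its \<open>k\<close>-th step takes place inside
    \<open>G k\<close>.\<close>
  define a where "a k = (case k of 0 \<Rightarrow> u z | Suc k \<Rightarrow> u (y k))" for k
  have "\<bar>a 0 - u x\<bar> \<le> S"
  proof (rule telescope_limit[OF _ _ b])
    show "\<bar>a k - a (Suc k)\<bar> \<le> b k" for k
      using G(4)[OF z y(1)[of 0]] G(4)[OF y(2) y(1)] by (cases k) (auto simp: a_def)
    have "y \<longlonglongrightarrow> x"
    proof (rule metric_LIMSEQ_I)
      fix e :: real assume e: "0 < e"
      obtain n :: nat where n: "\<rho> / e < 2 ^ n" using real_arch_pow[of 2 "\<rho> / e"] by auto
      have "dist (y k) x < e" if k: "n \<le> k" for k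
      proof -
        have "dist (y k) x < \<rho> / 2 ^ k" using y(1)[of k] G(2)[of k] by (auto simp: dist_commute)
        also have "\<dots> \<le> \<rho> / 2 ^ n" using \<rho> k by (intro divide_left_mono power_increasing) auto
        also have "\<dots> < e" using n e by (simp add: field_simps)
        finally show ?thesis .
      qed
      then show "\<exists>n. \<forall>k\<ge>n. dist (y k) x < e" by blast
    qed
    moreover have "isCont u x" using u by (simp add: continuous_on_eq_continuous_at)
    ultimately have "(\<lambda>k. u (y k)) \<longlonglongrightarrow> u x" by (rule isCont_tendsto_compose[rotated])
    then have "(\<lambda>k. a (Suc k)) \<longlonglongrightarrow> u x" by (simp add: a_def)
    then show "a \<longlonglongrightarrow> u x" by (rule LIMSEQ_imp_Suc)
  qed
  then show ?thesis by (simp add: a_def)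
qed

lemma osc_choice:
  assumes "\<And>k::nat. osc \<theta> u x (r k) (b k)"
  obtains G where "\<And>k. G k \<in> sets borel" "\<And>k. G k \<subseteq> ball x (r k)"
    "\<And>k. emeasure \<mu> (ball x (r k) - G k) \<le> ennreal \<theta> * emeasure \<mu> (ball x (r k))"
    "\<And>k z z'. z \<in> G k \<Longrightarrow> z' \<in> G k \<Longrightarrow> \<bar>u z - u z'\<bar> \<le> b k"
proof -
  have "\<forall>k. \<exists>G. G \<in> sets borel \<and> G \<subseteq> ball x (r k) \<and>
     emeasure \<mu> (ball x (r k) - G) \<le> ennreal \<theta> * emeasure \<mu> (ball x (r k)) \<and> (\<forall>z\<in>G. \<forall>z'\<in>G. \<bar>u z - u z'\<bar> \<le> b k)"
    using assms unfolding osc_def Bex_def by (intro allI)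
  from choice[OF this] obtain G where "\<forall>k. G k \<in> sets borel \<and> G k \<subseteq> ball x (r k) \<and>
     emeasure \<mu> (ball x (r k) - G k) \<le> ennreal \<theta> * emeasure \<mu> (ball x (r k)) \<and> (\<forall>z\<in>G k. \<forall>z'\<in>G k. \<bar>u z - u z'\<bar> \<le> b k)"
    by (rule exE)
  then show ?thesis by (intro that[of G]) auto
qed

text \<open>The radii at \<open>w\<close> start from \<open>4 * R\<close> so that the first ball
  there contains \<open>ball x R\<close>; the first large sets then share a point from which both
  telescopes descend.\<close>

lemma osc_two_point:
  assumes u: "continuous_on UNIV u" and R: "0 < R" and d: "dist x w \<le> 2 * R"
    and \<theta>: "0 \<le> \<theta>" "\<theta> * (D ^ 3 + 1) < 1"
    and b: "\<And>k. osc \<theta> u x (R / 2 ^ k) (b k)" "b sums S"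
    and b': "\<And>k. osc \<theta> u w (4 * R / 2 ^ k) (b' k)" "b' sums S'"
  shows "\<bar>u x - u w\<bar> \<le> S + S'"
proof -
  obtain G where G: "\<And>k. G k \<in> sets borel" "\<And>k. G k \<subseteq> ball x (R / 2 ^ k)"
    "\<And>k. emeasure \<mu> (ball x (R / 2 ^ k) - G k) \<le> ennreal \<theta> * emeasure \<mu> (ball x (R / 2 ^ k))"
    "\<And>k z z'. z \<in> G k \<Longrightarrow> z' \<in> G k \<Longrightarrow> \<bar>u z - u z'\<bar> \<le> b k"
    by (rule osc_choice[where r = "\<lambda>k. R / 2 ^ k" and b = b, OF b(1)]) blast
  obtain G' where G': "\<And>k. G' k \<in> sets borel" "\<And>k. G' k \<subseteq> ball w (4 * R / 2 ^ k)"
    "\<And>k. emeasure \<mu> (ball w (4 * R / 2 ^ k) - G' k) \<le> ennreal \<theta> * emeasure \<mu> (ball w (4 * R / 2 ^ k))"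
    "\<And>k z z'. z \<in> G' k \<Longrightarrow> z' \<in> G' k \<Longrightarrow> \<bar>u z - u z'\<bar> \<le> b' k"
    by (rule osc_choice[where r = "\<lambda>k. 4 * R / 2 ^ k" and b = b', OF b'(1)]) blast
  have R4: "0 < 4 * R" using R by simp
  have "\<exists>z\<in>G' 0 \<inter> G 0. z \<in> ball x R"
  proof (rule common_point[OF G'(1) _ G(1) _ R4 R _ _ \<theta>])
    show "emeasure \<mu> (ball w (4 * R) - G' 0) \<le> ennreal \<theta> * emeasure \<mu> (ball w (4 * R))" using G'(3)[of 0] by simp
    show "emeasure \<mu> (ball x R - G 0) \<le> ennreal \<theta> * emeasure \<mu> (ball x R)" using G(3)[of 0] by simp
    show "ball x R \<subseteq> ball w (4 * R)"
    proof
      fix z assume "z \<in> ball x R"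
      then show "z \<in> ball w (4 * R)" using d R dist_triangle[of w z x] by (auto simp: dist_commute)
    qed
    show "V w (4 * R) \<le> D ^ 3 * V x R" by (rule V_compare) (use d R in auto)
  qed
  then obtain z where z: "z \<in> G 0" "z \<in> G' 0" by blast
  have "\<bar>u z - u x\<bar> \<le> S" by (rule osc_telescope[OF G R u \<theta> b(2) z(1)])
  moreover have "\<bar>u z - u w\<bar> \<le> S'" by (rule osc_telescope[OF G' R4 u \<theta> b'(2) z(2)])
  ultimately show ?thesis by linarith
qed

lemma haus_content_finite_cover:
  assumes J: "finite J" and r: "\<And>j. j \<in> J \<Longrightarrow> 0 \<le> r j" "\<And>j. j \<in> J \<Longrightarrow> r j \<le> R"
    and E: "E \<subseteq> (\<Union>j\<in>J. ball (c j) (r j))" and R: "0 \<le> R"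
  shows "haus_content \<mu> t R E \<le> (\<Sum>j\<in>J. emeasure \<mu> (ball (c j) (r j)) * ennreal (r j powr (- t)))"
proof -
  obtain h where h: "bij_betw h {0..<card J} J" using ex_bij_betw_nat_finite[OF J] by blast
  define c' where "c' i = c (h i)" for i
  \<comment> \<open>The content is defined by sequences of balls; radius 0 pads the finite family
    with empty balls of measure zero.\<close>
  define r' where "r' i = (if i < card J then r (h i) else 0)" for i
  have hJ: "h i \<in> J" if "i < card J" for i using h that by (auto simp: bij_betw_def)
  have "E \<subseteq> (\<Union>i. ball (c' i) (r' i))"
  proof
    fix z assume "z \<in> E"
    then obtain j where j: "j \<in> J" "z \<in> ball (c j) (r j)" using E by blast
    then obtain i where "i < card J" "h i = j" using h by (force simp: bij_betw_def)
    then show "z \<in> (\<Union>i. ball (c' i) (r' i))" using j by (auto simp: c'_def r'_def intro!: exI[of _ i])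
  qed
  then have "haus_content \<mu> t R E \<le> (\<Sum>i. emeasure \<mu> (ball (c' i) (r' i)) * ennreal (r' i powr (- t)))"
    unfolding haus_content_def
    by (intro INF_lower2[of "(c', r')"]) (use r R hJ in \<open>auto simp: r'_def\<close>)
  also have "\<dots> = (\<Sum>i\<in>{0..<card J}. emeasure \<mu> (ball (c' i) (r' i)) * ennreal (r' i powr (- t)))"
    by (rule suminf_finite) (auto simp: r'_def)
  also have "\<dots> = (\<Sum>i\<in>{0..<card J}. emeasure \<mu> (ball (c (h i)) (r (h i))) * ennreal (r (h i) powr (- t)))"
    by (rule sum.cong) (auto simp: c'_def r'_def)
  also have "\<dots> = (\<Sum>j\<in>J. emeasure \<mu> (ball (c j) (r j)) * ennreal (r j powr (- t)))"
    by (rule sum.reindex_bij_betw[OF h])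
  finally show ?thesis .
qed

definition hardy_weight :: "'a set \<Rightarrow> real \<Rightarrow> real \<Rightarrow> ('a \<Rightarrow> ennreal) \<Rightarrow> 'a \<Rightarrow> ennreal" where
  "hardy_weight \<Omega> q \<gamma> g y = epowr (g y) q * ennreal (dist_bdry \<Omega> y powr \<gamma>) * indicator \<Omega> y"

section \<open>The weight and the estimate at a single point\<close>

lemma dist_bdry_pos:
  assumes "open \<Omega>" "frontier \<Omega> \<noteq> {}" "y \<in> \<Omega>"
  shows "0 < dist_bdry \<Omega> y"
proof -
  have "y \<notin> frontier \<Omega>" using assms by (simp add: frontier_def interior_open)
  then have "infdist y (frontier \<Omega>) \<noteq> 0"
    using in_closed_iff_infdist_zero[of "frontier \<Omega>" y] assms(2) by simp
  then show ?thesis using infdist_nonneg[of y "frontier \<Omega>"] by (simp add: dist_bdry_def)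
qed

text \<open>Here the sign of \<open>\<beta>\<close> enters: with a nonpositive exponent, boundary
  distance at most \<open>M\<close> makes the weight at least \<open>M powr \<gamma>\<close>, so
  inserting it costs the factor \<open>M powr (- \<gamma>)\<close>.\<close>

lemma hardy_weight_ball:
  assumes \<Omega>: "open \<Omega>" "frontier \<Omega> \<noteq> {}" and \<gamma>: "\<gamma> \<le> 0" and M: "0 < M" and q: "0 < q"
    and dM: "\<And>y. y \<in> \<Omega> \<Longrightarrow> y \<in> ball c r \<Longrightarrow> dist_bdry \<Omega> y \<le> M" and g: "g \<in> borel_measurable borel"
  shows "(\<integral>\<^sup>+y\<in>ball c r. epowr (g y * indicator \<Omega> y) q \<partial>\<mu>)
     \<le> ennreal (M powr (- \<gamma>)) * (\<integral>\<^sup>+y\<in>ball c r. hardy_weight \<Omega> q \<gamma> g y \<partial>\<mu>)"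
proof -
  have [measurable]: "g \<in> borel_measurable borel" by (rule g)
  have [measurable]: "\<Omega> \<in> sets borel" using \<Omega> by simp
  have [measurable]: "dist_bdry \<Omega> \<in> borel_measurable borel"
    unfolding dist_bdry_def by (intro borel_measurable_continuous_onI continuous_intros)
  have "(\<integral>\<^sup>+y\<in>ball c r. epowr (g y * indicator \<Omega> y) q \<partial>\<mu>)
     \<le> (\<integral>\<^sup>+y. ennreal (M powr (- \<gamma>)) * (hardy_weight \<Omega> q \<gamma> g y * indicator (ball c r) y) \<partial>\<mu>)"
  proof (rule nn_integral_mono)
    fix y
    show "epowr (g y * indicator \<Omega> y) q * indicator (ball c r) y
      \<le> ennreal (M powr (- \<gamma>)) * (hardy_weight \<Omega> q \<gamma> g y * indicator (ball c r) y)"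
    proof (cases "y \<in> \<Omega> \<and> y \<in> ball c r")
      case True
      have dp: "0 < dist_bdry \<Omega> y" using dist_bdry_pos[OF \<Omega>] True by blast
      have "1 = M powr (- \<gamma>) * M powr \<gamma>" using M by (simp add: powr_add[symmetric])
      also have "\<dots> \<le> M powr (- \<gamma>) * dist_bdry \<Omega> y powr \<gamma>"
        using dM[of y] True \<gamma> dp by (intro mult_left_mono powr_mono2') auto
      finally have "ennreal 1 \<le> ennreal (M powr (- \<gamma>) * dist_bdry \<Omega> y powr \<gamma>)" by (rule ennreal_leI)
      then have "1 \<le> ennreal (M powr (- \<gamma>)) * ennreal (dist_bdry \<Omega> y powr \<gamma>)" by (simp add: ennreal_mult)
      then have "epowr (g y) q * 1 \<le> epowr (g y) q * (ennreal (M powr (- \<gamma>)) * ennreal (dist_bdry \<Omega> y powr \<gamma>))"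
        by (rule mult_left_mono) simp
      then show ?thesis using True by (simp add: hardy_weight_def ac_simps)
    next
      case False
      then show ?thesis using q by (auto simp: epowr_def)
    qed
  qed
  also have "\<dots> = ennreal (M powr (- \<gamma>)) * (\<integral>\<^sup>+y\<in>ball c r. hardy_weight \<Omega> q \<gamma> g y \<partial>\<mu>)"
    unfolding hardy_weight_def by (rule nn_integral_cmult) measurable
  finally show ?thesis .
qed

text \<open>The number \<open>m\<close> stands for the value of the maximal function. Three
  alternatives produce the three summands of \<open>N\<close>: \<open>\<bar>u x\<bar>\<close> is
  already controlled by telescoping at \<open>x\<close>; or some boundary point has a bad ball of
  size comparable to the boundary distance; or all bad balls are small and can be used to test the
  Hausdorff content.\<close>

lemma hardy_estimate:
  assumes \<Omega>: "open \<Omega>" "frontier \<Omega> \<noteq> {}" and \<beta>: "\<beta> \<le> 0" and t: "0 \<le> t" and C0: "0 < C0"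
    and content: "\<forall>x\<in>\<Omega>. haus_content \<mu> t (dist_bdry \<Omega> x) (frontier \<Omega> \<inter> cball x (2 * dist_bdry \<Omega> x))
              \<ge> ennreal C0 * emeasure \<mu> (cball x (dist_bdry \<Omega> x)) * ennreal (dist_bdry \<Omega> x powr (- t))"
    and p: "1 < p" and q: "1 < q" and tq: "t < q * (1 - \<beta> / p)"
    and \<Lambda>: "1 \<le> \<Lambda>" and C: "0 < C" and \<theta>: "0 \<le> \<theta>" "\<theta> * (D ^ 3 + 1) < 1"
    and IP: "\<And>u g c r s. \<exists>L. L-lipschitz_on UNIV u \<Longrightarrow> upper_gradient_on UNIV u g \<Longrightarrow> 0 < r \<Longrightarrow> 0 < s \<Longrightarrow>
       (\<integral>\<^sup>+y\<in>ball c (\<Lambda> * r). epowr (g y) q \<partial>\<mu>) \<le> ennreal (s powr q) * emeasure \<mu> (ball c r) \<Longrightarrow>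
       osc \<theta> u c r (C * s * r)"
  shows "\<exists>N>0. \<forall>u\<in>Lip0 \<Omega>. \<forall>g x m. upper_gradient_on \<Omega> u g \<longrightarrow> x \<in> \<Omega> \<longrightarrow> 0 < m \<longrightarrow>
     (\<forall>r. 0 < r \<longrightarrow> r \<le> 6 * \<Lambda> * dist_bdry \<Omega> x \<longrightarrow>
       (\<integral>\<^sup>+y\<in>ball x r. hardy_weight \<Omega> q (\<beta> * q / p) g y \<partial>\<mu>) \<le> ennreal m * emeasure \<mu> (ball x r)) \<longrightarrow>
     \<bar>u x\<bar> powr q \<le> N * m * dist_bdry \<Omega> x powr (q * (1 - \<beta> / p))"
proof -
  define \<gamma> where "\<gamma> = \<beta> * q / p"
  define \<kappa> where "\<kappa> = 1 - \<beta> / p"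
  \<comment> \<open>The gain in exponent that makes the series at boundary points geometric; it is
    positive exactly because \<open>t < q * (1 - \<beta> / p)\<close>.\<close>
  define \<epsilon> where "\<epsilon> = \<kappa> - t / q"
  have D0: "0 < D" using D_ge_1 by simp
  have \<gamma>: "\<gamma> \<le> 0" using \<beta> p q by (simp add: \<gamma>_def divide_nonpos_pos mult_nonpos_nonneg)
  have \<epsilon>: "0 < \<epsilon>" using tq q by (simp add: \<epsilon>_def \<kappa>_def field_simps)
  have \<kappa>q: "q * \<kappa> = q - \<gamma>" by (simp add: \<kappa>_def \<gamma>_def right_diff_distrib)
  have \<epsilon>q: "\<epsilon> * q = q - \<gamma> - t"
  proof -
    have "\<epsilon> * q = q * \<kappa> - t" unfolding \<epsilon>_def using q by (simp add: field_simps)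
    then show ?thesis using \<kappa>q by simp
  qed
  \<comment> \<open>Enough doublings to absorb every dilation by a multiple of
    \<open>\<Lambda>\<close> below, the largest being \<open>12 * \<Lambda>\<close> for the radii of
    the final cover.\<close>
  obtain j where "16 * \<Lambda> < 2 ^ j" using real_arch_pow[of 2 "16 * \<Lambda>"] by auto
  then have j: "16 * \<Lambda> \<le> 2 ^ j" by simp
  define K1 where "K1 = (2 * \<Lambda>) powr (- \<gamma>) * D ^ j"
  \<comment> \<open>Normalised so that the geometric series of oscillations at a boundary point sums
    to \<open>a / 4\<close>.\<close>
  define \<sigma>c where "\<sigma>c = (1 - 2 powr (- \<epsilon>)) / (4 * C)"
  have tw: "2 powr (- \<epsilon>) < (1::real)" using \<epsilon> by (simp add: powr_less_one)
  have \<sigma>c: "0 < \<sigma>c" using tw C by (simp add: \<sigma>c_def)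
  define c1 where "c1 = \<sigma>c powr q * 4 powr (- (\<epsilon> * q)) * \<Lambda> powr \<gamma>"
  have c1: "0 < c1" using \<sigma>c \<Lambda> by (simp add: c1_def)
  have K1: "0 < K1" using \<Lambda> D0 by (simp add: K1_def)
  define Na where "Na = (8 * C) powr q * K1"
  define Nb where "Nb = 4 powr t * D ^ (2 * j) / c1"
  define Nc where "Nc = D ^ (2 * j) / (C0 * c1)"
  have Npos: "0 < Na" "0 < Nb" "0 < Nc" using C K1 D0 c1 C0 by (simp_all add: Na_def Nb_def Nc_def)
  show ?thesis
  proof (intro exI[of _ "Na + Nb + Nc"] conjI ballI allI impI)
    show "0 < Na + Nb + Nc" using Npos by simp
    fix u g x m
    assume u: "u \<in> Lip0 \<Omega>" and ug\<Omega>: "upper_gradient_on \<Omega> u g" and x: "x \<in> \<Omega>" and m: "0 < (m::real)"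
      and max0: "\<forall>r. 0 < r \<longrightarrow> r \<le> 6 * \<Lambda> * dist_bdry \<Omega> x \<longrightarrow>
       (\<integral>\<^sup>+y\<in>ball x r. hardy_weight \<Omega> q (\<beta> * q / p) g y \<partial>\<mu>) \<le> ennreal m * emeasure \<mu> (ball x r)"
    define R where "R = dist_bdry \<Omega> x"
    have R: "0 < R" unfolding R_def by (rule dist_bdry_pos[OF \<Omega> x])
    define H where "H = hardy_weight \<Omega> q \<gamma> g"
    have maxf: "(\<integral>\<^sup>+y\<in>ball x r. H y \<partial>\<mu>) \<le> ennreal (m * V x r)"
      if "0 < r" "r \<le> 6 * \<Lambda> * R" for r
    proof -
      have "(\<integral>\<^sup>+y\<in>ball x r. H y \<partial>\<mu>) \<le> ennreal m * emeasure \<mu> (ball x r)"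
        using max0 that by (simp add: H_def \<gamma>_def R_def)
      then show ?thesis using that m by (simp add: emeasure_ball ennreal_mult)
    qed
    obtain L where L: "L-lipschitz_on UNIV u" using u by (auto simp: Lip0_def)
    have Lex: "\<exists>L. L-lipschitz_on UNIV u" using L by blast
    have uc: "continuous_on UNIV u" by (rule lipschitz_on_continuous_on[OF L])
    have u0: "u z = 0" if "z \<notin> \<Omega>" for z
      using u that closure_subset[of "{x. u x \<noteq> 0}"] by (auto simp: Lip0_def)
    have gm: "g \<in> borel_measurable borel" using ug\<Omega> by (simp add: upper_gradient_on_def)
    have Hm[measurable]: "H \<in> borel_measurable borel"
    proof -
      have [measurable]: "dist_bdry \<Omega> \<in> borel_measurable borel"
        unfolding dist_bdry_def by (intro borel_measurable_continuous_onI continuous_intros)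
      have [measurable]: "g \<in> borel_measurable borel" "\<Omega> \<in> sets borel" using gm \<Omega> by simp_all
      show ?thesis unfolding H_def hardy_weight_def by measurable
    qed
    have ug: "upper_gradient_on UNIV u (\<lambda>y. g y * indicator \<Omega> y)"
      by (rule upper_gradient_zero_extension[OF ug\<Omega> \<Omega>(1) uc u0])
    have intH: "(\<integral>\<^sup>+y\<in>ball c r. epowr (g y * indicator \<Omega> y) q \<partial>\<mu>)
       \<le> ennreal (M powr (- \<gamma>)) * (\<integral>\<^sup>+y\<in>ball c r. H y \<partial>\<mu>)"
      if "0 < M" "\<And>y. y \<in> \<Omega> \<Longrightarrow> y \<in> ball c r \<Longrightarrow> dist_bdry \<Omega> y \<le> M" for c r M
      unfolding H_def by (rule hardy_weight_ball[OF \<Omega> \<gamma> that(1) _ that(2) gm]) (use q in auto)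
    define a where "a = \<bar>u x\<bar>"
    \<comment> \<open>The size that the maximal function bound at \<open>x\<close> allows for the
      gradient on balls about \<open>x\<close>, after removing the weight and the dilation.\<close>
    define sx where "sx = (K1 * R powr (- \<gamma>) * m) powr (1 / q)"
    have sxq: "sx powr q = K1 * R powr (- \<gamma>) * m" using q K1 m R by (simp add: sx_def powr_powr)
    have sx: "0 < sx" using K1 R m by (simp add: sx_def)
    have oscx: "osc \<theta> u x (R / 2 ^ k) (C * sx * (R / 2 ^ k))" for k
    proof (rule IP[OF Lex ug _ sx])
      let ?r = "R / 2 ^ k"
      show r: "0 < ?r" using R by simp
      have rR: "?r \<le> R" using R by (simp add: divide_le_eq)
      have \<Lambda>r: "0 < \<Lambda> * ?r" "\<Lambda> * ?r \<le> \<Lambda> * R" using \<Lambda> r rR by (auto intro: mult_left_mono simp del: times_divide_eq_right)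
      have "(\<integral>\<^sup>+y\<in>ball x (\<Lambda> * ?r). epowr (g y * indicator \<Omega> y) q \<partial>\<mu>)
        \<le> ennreal ((2 * \<Lambda> * R) powr (- \<gamma>)) * (\<integral>\<^sup>+y\<in>ball x (\<Lambda> * ?r). H y \<partial>\<mu>)"
      proof (rule intH)
        show "0 < 2 * \<Lambda> * R" using \<Lambda> R by simp
        fix y assume "y \<in> ball x (\<Lambda> * ?r)"
        then have "dist y x \<le> \<Lambda> * R" using \<Lambda>r by (simp add: dist_commute)
        moreover have "dist_bdry \<Omega> y \<le> R + dist y x" unfolding R_def dist_bdry_def
          using infdist_triangle[of y "frontier \<Omega>" x] by simp
        moreover have "R \<le> \<Lambda> * R" using \<Lambda> R by simp
        ultimately show "dist_bdry \<Omega> y \<le> 2 * \<Lambda> * R" by simp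
      qed
      also have "\<dots> \<le> ennreal ((2 * \<Lambda> * R) powr (- \<gamma>)) * ennreal (m * V x (\<Lambda> * ?r))"
      proof (intro mult_left_mono maxf \<Lambda>r)
        have "\<Lambda> * R \<le> 6 * \<Lambda> * R" using \<Lambda> R by simp
        then show "\<Lambda> * ?r \<le> 6 * \<Lambda> * R" using \<Lambda>r by linarith
      qed simp
      also have "\<dots> = ennreal ((2 * \<Lambda> * R) powr (- \<gamma>) * (m * V x (\<Lambda> * ?r)))"
        using m by (simp add: ennreal_mult)
      also have "\<dots> \<le> ennreal ((2 * \<Lambda> * R) powr (- \<gamma>) * (m * (D ^ j * V x ?r)))"
      proof (intro ennreal_leI mult_left_mono)
        have "\<Lambda> * ?r \<le> 2 ^ j * ?r" using j \<Lambda> r by (intro mult_right_mono) auto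
        then show "V x (\<Lambda> * ?r) \<le> D ^ j * V x ?r" using \<Lambda>r r by (intro V_compare) auto
      qed (use m in auto)
      also have "\<dots> = ennreal (sx powr q * V x ?r)"
        unfolding sxq K1_def using \<Lambda> R by (simp add: powr_mult ac_simps)
      also have "\<dots> = ennreal (sx powr q) * emeasure \<mu> (ball x ?r)"
        using r by (simp add: emeasure_ball ennreal_mult)
      finally show "(\<integral>\<^sup>+y\<in>ball x (\<Lambda> * ?r). epowr (g y * indicator \<Omega> y) q \<partial>\<mu>)
        \<le> ennreal (sx powr q) * emeasure \<mu> (ball x ?r)" .
    qed
    have sumx: "(\<lambda>k. C * sx * (R / 2 ^ k)) sums (2 * C * sx * R)"
    proof -
      have "(\<lambda>k. C * sx * R * (1 / 2) ^ k) sums (C * sx * R * (1 / (1 - 1 / 2)))"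
        by (intro sums_mult geometric_sums) auto
      then show ?thesis by (simp add: power_divide ac_simps)
    qed
    have Rpow: "R powr (\<epsilon> * q) * R powr t = R powr (q * \<kappa>)"
      unfolding \<epsilon>q \<kappa>q by (simp add: powr_add[symmetric])
    have goal: "a powr q \<le> (Na + Nb + Nc) * m * R powr (q * \<kappa>)"
      if "a powr q \<le> N * m * R powr (q * \<kappa>)" "N \<in> {Na, Nb, Nc}" for N
    proof -
      have "N * (m * R powr (q * \<kappa>)) \<le> (Na + Nb + Nc) * (m * R powr (q * \<kappa>))"
        by (intro mult_right_mono) (use that(2) Npos m in auto)
      then show ?thesis using that(1) by (simp add: mult.assoc)
    qed
    have "a powr q \<le> (Na + Nb + Nc) * m * R powr (q * \<kappa>)"
    \<comment> \<open>In the second case the telescope at \<open>x\<close> contributes less than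
      \<open>a / 4\<close>, which leaves most of \<open>\<bar>u x\<bar>\<close> to be accounted for
      at the boundary.\<close>
    proof (cases "a \<le> 8 * C * sx * R")
      case True
      have "a powr q \<le> (8 * C * sx * R) powr q" using True q by (intro powr_mono2) (auto simp: a_def)
      also have "\<dots> = (8 * C) powr q * (K1 * R powr (- \<gamma>) * m) * R powr q"
        using C sx R by (simp add: powr_mult sxq[symmetric])
      also have "\<dots> = Na * m * (R powr (- \<gamma>) * R powr q)" by (simp add: Na_def ac_simps)
      also have "R powr (- \<gamma>) * R powr q = R powr (q * \<kappa>)" unfolding \<kappa>q by (simp add: powr_add[symmetric])
      finally show ?thesis by (rule goal) simp
    next
      case False
      have a0: "0 < a" using False C sx R by (smt (verit) mult_pos_pos)
      define \<rho> where "\<rho> k = 4 * R / 2 ^ k" for k :: nat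
      have \<rho>: "0 < \<rho> k" "\<rho> k \<le> 4 * R" for k using R by (auto simp: \<rho>_def divide_le_eq)
      define E where "E = frontier \<Omega> \<inter> cball x (2 * R)"
      \<comment> \<open>If every ball about \<open>w\<close> were harmless, the two telescopes would
        give less than half of \<open>a\<close>, although \<open>u w = 0\<close>. Each
        \<open>w\<close> thus has a bad scale. Since \<open>enn2real\<close> maps infinity to 0, an
        infinite integral is listed separately.\<close>
      have key: "\<exists>k. c1 * a powr q * R powr (- (\<epsilon> * q)) * (\<rho> k powr (- t) * V w (\<rho> k))
          < enn2real (\<integral>\<^sup>+y\<in>ball w (\<Lambda> * \<rho> k). H y \<partial>\<mu>) \<or>
          (\<integral>\<^sup>+y\<in>ball w (\<Lambda> * \<rho> k). H y \<partial>\<mu>) = top" if w: "w \<in> E" for w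
      proof (rule ccontr)
        assume no: "\<not> ?thesis"
        \<comment> \<open>The oscillations \<open>C * s k * \<rho> k\<close> then decay like
          \<open>2 powr (- \<epsilon>)\<close>, and \<open>\<epsilon>\<close> is such that
          \<open>s k powr q\<close> times the weight scales as \<open>\<rho> k powr (- t)\<close>,
          the power in the Hausdorff content.\<close>
        define s where "s k = \<sigma>c * a * (2 powr (- \<epsilon>)) ^ k / \<rho> k" for k
        have s: "0 < s k" for k using \<sigma>c a0 \<rho>(1)[of k] by (simp add: s_def)
        have sq: "s k powr q * (\<Lambda> * \<rho> k) powr \<gamma> = c1 * a powr q * R powr (- (\<epsilon> * q)) * \<rho> k powr (- t)" for k
        proof -
          have two: "(2 powr (- \<epsilon>)) ^ k = \<rho> k powr \<epsilon> * (4 powr (- \<epsilon>) * R powr (- \<epsilon>))"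
          proof -
            have "\<rho> k powr \<epsilon> = (4 * R) powr \<epsilon> / (2 ^ k) powr \<epsilon>" unfolding \<rho>_def by (rule powr_divide)
            moreover have "(2 ^ k) powr \<epsilon> = (2 powr \<epsilon>) ^ k" by (simp add: powr_power powr_realpow[symmetric] powr_powr mult.commute)
            moreover have "(2 powr (- \<epsilon>)) ^ k = 1 / (2 powr \<epsilon>) ^ k" by (simp add: powr_minus_divide power_one_over)
            moreover have "(4 * R) powr \<epsilon> * (4 powr (- \<epsilon>) * R powr (- \<epsilon>)) = 1"
              using R by (simp add: powr_mult powr_minus field_simps)
            ultimately show ?thesis by simp
          qed
          have "s k powr q = (\<sigma>c * a * (\<rho> k powr \<epsilon> * (4 powr (- \<epsilon>) * R powr (- \<epsilon>)))) powr q / \<rho> k powr q"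
            unfolding s_def two by (rule powr_divide)
          also have "\<dots> = \<sigma>c powr q * a powr q * (\<rho> k powr (\<epsilon> * q) * (4 powr (- (\<epsilon> * q)) * R powr (- (\<epsilon> * q)))) * \<rho> k powr (- q)"
            using \<sigma>c a0 R \<rho>(1)[of k] by (simp add: powr_mult powr_powr divide_powr_uminus)
          finally have "s k powr q * (\<Lambda> * \<rho> k) powr \<gamma>
            = \<sigma>c powr q * a powr q * 4 powr (- (\<epsilon> * q)) * R powr (- (\<epsilon> * q)) * \<Lambda> powr \<gamma>
               * (\<rho> k powr (\<epsilon> * q) * \<rho> k powr (- q) * \<rho> k powr \<gamma>)"
            using \<Lambda> \<rho>(1)[of k] by (simp add: powr_mult ac_simps)
          also have "\<rho> k powr (\<epsilon> * q) * \<rho> k powr (- q) * \<rho> k powr \<gamma> = \<rho> k powr (- t)"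
            by (simp add: powr_add[symmetric] \<epsilon>q)
          finally show ?thesis by (simp add: c1_def ac_simps)
        qed
        have oscw: "osc \<theta> u w (4 * R / 2 ^ k) (C * s k * \<rho> k)" for k
          unfolding \<rho>_def[symmetric]
        proof (rule IP[OF Lex ug \<rho>(1) s])
          let ?I = "\<integral>\<^sup>+y\<in>ball w (\<Lambda> * \<rho> k). H y \<partial>\<mu>"
          have \<Lambda>\<rho>: "0 < \<Lambda> * \<rho> k" using \<Lambda> \<rho>(1)[of k] by simp
          have Ifin: "?I \<noteq> top" and Ile: "enn2real ?I \<le> s k powr q * (\<Lambda> * \<rho> k) powr \<gamma> * V w (\<rho> k)"
            using no unfolding sq by (auto simp: not_less mult.assoc)
          have "(\<integral>\<^sup>+y\<in>ball w (\<Lambda> * \<rho> k). epowr (g y * indicator \<Omega> y) q \<partial>\<mu>)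
            \<le> ennreal ((\<Lambda> * \<rho> k) powr (- \<gamma>)) * ?I"
          proof (rule intH[OF \<Lambda>\<rho>])
            \<comment> \<open>The centre \<open>w\<close> is a boundary point, so boundary distances
              in this ball are bounded by its own radius rather than by \<open>R\<close>; this gives
              the weight the right scaling.\<close>
            fix y assume "y \<in> ball w (\<Lambda> * \<rho> k)"
            moreover have "dist_bdry \<Omega> y \<le> dist y w" unfolding dist_bdry_def
              by (rule infdist_le) (use w in \<open>simp add: E_def\<close>)
            ultimately show "dist_bdry \<Omega> y \<le> \<Lambda> * \<rho> k" by (simp add: dist_commute)
          qed
          also have "?I = ennreal (enn2real ?I)" using Ifin by (simp add: less_top)
          also have "ennreal ((\<Lambda> * \<rho> k) powr (- \<gamma>)) * ennreal (enn2real ?I)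
            \<le> ennreal ((\<Lambda> * \<rho> k) powr (- \<gamma>)) * ennreal (s k powr q * (\<Lambda> * \<rho> k) powr \<gamma> * V w (\<rho> k))"
            by (intro mult_left_mono ennreal_leI Ile) simp
          also have "\<dots> = ennreal (s k powr q * V w (\<rho> k) * ((\<Lambda> * \<rho> k) powr (- \<gamma>) * (\<Lambda> * \<rho> k) powr \<gamma>))"
            by (simp add: ennreal_mult ac_simps)
          also have "(\<Lambda> * \<rho> k) powr (- \<gamma>) * (\<Lambda> * \<rho> k) powr \<gamma> = 1"
            unfolding powr_add[symmetric] using \<Lambda>\<rho> \<rho>(1)[of k] \<Lambda> by simp
          also have "ennreal (s k powr q * V w (\<rho> k) * 1) = ennreal (s k powr q) * emeasure \<mu> (ball w (\<rho> k))"
            using \<rho>(1)[of k] by (simp add: emeasure_ball ennreal_mult)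
          finally show "(\<integral>\<^sup>+y\<in>ball w (\<Lambda> * \<rho> k). epowr (g y * indicator \<Omega> y) q \<partial>\<mu>)
            \<le> ennreal (s k powr q) * emeasure \<mu> (ball w (\<rho> k))" .
        qed
        have sumw: "(\<lambda>k. C * s k * \<rho> k) sums (a / 4)"
        proof -
          have "(\<lambda>k. C * \<sigma>c * a * (2 powr (- \<epsilon>)) ^ k) sums (C * \<sigma>c * a * (1 / (1 - 2 powr (- \<epsilon>))))"
            using tw by (intro sums_mult geometric_sums) simp
          moreover have "C * \<sigma>c * a * (1 / (1 - 2 powr (- \<epsilon>))) = a / 4"
          proof -
            have "1 - 2 powr (- \<epsilon>) \<noteq> 0" using tw by linarith
            then show ?thesis using C unfolding \<sigma>c_def by (simp add: field_simps)
          qed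
          moreover have "C * \<sigma>c * a * (2 powr (- \<epsilon>)) ^ k = C * s k * \<rho> k" for k
            using \<rho>(1)[of k] by (simp add: s_def)
          ultimately show ?thesis by (simp only:)
        qed
        have "w \<notin> \<Omega>" using w \<Omega>(1) by (simp add: E_def frontier_def interior_open)
        then have "u w = 0" by (rule u0)
        moreover have "\<bar>u x - u w\<bar> \<le> 2 * C * sx * R + a / 4"
          by (rule osc_two_point[OF uc R _ \<theta> oscx sumx oscw sumw]) (use w in \<open>simp add: E_def\<close>)
        ultimately show False using False a0 by (simp add: a_def)
      qed
      have "\<forall>w\<in>E. \<exists>k. c1 * a powr q * R powr (- (\<epsilon> * q)) * (\<rho> k powr (- t) * V w (\<rho> k))
          < enn2real (\<integral>\<^sup>+y\<in>ball w (\<Lambda> * \<rho> k). H y \<partial>\<mu>) \<or>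
          (\<integral>\<^sup>+y\<in>ball w (\<Lambda> * \<rho> k). H y \<partial>\<mu>) = top" using key by blast
      from bchoice[OF this] obtain k where k: "\<forall>w\<in>E. c1 * a powr q * R powr (- (\<epsilon> * q)) * (\<rho> (k w) powr (- t) * V w (\<rho> (k w)))
          < enn2real (\<integral>\<^sup>+y\<in>ball w (\<Lambda> * \<rho> (k w)). H y \<partial>\<mu>) \<or>
          (\<integral>\<^sup>+y\<in>ball w (\<Lambda> * \<rho> (k w)). H y \<partial>\<mu>) = top" by (rule exE)
      have big: "(\<integral>\<^sup>+y\<in>ball x (6 * \<Lambda> * R). H y \<partial>\<mu>) \<le> ennreal (m * V x (6 * \<Lambda> * R))"
        by (rule maxf) (use \<Lambda> R in auto)
      \<comment> \<open>The radii at \<open>w\<close> are at most \<open>4 * \<Lambda> * R\<close>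
        and \<open>w\<close> is within \<open>2 * R\<close> of \<open>x\<close>, whence the factor 6
        in the range of the maximal function.\<close>
      have subx: "ball w (\<Lambda> * \<rho> i) \<subseteq> ball x (6 * \<Lambda> * R)" if w: "w \<in> E" for w i
      proof
        fix y assume "y \<in> ball w (\<Lambda> * \<rho> i)"
        then have "dist w y < \<Lambda> * \<rho> i" by simp
        also have "\<Lambda> * \<rho> i \<le> \<Lambda> * (4 * R)" using \<Lambda> \<rho>(2)[of i] by (intro mult_left_mono) auto
        finally have "dist w y < 4 * \<Lambda> * R" by simp
        moreover have "dist x w \<le> 2 * R" using w by (simp add: E_def)
        moreover have "R \<le> \<Lambda> * R" using \<Lambda> R by simp
        ultimately show "y \<in> ball x (6 * \<Lambda> * R)" using dist_triangle[of x y w] by simp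
      qed
      define I where "I w = (\<integral>\<^sup>+y\<in>ball w (\<Lambda> * \<rho> (k w)). H y \<partial>\<mu>)" for w
      define B where "B = c1 * a powr q * R powr (- (\<epsilon> * q))"
      have B0: "0 < B" using c1 a0 R by (simp add: B_def)
      have Ige: "ennreal (B * (\<rho> (k w) powr (- t) * V w (\<rho> (k w)))) \<le> I w" if w: "w \<in> E" for w
      proof -
        have "I w \<le> (\<integral>\<^sup>+y\<in>ball x (6 * \<Lambda> * R). H y \<partial>\<mu>)"
          unfolding I_def by (rule nn_integral_mono) (use subx[OF w, of "k w"] in \<open>auto simp: indicator_def\<close>)
        then have fin: "I w \<noteq> top" using big by (auto simp: top_unique)
        then have "B * (\<rho> (k w) powr (- t) * V w (\<rho> (k w))) < enn2real (I w)"
          using k w unfolding B_def I_def by auto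
        then have "ennreal (B * (\<rho> (k w) powr (- t) * V w (\<rho> (k w)))) \<le> ennreal (enn2real (I w))"
          by (intro ennreal_leI) simp
        also have "\<dots> = I w" using fin by (intro ennreal_enn2real) (simp add: less_top)
        finally show ?thesis .
      qed
      have Vx: "V x (6 * \<Lambda> * R) \<le> D ^ j * V x R"
        by (rule V_compare) (use \<Lambda> R mult_right_mono[OF j, of R] in auto)
      \<comment> \<open>Both remaining cases end with an upper bound for
        \<open>B * R powr (- t)\<close>; this unfolds \<open>B\<close> and recombines the powers of
        \<open>R\<close>.\<close>
      have conv: "a powr q \<le> X * m * R powr (q * \<kappa>)" if "B * R powr (- t) \<le> X * (m * c1)" for X
      proof -
        have "c1 * a powr q = B * R powr (- t) * (R powr (\<epsilon> * q) * R powr t)"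
          unfolding B_def using R by (simp add: powr_minus field_simps)
        also have "\<dots> \<le> X * (m * c1) * (R powr (\<epsilon> * q) * R powr t)" by (rule mult_right_mono[OF that]) simp
        finally have "c1 * a powr q \<le> c1 * (X * m * R powr (q * \<kappa>))" unfolding Rpow by (simp add: ac_simps)
        then show ?thesis using c1 by simp
      qed
      show ?thesis
      \<comment> \<open>A scale below \<open>j\<close> means a bad ball comparable to the big ball
        about \<open>x\<close>; otherwise all bad balls remain below radius \<open>R\<close> after
        the enlargement in the covering lemma.\<close>
      proof (cases "\<exists>w\<in>E. k w < j")
        case True
        then obtain w where w: "w \<in> E" "k w < j" by blast
        have "ennreal (B * (\<rho> (k w) powr (- t) * V w (\<rho> (k w)))) \<le> I w" by (rule Ige[OF w(1)])
        also have "I w \<le> (\<integral>\<^sup>+y\<in>ball x (6 * \<Lambda> * R). H y \<partial>\<mu>)"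
          unfolding I_def by (rule nn_integral_mono) (use subx[OF w(1), of "k w"] in \<open>auto simp: indicator_def\<close>)
        also have "\<dots> \<le> ennreal (m * V x (6 * \<Lambda> * R))" by (rule big)
        finally have 1: "B * (\<rho> (k w) powr (- t) * V w (\<rho> (k w))) \<le> m * V x (6 * \<Lambda> * R)"
          using m by (simp add: ennreal_le_iff)
        have 2: "V x (6 * \<Lambda> * R) \<le> D ^ (2 * j) * V w (\<rho> (k w))"
        proof (rule V_compare)
          show "0 < \<rho> (k w)" "0 < 6 * \<Lambda> * R" using \<rho>(1) \<Lambda> R by auto
          have "dist w x + 6 * \<Lambda> * R \<le> 8 * \<Lambda> * R"
          proof -
            have "dist w x \<le> 2 * R" using w by (simp add: E_def dist_commute)
            moreover have "R \<le> \<Lambda> * R" using \<Lambda> R by simp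
            ultimately have "dist w x + 6 * (\<Lambda> * R) \<le> 8 * (\<Lambda> * R)" by linarith
            then show ?thesis by (simp add: mult.assoc)
          qed
          also have "\<dots> \<le> 2 ^ j * (4 * R)" using mult_right_mono[OF j, of R] R \<Lambda> by simp
          also have "\<dots> = 2 ^ (2 * j) * (4 * R / 2 ^ j)" by (simp add: mult_2 power_add)
          also have "\<dots> \<le> 2 ^ (2 * j) * \<rho> (k w)"
            unfolding \<rho>_def using w(2) R by (intro mult_left_mono divide_left_mono power_increasing) auto
          finally show "dist w x + 6 * \<Lambda> * R \<le> 2 ^ (2 * j) * \<rho> (k w)" .
        qed
        have 3: "(4 * R) powr (- t) \<le> \<rho> (k w) powr (- t)" using \<rho>[of "k w"] t by (intro powr_mono2') auto
        have "B * (4 * R) powr (- t) * V w (\<rho> (k w)) \<le> B * \<rho> (k w) powr (- t) * V w (\<rho> (k w))"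
          using B0 3 by (intro mult_right_mono mult_left_mono) auto
        also have "\<dots> \<le> m * V x (6 * \<Lambda> * R)" using 1 by (simp add: mult.assoc)
        also have "\<dots> \<le> m * (D ^ (2 * j) * V w (\<rho> (k w)))" using 2 m by (intro mult_left_mono) auto
        finally have "B * (4 * R) powr (- t) * V w (\<rho> (k w)) \<le> (m * D ^ (2 * j)) * V w (\<rho> (k w))" by simp
        then have "B * (4 * R) powr (- t) \<le> m * D ^ (2 * j)"
          using V_pos[OF \<rho>(1)[of "k w"], of w] by (simp only: mult_le_cancel_right_pos)
        then have "4 powr t * (B * (4 * R) powr (- t)) \<le> 4 powr t * (m * D ^ (2 * j))" by (intro mult_left_mono) auto
        moreover have "4 powr t * (B * (4 * R) powr (- t)) = B * R powr (- t)"
          using R by (simp add: powr_mult powr_minus field_simps)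
        moreover have "4 powr t * (m * D ^ (2 * j)) = Nb * (m * c1)" using c1 by (simp add: Nb_def)
        ultimately have "B * R powr (- t) \<le> Nb * (m * c1)" by simp
        from conv[OF this] show ?thesis by (rule goal) simp
      next
        case False
        have Ec: "compact E" unfolding E_def using compact_cball by (intro closed_Int_compact frontier_closed)
        have "E \<subseteq> (\<Union>w\<in>E. ball w (\<Lambda> * \<rho> (k w)))" using \<Lambda> \<rho>(1) by (force intro!: mult_pos_pos)
        then obtain W where W: "W \<subseteq> E" "finite W" "E \<subseteq> (\<Union>w\<in>W. ball w (\<Lambda> * \<rho> (k w)))"
          by (rule compactE_image[OF Ec open_ball])
        \<comment> \<open>Disjointness lets the integrals over the bad balls add up inside the big
          ball, while the tripled balls still cover \<open>E\<close>.\<close>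
        obtain J where J: "J \<subseteq> W" "disjoint_family_on (\<lambda>w. ball w (\<Lambda> * \<rho> (k w))) J"
          "\<forall>w\<in>W. \<exists>w'\<in>J. ball w (\<Lambda> * \<rho> (k w)) \<subseteq> ball w' (3 * (\<Lambda> * \<rho> (k w')))"
          using finite_vitali[OF W(2), of "\<lambda>w. w" "\<lambda>w. \<Lambda> * \<rho> (k w)"] by blast
        have fJ: "finite J" using J(1) W(2) finite_subset by blast
        have JE: "w \<in> E" if "w \<in> J" for w using that J(1) W(1) by blast
        have cover: "E \<subseteq> (\<Union>w\<in>J. ball w (3 * (\<Lambda> * \<rho> (k w))))" using W(3) J(3) by fastforce
        \<comment> \<open>This makes the enlarged balls admissible for the content at scale
          \<open>R\<close>.\<close>
        have \<rho>small: "3 * (\<Lambda> * \<rho> (k w)) \<le> R" if "w \<in> E" for w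
        proof -
          have "j \<le> k w" using False that by (simp add: not_less)
          then have "\<rho> (k w) \<le> 4 * R / 2 ^ j" unfolding \<rho>_def using R by (intro divide_left_mono power_increasing) auto
          then have "3 * (\<Lambda> * \<rho> (k w)) \<le> 3 * (\<Lambda> * (4 * R / 2 ^ j))" using \<Lambda> by (intro mult_left_mono) auto
          also have "\<dots> \<le> R" using mult_right_mono[OF j, of R] R \<Lambda> by (simp add: divide_le_eq)
          finally show ?thesis .
        qed
        have sumI: "(\<Sum>w\<in>J. I w) \<le> ennreal (m * V x (6 * \<Lambda> * R))"
        proof -
          have "(\<Sum>w\<in>J. I w) = (\<integral>\<^sup>+y. (\<Sum>w\<in>J. H y * indicator (ball w (\<Lambda> * \<rho> (k w))) y) \<partial>\<mu>)"
            unfolding I_def by (rule nn_integral_sum[symmetric]) measurable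
          also have "\<dots> = (\<integral>\<^sup>+y\<in>\<Union>w\<in>J. ball w (\<Lambda> * \<rho> (k w)). H y \<partial>\<mu>)"
            by (rule nn_integral_cong) (simp add: indicator_UN_disjoint[OF fJ J(2)] sum_distrib_left)
          also have "\<dots> \<le> (\<integral>\<^sup>+y\<in>ball x (6 * \<Lambda> * R). H y \<partial>\<mu>)"
            by (rule nn_integral_mono) (use subx JE in \<open>fastforce simp: indicator_def\<close>)
          finally show ?thesis using big by (rule order_trans)
        qed
        have "ennreal (C0 * V x R * R powr (- t)) = ennreal C0 * emeasure \<mu> (ball x R) * ennreal (R powr (- t))"
          using R C0 by (simp add: emeasure_ball ennreal_mult)
        also have "\<dots> \<le> ennreal C0 * emeasure \<mu> (cball x R) * ennreal (R powr (- t))"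
          by (intro mult_right_mono mult_left_mono emeasure_mono) (auto simp: sets_eq)
        also have "\<dots> \<le> haus_content \<mu> t R E" using content x unfolding E_def R_def by blast
        also have "\<dots> \<le> (\<Sum>w\<in>J. emeasure \<mu> (ball w (3 * (\<Lambda> * \<rho> (k w)))) * ennreal ((3 * (\<Lambda> * \<rho> (k w))) powr (- t)))"
          by (rule haus_content_finite_cover[OF fJ _ _ cover]) (use \<rho>small JE \<Lambda> \<rho>(1) R in \<open>auto simp: less_imp_le\<close>)
        also have "\<dots> \<le> (\<Sum>w\<in>J. ennreal (D ^ j / B) * I w)"
        proof (rule sum_mono)
          fix w assume wJ: "w \<in> J"
          let ?\<rho> = "\<rho> (k w)"
          have r3: "0 < 3 * (\<Lambda> * ?\<rho>)" using \<Lambda> \<rho>(1)[of "k w"] by simp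
          have "emeasure \<mu> (ball w (3 * (\<Lambda> * ?\<rho>))) * ennreal ((3 * (\<Lambda> * ?\<rho>)) powr (- t))
            = ennreal (V w (3 * (\<Lambda> * ?\<rho>)) * (3 * (\<Lambda> * ?\<rho>)) powr (- t))"
            using r3 by (simp add: emeasure_ball ennreal_mult)
          also have "\<dots> \<le> ennreal ((D ^ j * V w ?\<rho>) * ?\<rho> powr (- t))"
          proof (intro ennreal_leI mult_mono)
            have "3 * (\<Lambda> * ?\<rho>) \<le> 2 ^ j * ?\<rho>" using mult_right_mono[OF j, of ?\<rho>] \<rho>(1)[of "k w"] \<Lambda> by simp
            then show "V w (3 * (\<Lambda> * ?\<rho>)) \<le> D ^ j * V w ?\<rho>" using r3 \<rho>(1) by (intro V_compare) auto
            have "?\<rho> \<le> \<Lambda> * ?\<rho>" using \<Lambda> \<rho>(1)[of "k w"] by simp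
            then have "?\<rho> \<le> 3 * (\<Lambda> * ?\<rho>)" using \<rho>(1)[of "k w"] by linarith
            \<comment> \<open>Enlarging the radius can only decrease this power, because
              \<open>t\<close> is nonnegative; only the measure has to be compared by
              doubling.\<close>
            then show "(3 * (\<Lambda> * ?\<rho>)) powr (- t) \<le> ?\<rho> powr (- t)" using \<rho>(1)[of "k w"] t by (intro powr_mono2') auto
          qed (use D0 in auto)
          also have "\<dots> = ennreal (D ^ j / B) * ennreal (B * (?\<rho> powr (- t) * V w ?\<rho>))"
            using B0 D0 by (simp add: ennreal_mult[symmetric] ac_simps)
          also have "\<dots> \<le> ennreal (D ^ j / B) * I w" by (rule mult_left_mono[OF Ige[OF JE[OF wJ]]]) simp
          finally show "emeasure \<mu> (ball w (3 * (\<Lambda> * ?\<rho>))) * ennreal ((3 * (\<Lambda> * ?\<rho>)) powr (- t)) \<le> ennreal (D ^ j / B) * I w" .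
        qed
        also have "\<dots> = ennreal (D ^ j / B) * (\<Sum>w\<in>J. I w)" by (simp add: sum_distrib_left)
        also have "\<dots> \<le> ennreal (D ^ j / B) * ennreal (m * (D ^ j * V x R))"
        proof (rule mult_left_mono)
          show "(\<Sum>w\<in>J. I w) \<le> ennreal (m * (D ^ j * V x R))"
            by (rule order_trans[OF sumI]) (intro ennreal_leI mult_left_mono Vx, use m in simp)
        qed simp
        also have "\<dots> = ennreal (D ^ j / B * (m * (D ^ j * V x R)))"
          by (rule ennreal_mult[symmetric]) (use B0 D0 m in auto)
        finally have "C0 * V x R * R powr (- t) \<le> D ^ j / B * (m * (D ^ j * V x R))"
          using B0 D0 m by (subst (asm) ennreal_le_iff) (auto intro!: mult_nonneg_nonneg divide_nonneg_nonneg)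
        then have "(C0 * R powr (- t)) * V x R \<le> (D ^ j / B * m * D ^ j) * V x R" by (simp add: ac_simps)
        then have "C0 * R powr (- t) \<le> D ^ j / B * m * D ^ j"
          using V_pos[OF R, of x] by (simp only: mult_le_cancel_right_pos)
        then have "B * R powr (- t) \<le> (D ^ j * D ^ j) * m / C0" using B0 C0 by (simp add: field_simps)
        also have "\<dots> = Nc * (m * c1)" using c1 C0 by (simp add: Nc_def mult_2 power_add)
        finally have "B * R powr (- t) \<le> Nc * (m * c1)" .
        from conv[OF this] show ?thesis by (rule goal) simp
      qed
    qed
    then show "\<bar>u x\<bar> powr q \<le> (Na + Nb + Nc) * m * dist_bdry \<Omega> x powr (q * (1 - \<beta> / p))"
      by (simp add: a_def R_def \<kappa>_def)
  qed
qed

end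

section \<open>Choice of the exponent and passage to the maximal function\<close>

theorem theorem4p2:
  fixes \<mu> :: "'a::complete_space measure" and \<Omega> :: "'a set" and p \<beta> t C0 :: real
  assumes "sets \<mu> = sets borel"
    and "doubling_measure \<mu>"
    and "1 < p"
    and "weak_poincare \<mu> p"
    and "open \<Omega>" and "frontier \<Omega> \<noteq> {}"
    and "\<beta> \<le> 0"
    and "0 \<le> t" and "t < p - \<beta>" and "C0 > 0"
    and "\<forall>x\<in>\<Omega>. haus_content \<mu> t (dist_bdry \<Omega> x) (frontier \<Omega> \<inter> cball x (2 * dist_bdry \<Omega> x))
              \<ge> ennreal C0 * emeasure \<mu> (cball x (dist_bdry \<Omega> x)) * ennreal (dist_bdry \<Omega> x powr (- t))"
  shows "pointwise_hardy \<mu> \<Omega> p \<beta>"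
proof -
  note p = assms(3)
  obtain Cd where Cd: "\<And>x r. 0 < r \<Longrightarrow> emeasure \<mu> (ball x (2 * r)) \<le> ennreal Cd * emeasure \<mu> (ball x r)"
    using assms(2) unfolding doubling_measure_def by blast
  define D where "D = max 1 Cd"
  interpret doubling_space \<mu> D
  proof
    show "sets \<mu> = sets borel" "1 \<le> D" by (simp_all add: assms(1) D_def)
    fix r :: real and x assume r: "0 < r"
    show "0 < emeasure \<mu> (ball x r)" "emeasure \<mu> (ball x r) < \<infinity>"
      using assms(2) r unfolding doubling_measure_def by blast+
    have "ennreal Cd \<le> ennreal D" by (rule ennreal_leI) (simp add: D_def)
    then show "emeasure \<mu> (ball x (2 * r)) \<le> ennreal D * emeasure \<mu> (ball x r)"
      using Cd[OF r, of x] by (meson mult_right_mono order_trans zero_le)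
  qed
  obtain \<Lambda> q0 where \<Lambda>: "1 \<le> \<Lambda>" and q0: "1 \<le> q0" "q0 < p"
    and IP: "\<And>\<theta>. 0 < \<theta> \<Longrightarrow> \<exists>C>0. \<forall>q u g c r s. q0 < q \<longrightarrow> q < p \<longrightarrow> (\<exists>L. L-lipschitz_on UNIV u) \<longrightarrow>
       upper_gradient_on UNIV u g \<longrightarrow> 0 < r \<longrightarrow> 0 < s \<longrightarrow>
       (\<integral>\<^sup>+y\<in>ball c (\<Lambda> * r). epowr (g y) q \<partial>\<mu>) \<le> ennreal (s powr q) * emeasure \<mu> (ball c r) \<longrightarrow>
       osc \<theta> u c r (C * s * r)"
    using improved_poincare[OF p assms(4)] unfolding osc_def by blast
  \<comment> \<open>Makes the product in the common point condition equal to 1/2.\<close>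
  define \<theta> where "\<theta> = 1 / (2 * (D ^ 3 + 1))"
  have D3: "0 < D ^ 3 + 1" using D_ge_1 by (simp add: add_nonneg_pos)
  then have \<theta>: "0 < \<theta>" "0 \<le> \<theta>" "\<theta> * (D ^ 3 + 1) < 1" by (simp_all add: \<theta>_def)
  obtain C where C: "0 < C" and IP': "\<forall>q u g c r s. q0 < q \<longrightarrow> q < p \<longrightarrow> (\<exists>L. L-lipschitz_on UNIV u) \<longrightarrow>
       upper_gradient_on UNIV u g \<longrightarrow> 0 < r \<longrightarrow> 0 < s \<longrightarrow>
       (\<integral>\<^sup>+y\<in>ball c (\<Lambda> * r). epowr (g y) q \<partial>\<mu>) \<le> ennreal (s powr q) * emeasure \<mu> (ball c r) \<longrightarrow>
       osc \<theta> u c r (C * s * r)"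
    using IP[OF \<theta>(1)] by blast
  define \<kappa> where "\<kappa> = 1 - \<beta> / p"
  have "\<beta> / p \<le> 0" using assms(7) p by (simp add: divide_nonpos_pos)
  then have \<kappa>: "0 < \<kappa>" by (simp add: \<kappa>_def)
  have "t / \<kappa> < p"
  proof -
    have "p * \<kappa> = p - \<beta>" using p by (simp add: \<kappa>_def right_diff_distrib)
    then show ?thesis using \<kappa> assms(9) by (simp add: divide_less_eq)
  qed
  \<comment> \<open>Two lower constraints on \<open>q\<close>: the range of the improved Poincare
    inequality, and \<open>t / \<kappa>\<close>, which is below \<open>p\<close> because
    \<open>t < p - \<beta>\<close>. The midpoint with \<open>p\<close> satisfies both.\<close>
  define q' where "q' = max q0 (t / \<kappa>)"
  define q where "q = (q' + p) / 2"
  have q: "q0 < q" "q < p" "t / \<kappa> < q"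
  proof -
    have m: "q0 \<le> q'" "t / \<kappa> \<le> q'" "q' < p"
      unfolding q'_def using q0(2) \<open>t / \<kappa> < p\<close> by simp_all
    have "q' < q" "q < p" unfolding q_def using m(3) by simp_all
    then show "q0 < q" "q < p" "t / \<kappa> < q" using m(1,2) le_less_trans by blast+
  qed
  have q1: "1 < q" using q q0 by simp
  have tq: "t < q * (1 - \<beta> / p)" using q(3) \<kappa> by (simp add: divide_less_eq flip: \<kappa>_def)
  obtain N where N: "0 < N" and est: "\<forall>u\<in>Lip0 \<Omega>. \<forall>g x m. upper_gradient_on \<Omega> u g \<longrightarrow> x \<in> \<Omega> \<longrightarrow> 0 < m \<longrightarrow>
     (\<forall>r. 0 < r \<longrightarrow> r \<le> 6 * \<Lambda> * dist_bdry \<Omega> x \<longrightarrow>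
       (\<integral>\<^sup>+y\<in>ball x r. hardy_weight \<Omega> q (\<beta> * q / p) g y \<partial>\<mu>) \<le> ennreal m * emeasure \<mu> (ball x r)) \<longrightarrow>
     \<bar>u x\<bar> powr q \<le> N * m * dist_bdry \<Omega> x powr (q * (1 - \<beta> / p))"
    using hardy_estimate[OF assms(5-8,10,11) p q1 tq \<Lambda> C \<theta>(2,3)] IP' q by blast
  show ?thesis
    unfolding pointwise_hardy_def
  proof (intro exI conjI allI impI)
    show "1 < q" "q < p" "0 < N powr (1 / q)" "1 \<le> 6 * \<Lambda>" using q1 q(2) N \<Lambda> by auto
    fix u g x
    assume as: "u \<in> Lip0 \<Omega> \<and> upper_gradient_on \<Omega> u g \<and> x \<in> \<Omega>"
    define R where "R = dist_bdry \<Omega> x"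
    have R: "0 < R" unfolding R_def by (rule dist_bdry_pos) (use assms as in auto)
    define Mx where "Mx = max_fun \<mu> (6 * \<Lambda> * R) (hardy_weight \<Omega> q (\<beta> * q / p) g) x"
    have "ennreal \<bar>u x\<bar> \<le> ennreal (N powr (1 / q) * R powr \<kappa>) * epowr Mx (1 / q)"
    proof (cases Mx)
      \<comment> \<open>The factor in front is positive, so the right side is infinite.\<close>
      case top
      have "0 < N powr (1 / q) * R powr \<kappa>" using N R by simp
      then show ?thesis using top by (simp add: epowr_def ennreal_mult_top ennreal_eq_0_iff)
    next
      case (real m0)
      \<comment> \<open>The estimate requires a positive \<open>m\<close>, while the maximal
        function may vanish; \<open>e\<close> is sent to 0 afterwards.\<close>
      have "\<bar>u x\<bar> powr q \<le> N * (m0 + e) * R powr (q * \<kappa>)" if e: "0 < e" for e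
      proof -
        have "(\<integral>\<^sup>+y\<in>ball x r. hardy_weight \<Omega> q (\<beta> * q / p) g y \<partial>\<mu>) \<le> ennreal (m0 + e) * emeasure \<mu> (ball x r)"
          if r: "0 < r" "r \<le> 6 * \<Lambda> * R" for r
        proof -
          let ?I = "\<integral>\<^sup>+y\<in>ball x r. hardy_weight \<Omega> q (\<beta> * q / p) g y \<partial>\<mu>"
          have "?I / emeasure \<mu> (ball x r) \<le> Mx" unfolding Mx_def max_fun_def
            by (rule SUP_upper) (use r in auto)
          also have "\<dots> \<le> ennreal (m0 + e)" using real e by (simp add: ennreal_leI)
          finally have "?I / emeasure \<mu> (ball x r) * emeasure \<mu> (ball x r) \<le> ennreal (m0 + e) * emeasure \<mu> (ball x r)"
            by (rule mult_right_mono) simp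
          then show ?thesis unfolding emeasure_ball[OF r(1)] using V_pos[OF r(1), of x]
            by (simp add: ennreal_divide_times ennreal_times_divide ennreal_divide_self)
        qed
        moreover have "0 < m0 + e" using real(1) e by simp
        ultimately show ?thesis using est as unfolding R_def \<kappa>_def by blast
      qed
      then have lim: "\<bar>u x\<bar> powr q - N * m0 * R powr (q * \<kappa>) \<le> N * R powr (q * \<kappa>) * e" if "0 < e" for e
        using that by (fastforce simp: algebra_simps)
      have NR: "0 < N * R powr (q * \<kappa>)" using N R by simp
      have "\<bar>u x\<bar> powr q - N * m0 * R powr (q * \<kappa>) \<le> 0"
      proof (rule field_le_epsilon)
        fix e :: real assume "0 < e"
        then have "0 < e / (N * R powr (q * \<kappa>))" using NR by (rule divide_pos_pos)
        note lim[OF this]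
        also have "N * R powr (q * \<kappa>) * (e / (N * R powr (q * \<kappa>))) = e"
          using NR by (metis less_irrefl nonzero_mult_div_cancel_left times_divide_eq_right)
        finally show "\<bar>u x\<bar> powr q - N * m0 * R powr (q * \<kappa>) \<le> 0 + e" by simp
      qed
      then have "\<bar>u x\<bar> powr q \<le> N * m0 * R powr (q * \<kappa>)" by simp
      then have "(\<bar>u x\<bar> powr q) powr (1 / q) \<le> (N * m0 * R powr (q * \<kappa>)) powr (1 / q)"
        using q1 by (intro powr_mono2) auto
      also have "(\<bar>u x\<bar> powr q) powr (1 / q) = \<bar>u x\<bar>" using q1 by (simp add: powr_powr)
      also have "(N * m0 * R powr (q * \<kappa>)) powr (1 / q) = N powr (1 / q) * R powr \<kappa> * m0 powr (1 / q)"
        using q1 N real(1) by (simp add: powr_mult powr_powr)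
      finally have "ennreal \<bar>u x\<bar> \<le> ennreal (N powr (1 / q) * R powr \<kappa> * m0 powr (1 / q))" by (rule ennreal_leI)
      also have "\<dots> = ennreal (N powr (1 / q) * R powr \<kappa>) * epowr Mx (1 / q)"
        using real by (simp add: epowr_ennreal ennreal_mult)
      finally show ?thesis .
    qed
    then show "ennreal \<bar>u x\<bar> \<le> ennreal (N powr (1 / q) * dist_bdry \<Omega> x powr (1 - \<beta> / p)) *
          epowr (max_fun \<mu> (6 * \<Lambda> * dist_bdry \<Omega> x)
                   (\<lambda>y. epowr (g y) q * ennreal (dist_bdry \<Omega> y powr (\<beta> * q / p)) * indicator \<Omega> y) x)
                (1 / q)"
      by (simp add: Mx_def R_def \<kappa>_def hardy_weight_def[abs_def])
  qed
qed

end
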